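(* Let $\mathcal U$ and $\mathcal X$ be complex Hilbert spaces and let $A\in\mathcal B(\mathcal X)$, $B\in\mathcal B(\mathcal U,\mathcal X)$, $C\in\mathcal B(\mathcal X,\mathcal U)$, $D\in\mathcal B(\mathcal U)$. Assume that $A$ is dichotomous and that $I+D$ is invertible. Let $$G(z)=I+F(z),\qquad F(z)=D+zC(I-zA)^{-1}B,$$ and assume that $\|F\|_{\infty,\mathbb T}:=\max_{z\in\mathbb T}\|F(z)\|<1$. Then $G$ has a right canonical Wiener-Hopf factorization $G(z)=V_-(z)V_+(z)$ on $\mathbb T$, i.e., $V_+(z)$ and $V_+(z)^{-1}$ are analytic on a neighborhood of the closed unit disc $\overline{\mathbb D}$, while $V_-(z)$ and $V_-(z)^{-1}$ are analytic on a neighborhood of $\overline{\mathbb E}$. There is also a left canonical Wiener-Hopf factorization $G(z)=W_+(z)W_-(z)$ on $\mathbb T$, where $W_+(z)$ and $W_+(z)^{-1}$ are analytic on a neighborhood of $\overline{\mathbb D}$, while $W_-(z)$ and $W_-(z)^{-1}$ are analytic on a neighborhood of $\overline{\mathbb E}$.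
   Context: $\mathcal B(\mathcal X,\mathcal Y)$ denotes the bounded linear operators from $\mathcal X$ to $\mathcal Y$, and $\mathcal B(\mathcal X)=\mathcal B(\mathcal X,\mathcal X)$. An operator is called invertible when it has a bounded inverse. $\mathbb T$ is the complex unit circle, $\mathbb D$ the open unit disc, $\mathbb E:=\mathbb C\setminus\overline{\mathbb D}$, and $\overline{\mathbb E}$ is its closure, the closed complement of $\mathbb D$. An operator $A\in\mathcal B(\mathcal X)$ is dichotomous if its spectrum $\sigma(A)$ is disjoint from $\mathbb T$. The function $F$ is defined for all $z\in\mathbb C$ such that $I-zA$ is invertible, in particular for $z\in\mathbb T$. All the factors $V_\pm$, $W_\pm$ are $\mathcal B(\mathcal U)$-valued functions. *)

theory Defs
  imports "HOL-Analysis.Analysis"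
begin

section \<open>Complex Hilbert spaces\<close>

class scaleC =
  fixes scaleC :: "complex \<Rightarrow> 'a \<Rightarrow> 'a"  (infixr \<open>*\<^sub>C\<close> 75)

text \<open>The class extends \<^class>\<open>real_vector\<close> so that the analysis library applies;
  \<open>scaleR_scaleC\<close> says that the real structure is the restriction of the complex one.\<close>

class complex_vector = real_vector + scaleC +
  assumes scaleC_add_right: "a *\<^sub>C (x + y) = a *\<^sub>C x + a *\<^sub>C y"
    and scaleC_add_left: "(a + b) *\<^sub>C x = a *\<^sub>C x + b *\<^sub>C x"
    and scaleC_scaleC: "a *\<^sub>C (b *\<^sub>C x) = (a * b) *\<^sub>C x"
    and scaleR_scaleC: "r *\<^sub>R x = complex_of_real r *\<^sub>C x"

class complex_normed_vector = real_normed_vector + complex_vector +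
  assumes norm_scaleC: "norm (a *\<^sub>C x) = cmod a * norm x"

text \<open>The inner product is linear in its first argument. Positive definiteness is
  contained in \<open>cinner_self\<close>, since \<^const>\<open>norm\<close> is a norm.\<close>

class complex_hilbert = complex_normed_vector + complete_space +
  fixes cinner :: "'a \<Rightarrow> 'a \<Rightarrow> complex"
  assumes cinner_commute: "cinner x y = cnj (cinner y x)"
    and cinner_add_left: "cinner (x + y) z = cinner x z + cinner y z"
    and cinner_scaleC_left: "cinner (a *\<^sub>C x) y = a * cinner x y"
    and cinner_self: "cinner x x = complex_of_real ((norm x)\<^sup>2)"

lemma scaleC_one: "1 *\<^sub>C x = (x :: 'a::complex_vector)"
  using scaleR_scaleC[of 1 x] by simp

lemma scaleC_zero_right: "a *\<^sub>C 0 = (0 :: 'a::complex_vector)"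
  using scaleC_add_right[of a 0 "0::'a"] by simp

lemma scaleC_minus_right: "a *\<^sub>C (- x) = - (a *\<^sub>C x :: 'a::complex_vector)"
  using scaleC_add_right[of a x "- x"] by (simp add: scaleC_zero_right eq_neg_iff_add_eq_0 add.commute)

lemma scaleC_diff_right: "a *\<^sub>C (x - y) = a *\<^sub>C x - (a *\<^sub>C y :: 'a::complex_vector)"
  using scaleC_add_right[of a x "- y"] by (simp add: scaleC_minus_right)

lemma bounded_linear_scaleC_right:
  "bounded_linear (\<lambda>x::'a::complex_normed_vector. a *\<^sub>C x)"
  by (rule bounded_linear_intro[where K = "cmod a"])
     (simp_all add: scaleC_add_right scaleR_scaleC scaleC_scaleC norm_scaleC mult.commute)

instantiation complex :: complex_hilbert
begin
definition scaleC_complex :: "complex \<Rightarrow> complex \<Rightarrow> complex" where "scaleC_complex a x = a * x"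
definition cinner_complex :: "complex \<Rightarrow> complex \<Rightarrow> complex" where "cinner_complex x y = x * cnj y"
instance
  by standard
    (simp_all add: scaleC_complex_def cinner_complex_def distrib_left distrib_right
      scaleR_conv_of_real norm_mult complex_mult_cnj cmod_power2)
end

section \<open>Bounded operators\<close>

typedef (overloaded) ('a, 'b) cblinfun (\<open>(_ \<Rightarrow>\<^sub>B /_)\<close> [22, 21] 21) =
  "{f :: 'a::complex_normed_vector \<Rightarrow> 'b::complex_normed_vector.
     bounded_linear f \<and> (\<forall>a x. f (a *\<^sub>C x) = a *\<^sub>C f x)}"
  morphisms cblinfun_apply Cblinfun
  by (rule exI[where x = "\<lambda>x. 0"]) (simp add: scaleC_zero_right)

setup_lifting type_definition_cblinfun

instantiation cblinfun :: (complex_normed_vector, complex_normed_vector) complex_normed_vector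
begin

lift_definition norm_cblinfun :: "'a \<Rightarrow>\<^sub>B 'b \<Rightarrow> real" is onorm .

lift_definition zero_cblinfun :: "'a \<Rightarrow>\<^sub>B 'b" is "\<lambda>x. 0"
  by (simp add: scaleC_zero_right)

lift_definition plus_cblinfun :: "'a \<Rightarrow>\<^sub>B 'b \<Rightarrow> 'a \<Rightarrow>\<^sub>B 'b \<Rightarrow> 'a \<Rightarrow>\<^sub>B 'b" is "\<lambda>f g x. f x + g x"
  by (simp add: bounded_linear_add scaleC_add_right)

lift_definition minus_cblinfun :: "'a \<Rightarrow>\<^sub>B 'b \<Rightarrow> 'a \<Rightarrow>\<^sub>B 'b \<Rightarrow> 'a \<Rightarrow>\<^sub>B 'b" is "\<lambda>f g x. f x - g x"
  by (simp add: bounded_linear_sub scaleC_diff_right)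

lift_definition uminus_cblinfun :: "'a \<Rightarrow>\<^sub>B 'b \<Rightarrow> 'a \<Rightarrow>\<^sub>B 'b" is "\<lambda>f x. - f x"
  by (simp add: bounded_linear_minus scaleC_minus_right)

lift_definition scaleC_cblinfun :: "complex \<Rightarrow> 'a \<Rightarrow>\<^sub>B 'b \<Rightarrow> 'a \<Rightarrow>\<^sub>B 'b" is "\<lambda>a f x. a *\<^sub>C f x"
  by (simp add: scaleC_scaleC mult.commute bounded_linear_compose[OF bounded_linear_scaleC_right])

lift_definition scaleR_cblinfun :: "real \<Rightarrow> 'a \<Rightarrow>\<^sub>B 'b \<Rightarrow> 'a \<Rightarrow>\<^sub>B 'b" is "\<lambda>r f x. r *\<^sub>R f x"
  by (simp add: scaleR_scaleC scaleC_scaleC mult.commute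
      bounded_linear_compose[OF bounded_linear_scaleC_right])

definition sgn_cblinfun :: "'a \<Rightarrow>\<^sub>B 'b \<Rightarrow> 'a \<Rightarrow>\<^sub>B 'b"
  where "sgn_cblinfun x = scaleR (inverse (norm x)) x"

definition dist_cblinfun :: "'a \<Rightarrow>\<^sub>B 'b \<Rightarrow> 'a \<Rightarrow>\<^sub>B 'b \<Rightarrow> real"
  where "dist_cblinfun a b = norm (a - b)"

definition
  "(uniformity :: (('a \<Rightarrow>\<^sub>B 'b) \<times> ('a \<Rightarrow>\<^sub>B 'b)) filter)
     = (INF e\<in>{0 <..}. principal {(x, y). dist x y < e})"

definition open_cblinfun :: "('a \<Rightarrow>\<^sub>B 'b) set \<Rightarrow> bool"
  where "open_cblinfun S = (\<forall>x\<in>S. \<forall>\<^sub>F (x', y) in uniformity. x' = x \<longrightarrow> y \<in> S)"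

instance
proof
  have aux: "onorm (\<lambda>x. a *\<^sub>C f x) = cmod a * onorm f"
    if f: "bounded_linear f" for a and f :: "'a \<Rightarrow> 'b"
  proof (rule antisym)
    show "onorm (\<lambda>x. a *\<^sub>C f x) \<le> cmod a * onorm f"
      by (rule onorm_bound)
         (simp_all add: norm_scaleC mult.assoc mult_left_mono onorm[OF f] onorm_pos_le[OF f])
  next
    show "cmod a * onorm f \<le> onorm (\<lambda>x. a *\<^sub>C f x)"
    proof (cases "a = 0")
      case True
      then show ?thesis
        using onorm_pos_le[OF bounded_linear_compose[OF bounded_linear_scaleC_right f, of a]] by simp
    next
      case False
      have bl: "bounded_linear (\<lambda>x. a *\<^sub>C f x)"
        by (rule bounded_linear_compose[OF bounded_linear_scaleC_right f])
      have "onorm f \<le> onorm (\<lambda>x. a *\<^sub>C f x) / cmod a"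
      proof (rule onorm_bound)
        show "0 \<le> onorm (\<lambda>x. a *\<^sub>C f x) / cmod a"
          using onorm_pos_le[OF bl] by simp
        show "norm (f x) \<le> onorm (\<lambda>x. a *\<^sub>C f x) / cmod a * norm x" for x
          using onorm[OF bl, of x] False by (simp add: norm_scaleC field_simps)
      qed
      then show ?thesis using False by (simp add: field_simps)
    qed
  qed
  show "norm (a *\<^sub>C x) = cmod a * norm x" for a and x :: "'a \<Rightarrow>\<^sub>B 'b"
    by transfer (simp add: aux)
next
  fix x y z :: "'a \<Rightarrow>\<^sub>B 'b" and a b :: complex and r s :: real
  show "a *\<^sub>C (x + y) = a *\<^sub>C x + a *\<^sub>C y" by transfer (simp add: scaleC_add_right)
  show "(a + b) *\<^sub>C x = a *\<^sub>C x + b *\<^sub>C x" by transfer (simp add: scaleC_add_left)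
  show "a *\<^sub>C b *\<^sub>C x = (a * b) *\<^sub>C x" by transfer (simp add: scaleC_scaleC)
  show "r *\<^sub>R x = complex_of_real r *\<^sub>C x" by transfer (simp add: scaleR_scaleC)
  show "r *\<^sub>R (x + y) = r *\<^sub>R x + r *\<^sub>R y" by transfer (simp add: scaleR_add_right)
  show "(r + s) *\<^sub>R x = r *\<^sub>R x + s *\<^sub>R x" by transfer (simp add: scaleR_add_left)
  show "r *\<^sub>R s *\<^sub>R x = (r * s) *\<^sub>R x" by transfer simp
  show "1 *\<^sub>R x = x" by transfer simp
  show "x + y + z = x + (y + z)" by transfer (simp add: add.assoc)
  show "x + y = y + x" by transfer (simp add: add.commute)
  show "0 + x = x" by transfer simp
  show "- x + x = 0" by transfer simp
  show "x - y = x + - y" by transfer simp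
  show "dist x y = norm (x - y)" by (rule dist_cblinfun_def)
  show "sgn x = inverse (norm x) *\<^sub>R x" by (rule sgn_cblinfun_def)
  show "norm x = 0 \<longleftrightarrow> x = 0" by transfer (auto simp: onorm_eq_0)
  show "norm (x + y) \<le> norm x + norm y" by transfer (simp add: onorm_triangle)
  show "norm (r *\<^sub>R x) = \<bar>r\<bar> * norm x" by transfer (simp add: onorm_scaleR)
qed (rule uniformity_cblinfun_def open_cblinfun_def)+

end

lift_definition id_cblinfun :: "'a::complex_normed_vector \<Rightarrow>\<^sub>B 'a" is "\<lambda>x. x"
  by simp

lift_definition cblinfun_compose ::
  "'b::complex_normed_vector \<Rightarrow>\<^sub>B 'c \<Rightarrow> 'a \<Rightarrow>\<^sub>B 'b \<Rightarrow> 'a::complex_normed_vector \<Rightarrow>\<^sub>B 'c::complex_normed_vector"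
  (infixl \<open>o\<^sub>B\<close> 67) is "\<lambda>f g x. f (g x)"
  using bounded_linear_compose by fastforce

lemma cblinfun_compose_assoc: "(f o\<^sub>B g) o\<^sub>B h = f o\<^sub>B (g o\<^sub>B h)"
  by transfer simp

lemma cblinfun_compose_id_left: "id_cblinfun o\<^sub>B f = f"
  by transfer simp

lemma cblinfun_compose_id_right: "f o\<^sub>B id_cblinfun = f"
  by transfer simp

definition is_inverse :: "'a \<Rightarrow>\<^sub>B 'b \<Rightarrow> 'b::complex_normed_vector \<Rightarrow>\<^sub>B 'a::complex_normed_vector \<Rightarrow> bool"
  where "is_inverse T S \<longleftrightarrow> S o\<^sub>B T = id_cblinfun \<and> T o\<^sub>B S = id_cblinfun"

definition op_invertible :: "'a::complex_normed_vector \<Rightarrow>\<^sub>B 'b::complex_normed_vector \<Rightarrow> bool"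
  where "op_invertible T \<longleftrightarrow> (\<exists>S. is_inverse T S)"

definition op_inv :: "'a \<Rightarrow>\<^sub>B 'b \<Rightarrow> 'b::complex_normed_vector \<Rightarrow>\<^sub>B 'a::complex_normed_vector"
  where "op_inv T = (THE S. is_inverse T S)"

lemma is_inverse_op_inv:
  assumes "op_invertible T" shows "is_inverse T (op_inv T)"
proof -
  have "S = S'" if "is_inverse T S" "is_inverse T S'" for S S'
    using that unfolding is_inverse_def
    by (metis cblinfun_compose_assoc cblinfun_compose_id_left cblinfun_compose_id_right)
  then show ?thesis
    using assms unfolding op_inv_def op_invertible_def by (metis theI)
qed

definition op_spectrum :: "'a::complex_normed_vector \<Rightarrow>\<^sub>B 'a \<Rightarrow> complex set"
  where "op_spectrum A = {l. \<not> op_invertible (l *\<^sub>C id_cblinfun - A)}"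

abbreviation unit_circle :: "complex set"  (\<open>\<T>\<close>) where "\<T> \<equiv> sphere 0 1"
abbreviation exterior_disc :: "complex set"  (\<open>\<E>\<close>) where "\<E> \<equiv> - cball 0 1"

definition dichotomous :: "'a::complex_normed_vector \<Rightarrow>\<^sub>B 'a \<Rightarrow> bool"
  where "dichotomous A \<longleftrightarrow> op_spectrum A \<inter> \<T> = {}"

text \<open>Meaningful for those \<open>z\<close> for which \<open>I - z A\<close> is invertible.\<close>

definition transfer_function ::
  "'x::complex_normed_vector \<Rightarrow>\<^sub>B 'x \<Rightarrow> 'u \<Rightarrow>\<^sub>B 'x \<Rightarrow> 'x \<Rightarrow>\<^sub>B 'u \<Rightarrow> 'u \<Rightarrow>\<^sub>B 'u \<Rightarrow> complex
     \<Rightarrow> 'u::complex_normed_vector \<Rightarrow>\<^sub>B 'u"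
  where "transfer_function A B C D z =
    D + z *\<^sub>C (C o\<^sub>B op_inv (id_cblinfun - z *\<^sub>C A) o\<^sub>B B)"

text \<open>A supremum of reals; for \<open>F\<close> continuous on the compact set \<open>\<T>\<close> it is the maximum.\<close>

definition sup_norm_circle :: "(complex \<Rightarrow> 'a::complex_normed_vector) \<Rightarrow> real"
  where "sup_norm_circle F = (SUP z\<in>\<T>. norm (F z))"

section \<open>Vector-valued analytic functions and Wiener--Hopf factorization\<close>

definition has_complex_derivative ::
  "(complex \<Rightarrow> 'a::complex_normed_vector) \<Rightarrow> 'a \<Rightarrow> complex \<Rightarrow> bool"
  where "has_complex_derivative f f' z \<longleftrightarrow>
    ((\<lambda>w. (1 / (w - z)) *\<^sub>C (f w - f z)) \<longlongrightarrow> f') (at z)"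

definition analytic_on_nhd :: "(complex \<Rightarrow> 'a::complex_normed_vector) \<Rightarrow> complex set \<Rightarrow> bool"
  where "analytic_on_nhd f K \<longleftrightarrow>
    (\<exists>S. open S \<and> K \<subseteq> S \<and> (\<forall>z\<in>S. \<exists>f'. has_complex_derivative f f' z))"

definition analytic_at_infinity :: "(complex \<Rightarrow> 'a::complex_normed_vector) \<Rightarrow> bool"
  where "analytic_at_infinity f \<longleftrightarrow>
    (\<exists>L. analytic_on_nhd (\<lambda>w. if w = 0 then L else f (1 / w)) {0})"

definition invertible_on_nhd ::
  "(complex \<Rightarrow> 'a::complex_normed_vector \<Rightarrow>\<^sub>B 'b::complex_normed_vector) \<Rightarrow> complex set \<Rightarrow> bool"
  where "invertible_on_nhd V K \<longleftrightarrow> (\<exists>S. open S \<and> K \<subseteq> S \<and> (\<forall>z\<in>S. op_invertible (V z)))"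

definition plus_factor :: "(complex \<Rightarrow> 'u::complex_normed_vector \<Rightarrow>\<^sub>B 'u) \<Rightarrow> bool"
  where "plus_factor V \<longleftrightarrow>
    invertible_on_nhd V (cball 0 1) \<and>
    analytic_on_nhd V (cball 0 1) \<and> analytic_on_nhd (\<lambda>z. op_inv (V z)) (cball 0 1)"

text \<open>As usual for Wiener--Hopf factorizations, the closed exterior domain contains the point
  at infinity: its neighbourhoods are taken in the Riemann sphere. Without that point every
  invertible analytic function on an annulus around \<open>\<T>\<close> would factor. Analyticity of both
  \<open>V\<close> and its inverse at infinity forces the value of \<open>V\<close> at infinity to be invertible.\<close>

definition minus_factor :: "(complex \<Rightarrow> 'u::complex_normed_vector \<Rightarrow>\<^sub>B 'u) \<Rightarrow> bool"
  where "minus_factor V \<longleftrightarrow>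
    invertible_on_nhd V (closure \<E>) \<and>
    analytic_on_nhd V (closure \<E>) \<and> analytic_on_nhd (\<lambda>z. op_inv (V z)) (closure \<E>) \<and>
    analytic_at_infinity V \<and> analytic_at_infinity (\<lambda>z. op_inv (V z))"

definition right_canonical_factorization ::
  "(complex \<Rightarrow> 'u::complex_normed_vector \<Rightarrow>\<^sub>B 'u) \<Rightarrow>
   (complex \<Rightarrow> 'u \<Rightarrow>\<^sub>B 'u) \<Rightarrow> (complex \<Rightarrow> 'u \<Rightarrow>\<^sub>B 'u) \<Rightarrow> bool"
  where "right_canonical_factorization G Vm Vp \<longleftrightarrow>
    minus_factor Vm \<and> plus_factor Vp \<and> (\<forall>z\<in>\<T>. G z = Vm z o\<^sub>B Vp z)"

definition left_canonical_factorization ::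
  "(complex \<Rightarrow> 'u::complex_normed_vector \<Rightarrow>\<^sub>B 'u) \<Rightarrow>
   (complex \<Rightarrow> 'u \<Rightarrow>\<^sub>B 'u) \<Rightarrow> (complex \<Rightarrow> 'u \<Rightarrow>\<^sub>B 'u) \<Rightarrow> bool"
  where "left_canonical_factorization G Wp Wm \<longleftrightarrow>
    plus_factor Wp \<and> minus_factor Wm \<and> (\<forall>z\<in>\<T>. G z = Wp z o\<^sub>B Wm z)"

end

theory Submission
  imports Defs
begin

text \<open>Since \<open>A\<close> is dichotomous, \<open>F\<close> has a Laurent expansion on \<open>\<T>\<close> with exponentially
  decaying coefficients, obtained by integrating the resolvent over circles. By Parseval, a
  half-line Toeplitz matrix with symbol of norm at most \<open>q < 1\<close> has norm at most \<open>q\<close> on square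
  summable sequences, so \<open>I + F\<close> gives a half-line Toeplitz matrix with a Neumann series inverse
  \<open>R\<close>. Applying this to the symbols \<open>F (\<rho> z)\<close> with \<open>\<rho>\<close> slightly larger and slightly smaller
  than \<open>1\<close> shows that the entries of \<open>R\<close> decay exponentially away from the diagonal.

  Let \<open>X\<close> and \<open>Y\<close> be the functions whose coefficients are column 0 and row 0 of \<open>R\<close>; they have only
  nonnegative and only nonpositive powers of \<open>z\<close>. Then \<open>V = G X\<close> has only nonpositive and
  \<open>Q = Y G\<close> only nonnegative powers, so both sides of \<open>Q X = Y V\<close> are constant, equal to the corner
  entry \<open>T\<close> of \<open>R\<close>. That entry is invertible, which makes \<open>T\<^sup>-\<^sup>1 Q\<close> a left inverse of \<open>X\<close>, and by a
  connectedness argument a two-sided one, so that \<open>G = V (T\<^sup>-\<^sup>1 Q)\<close>. The left factorization is the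
  right factorization of \<open>G (1 / z)\<close>.\<close>

section \<open>The Banach algebra of bounded operators\<close>

text \<open>An inverse of the half-line matrix that is merely bounded on square summable sequences
  would give factors with square summable coefficients, whereas the factors have to be analytic
  across the circle. Hence every matrix here lives in an algebra of exponentially decaying ones.
  Conjugation by weights with \<rho> > 1 gives decay below the diagonal only, so a weight below 1 is
  needed as well. All powers of the half-line matrix must share one rate: the general product
  estimate loses a square root of the rate at each multiplication and could not feed a Neumann
  series. The sequence space itself is never formed; only bounds on finite sums of squares along a
  column enter.

  In infinite dimensions a one-sided inverse need not be two-sided, and \<open>Q X = T\<close>
  yields only one side. The missing side is checked at \<open>z = 0\<close>, where
  \<open>X 0 = T\<close> and \<open>Q 0 = I\<close>, and transported from there. The function to be
  factored is written as \<open>I - f\<close> with \<open>f = - F\<close>, the form that suits the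
  Neumann series.\<close>

instance complex_hilbert \<subseteq> banach ..

lemma bounded_linear_cblinfun_apply: "bounded_linear (cblinfun_apply T)"
  using cblinfun_apply[of T] by simp

lemma cblinfun_apply_scaleC: "cblinfun_apply T (a *\<^sub>C x) = a *\<^sub>C cblinfun_apply T x"
  using cblinfun_apply[of T] by simp

lemma norm_cblinfun_apply: "norm (cblinfun_apply T x) \<le> norm T * norm x"
  by (simp add: norm_cblinfun.rep_eq onorm[OF bounded_linear_cblinfun_apply])

lemma norm_cblinfun_bound:
  "0 \<le> b \<Longrightarrow> (\<And>x. norm (cblinfun_apply T x) \<le> b * norm x) \<Longrightarrow> norm T \<le> b"
  by (simp add: norm_cblinfun.rep_eq onorm_bound)

lemma norm_cblinfun_compose: "norm (S o\<^sub>B T) \<le> norm S * norm T"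
proof (rule norm_cblinfun_bound)
  fix x
  have "norm (cblinfun_apply S (cblinfun_apply T x)) \<le> norm S * (norm T * norm x)"
    by (rule order_trans[OF norm_cblinfun_apply]) (simp add: mult_left_mono norm_cblinfun_apply)
  then show "norm (cblinfun_apply (S o\<^sub>B T) x) \<le> norm S * norm T * norm x"
    by (simp add: cblinfun_compose.rep_eq)
qed simp

interpretation compose: bounded_bilinear
  "(o\<^sub>B) :: ('b::complex_normed_vector \<Rightarrow>\<^sub>B 'c::complex_normed_vector) \<Rightarrow>
     ('a::complex_normed_vector \<Rightarrow>\<^sub>B 'b) \<Rightarrow> 'a \<Rightarrow>\<^sub>B 'c"
proof
  fix a a' :: "'b \<Rightarrow>\<^sub>B 'c" and b b' :: "'a \<Rightarrow>\<^sub>B 'b" and r :: real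
  show "(a + a') o\<^sub>B b = a o\<^sub>B b + a' o\<^sub>B b" by transfer simp
  show "a o\<^sub>B (b + b') = a o\<^sub>B b + a o\<^sub>B b'"
    by transfer (simp add: bounded_linear.linear linear_add)
  show "(r *\<^sub>R a) o\<^sub>B b = r *\<^sub>R (a o\<^sub>B b)" by transfer simp
  show "a o\<^sub>B (r *\<^sub>R b) = r *\<^sub>R (a o\<^sub>B b)"
    by transfer (simp add: bounded_linear.linear linear_scale)
  show "\<exists>K. \<forall>a b. norm ((a :: 'b \<Rightarrow>\<^sub>B 'c) o\<^sub>B (b :: 'a \<Rightarrow>\<^sub>B 'b)) \<le> norm a * norm b * K"
    by (rule exI[where x = 1]) (simp add: norm_cblinfun_compose)
qed

interpretation scaleC: bounded_bilinear "scaleC :: complex \<Rightarrow> 'a::complex_normed_vector \<Rightarrow> 'a"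
proof
  show "(r *\<^sub>R a) *\<^sub>C b = r *\<^sub>R (a *\<^sub>C b)" for r a and b :: 'a
    by (metis scaleR_scaleC scaleC_scaleC scaleC_complex_def)
  show "a *\<^sub>C (r *\<^sub>R b) = r *\<^sub>R (a *\<^sub>C b)" for r a and b :: 'a
    by (simp add: scaleR_scaleC scaleC_scaleC mult.commute)
  show "\<exists>K. \<forall>a (b :: 'a). norm (a *\<^sub>C b) \<le> norm a * norm b * K"
    by (rule exI[where x = 1]) (simp add: norm_scaleC)
qed (simp_all add: scaleC_add_left scaleC_add_right)

interpretation cbapply: bounded_bilinear
  "cblinfun_apply :: ('a::complex_normed_vector \<Rightarrow>\<^sub>B 'b::complex_normed_vector) \<Rightarrow> 'a \<Rightarrow> 'b"
proof
  fix a a' :: "'a \<Rightarrow>\<^sub>B 'b" and b b' :: 'a and r :: real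
  show "cblinfun_apply (a + a') b = cblinfun_apply a b + cblinfun_apply a' b" by transfer simp
  show "cblinfun_apply a (b + b') = cblinfun_apply a b + cblinfun_apply a b'"
    by transfer (simp add: bounded_linear.linear linear_add)
  show "cblinfun_apply (r *\<^sub>R a) b = r *\<^sub>R cblinfun_apply a b" by transfer simp
  show "cblinfun_apply a (r *\<^sub>R b) = r *\<^sub>R cblinfun_apply a b"
    by transfer (simp add: bounded_linear.linear linear_scale)
  show "\<exists>K. \<forall>a b. norm (cblinfun_apply (a :: 'a \<Rightarrow>\<^sub>B 'b) b) \<le> norm a * norm b * K"
    by (rule exI[where x = 1]) (simp add: norm_cblinfun_apply)
qed

lemma compose_scaleC_left: "(a *\<^sub>C S) o\<^sub>B T = a *\<^sub>C (S o\<^sub>B T)"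
  by transfer simp

lemma compose_scaleC_right: "S o\<^sub>B (a *\<^sub>C T) = a *\<^sub>C (S o\<^sub>B T)"
  by transfer simp

lemma scaleC_apply: "cblinfun_apply (a *\<^sub>C T) x = a *\<^sub>C cblinfun_apply T x"
  by transfer simp

lemmas compose_simps =
  compose.add_left compose.add_right compose.diff_left compose.diff_right
  compose.minus_left compose.minus_right compose.zero_left compose.zero_right
  compose_scaleC_left compose_scaleC_right cblinfun_compose_assoc
  cblinfun_compose_id_left cblinfun_compose_id_right

text \<open>Completeness is inherited from the real bounded operators: the embedding is isometric,
  and complex homogeneity survives pointwise limits.\<close>

instance cblinfun :: (complex_normed_vector, complex_hilbert) banach
proof
  fix X :: "nat \<Rightarrow> 'a \<Rightarrow>\<^sub>B 'b"
  assume "Cauchy X"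
  define Y where "Y n = Blinfun (cblinfun_apply (X n))" for n
  have Y: "blinfun_apply (Y n) = cblinfun_apply (X n)" for n
    by (simp add: Y_def bounded_linear_Blinfun_apply bounded_linear_cblinfun_apply)
  have normY: "dist (Y m) (Y n) = dist (X m) (X n)" for m n
    by (simp add: dist_norm norm_blinfun.rep_eq norm_cblinfun.rep_eq minus_blinfun.rep_eq
        minus_cblinfun.rep_eq Y)
  have "Cauchy Y"
    using \<open>Cauchy X\<close> by (simp add: Cauchy_def normY)
  then obtain L where L: "Y \<longlonglongrightarrow> L"
    using Cauchy_convergent[of Y] convergentD[of Y] by auto
  have "blinfun_apply L (a *\<^sub>C x) = a *\<^sub>C blinfun_apply L x" for a x
  proof (rule LIMSEQ_unique)
    show "(\<lambda>n. Y n (a *\<^sub>C x)) \<longlonglongrightarrow> L (a *\<^sub>C x)"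
      by (intro tendsto_intros L)
    show "(\<lambda>n. Y n (a *\<^sub>C x)) \<longlonglongrightarrow> a *\<^sub>C L x"
      unfolding Y cblinfun_apply_scaleC unfolding Y[symmetric]
      by (intro tendsto_intros L scaleC.tendsto)
  qed
  then have "cblinfun_apply (Cblinfun (blinfun_apply L)) = blinfun_apply L"
    by (intro Cblinfun_inverse) (simp add: blinfun.bounded_linear_right)
  then obtain M :: "'a \<Rightarrow>\<^sub>B 'b" where M: "cblinfun_apply M = blinfun_apply L"
    by blast
  have "dist (X n) M = dist (Y n) L" for n
    by (simp add: dist_norm norm_blinfun.rep_eq norm_cblinfun.rep_eq minus_blinfun.rep_eq
        minus_cblinfun.rep_eq Y M)
  then have "X \<longlonglongrightarrow> M"
    using L tendsto_dist_iff[of Y L] tendsto_dist_iff[of X M] by simp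
  then show "convergent X"
    by (auto simp: convergent_def)
qed

section \<open>Inverses and the Neumann series for operators\<close>

lemma is_inverse_unique: "is_inverse T S \<Longrightarrow> is_inverse T S' \<Longrightarrow> S = S'"
  unfolding is_inverse_def
  by (metis cblinfun_compose_assoc cblinfun_compose_id_left cblinfun_compose_id_right)

lemma op_inv_eq: "is_inverse T S \<Longrightarrow> op_inv T = S"
  using is_inverse_op_inv is_inverse_unique op_invertible_def by blast

text \<open>The Neumann series. Its terms are iterated compositions, and \<open>pS'\<close> says
  that they commute with \<open>K\<close>, which makes the sum a two-sided inverse.\<close>

lemma op_invertible_id_minus:
  fixes K :: "'a::complex_hilbert \<Rightarrow>\<^sub>B 'a"
  assumes "norm K < 1"
  shows "op_invertible (id_cblinfun - K)"
proof -
  define p where "p n = ((o\<^sub>B) K ^^ n) id_cblinfun" for n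
  have p0: "p 0 = id_cblinfun" and pS: "p (Suc n) = K o\<^sub>B p n" for n
    by (simp_all add: p_def)
  have pS': "p (Suc n) = p n o\<^sub>B K" for n
    by (induction n) (simp_all add: p0 pS compose_simps, metis cblinfun_compose_assoc pS)
  have norm_p: "norm (p n) \<le> norm K ^ n * norm (p 0)" for n
  proof (induction n)
    case (Suc n)
    have "norm (p (Suc n)) \<le> norm K * norm (p n)"
      by (simp add: pS norm_cblinfun_compose)
    also have "\<dots> \<le> norm K * (norm K ^ n * norm (p 0))"
      by (intro mult_left_mono Suc.IH) simp
    finally show ?case by (simp add: mult.assoc)
  qed simp
  have sm: "summable p"
    by (rule summable_comparison_test'[where g = "\<lambda>n. norm K ^ n * norm (p 0)"])
      (auto intro!: summable_mult2 summable_geometric norm_p assms)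
  have split: "suminf p = id_cblinfun + (\<Sum>n. p (Suc n))"
    using suminf_split_head[OF sm] by (simp add: p0)
  have l: "K o\<^sub>B suminf p = (\<Sum>n. p (Suc n))"
    using bounded_linear.suminf[OF compose.bounded_linear_right sm, of K] by (simp add: pS)
  have r: "suminf p o\<^sub>B K = (\<Sum>n. p (Suc n))"
    using bounded_linear.suminf[OF compose.bounded_linear_left sm, of K] by (simp add: pS')
  have "is_inverse (id_cblinfun - K) (suminf p)"
    by (simp add: is_inverse_def compose_simps l r) (simp add: split)
  then show ?thesis
    by (auto simp: op_invertible_def)
qed

lemma op_invertible_compose:
  "op_invertible S \<Longrightarrow> op_invertible T \<Longrightarrow> op_invertible (S o\<^sub>B T)"
  unfolding op_invertible_def is_inverse_def
  by (metis cblinfun_compose_assoc cblinfun_compose_id_left)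

lemma op_invertible_near:
  fixes T :: "'a::complex_hilbert \<Rightarrow>\<^sub>B 'a"
  assumes "is_inverse T S" "norm (T' - T) * norm S < 1"
  shows "op_invertible T'"
proof -
  have eq: "T' = T o\<^sub>B (id_cblinfun - S o\<^sub>B (T - T'))"
    using assms(1) 
    by (simp add: is_inverse_def compose_simps cblinfun_compose_assoc[symmetric]
        del: cblinfun_compose_assoc)
  have "norm (S o\<^sub>B (T - T')) < 1"
    using norm_cblinfun_compose[of S "T - T'"] assms(2)
    by (simp add: norm_minus_commute mult.commute)
  then show ?thesis
    using assms(1)
    by (subst eq, intro op_invertible_compose op_invertible_id_minus)
       (auto simp: op_invertible_def)
qed

section \<open>Complex derivatives and the resolvent\<close>

text \<open>The bridge to the Frechet derivative: the chain rule, the product rule and termwise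
  differentiation become available for difference quotients with complex increments.\<close>

lemma has_complex_derivative_iff:
  "has_complex_derivative f f' z \<longleftrightarrow> (f has_derivative (\<lambda>h. h *\<^sub>C f')) (at z)"
proof -
  have "eventually (\<lambda>w. norm ((1 / (w - z)) *\<^sub>C (f w - f z) - f') =
      norm (f w - f z - (w - z) *\<^sub>C f') / norm (w - z)) (at z)"
    unfolding eventually_at_topological
  proof (intro exI[where x = UNIV] conjI ballI impI)
    fix w assume "w \<noteq> z"
    then have "(1 / (w - z)) *\<^sub>C (f w - f z) - f' = (1 / (w - z)) *\<^sub>C (f w - f z - (w - z) *\<^sub>C f')"
      by (simp add: scaleC.diff_right scaleC_scaleC scaleC_one)
    then show "norm ((1 / (w - z)) *\<^sub>C (f w - f z) - f') =
        norm (f w - f z - (w - z) *\<^sub>C f') / norm (w - z)"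
      by (simp add: norm_scaleC norm_divide)
  qed auto
  then have "((\<lambda>w. norm ((1 / (w - z)) *\<^sub>C (f w - f z) - f')) \<longlongrightarrow> 0) (at z) \<longleftrightarrow>
      ((\<lambda>w. norm (f w - f z - (w - z) *\<^sub>C f') / norm (w - z)) \<longlongrightarrow> 0) (at z)"
    by (rule tendsto_cong)
  then show ?thesis
    unfolding has_complex_derivative_def has_derivative_iff_norm
      Lim_null[of "\<lambda>w. (1 / (w - z)) *\<^sub>C (f w - f z)"]
      tendsto_norm_zero_iff[of "\<lambda>w. (1 / (w - z)) *\<^sub>C (f w - f z) - f'", symmetric]
    by (simp add: scaleC.bounded_linear_left)
qed

text \<open>From \<open>V - S = V (T0 - T) S\<close> for the inverses \<open>V\<close> of
  \<open>T\<close> and \<open>S\<close> of \<open>T0\<close>: once the perturbation is below 1/2,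
  half of \<open>norm V\<close> is absorbed, so \<open>norm V\<close> is at most
  \<open>2 * norm S\<close> and the difference is controlled by
  \<open>norm (T - T0)\<close>.\<close>

lemma op_inv_tendsto:
  fixes T :: "'b \<Rightarrow> 'a::complex_hilbert \<Rightarrow>\<^sub>B 'a"
  assumes lim: "(T \<longlongrightarrow> T0) F" and inv: "op_invertible T0"
  shows "eventually (\<lambda>x. op_invertible (T x)) F" and "((\<lambda>x. op_inv (T x)) \<longlongrightarrow> op_inv T0) F"
proof -
  define S where "S = op_inv T0"
  have S: "is_inverse T0 S"
    unfolding S_def by (rule is_inverse_op_inv[OF inv])
  have lim0: "((\<lambda>x. norm (T x - T0) * norm S) \<longlongrightarrow> 0) F"
    by (rule tendsto_mult_left_zero) (simp add: lim LIM_zero tendsto_norm_zero)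
  have ev: "eventually (\<lambda>x. norm (T x - T0) * norm S < 1/2) F"
    by (rule order_tendstoD(2)[OF lim0]) simp
  then show inv': "eventually (\<lambda>x. op_invertible (T x)) F"
    by eventually_elim (rule op_invertible_near[OF S], simp)
  have bound: "norm (op_inv (T x) - S) \<le> 2 * norm S * (norm (T x - T0) * norm S)"
    if x: "norm (T x - T0) * norm S < 1/2" "op_invertible (T x)" for x
  proof -
    let ?V = "op_inv (T x)"
    have V: "is_inverse (T x) ?V"
      by (rule is_inverse_op_inv[OF x(2)])
    have eq: "?V - S = ?V o\<^sub>B ((T0 - T x) o\<^sub>B S)"
      using S V unfolding is_inverse_def
      by (simp add: compose_simps flip: cblinfun_compose_assoc)
    have le: "norm (?V - S) \<le> norm ?V * (norm (T x - T0) * norm S)"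
      unfolding eq norm_minus_commute[of "T x"]
      by (intro order_trans[OF norm_cblinfun_compose] mult_left_mono norm_cblinfun_compose) simp
    have "norm ?V * (norm (T x - T0) * norm S) \<le> norm ?V * (1/2)"
      using x(1) by (intro mult_left_mono) auto
    then have "norm ?V \<le> 2 * norm S"
      using le norm_triangle_sub[of ?V S] by linarith
    then have "norm ?V * (norm (T x - T0) * norm S) \<le> 2 * norm S * (norm (T x - T0) * norm S)"
      by (intro mult_right_mono) auto
    then show ?thesis
      using le by linarith
  qed
  have "((\<lambda>x. op_inv (T x) - S) \<longlongrightarrow> 0) F"
  proof (rule Lim_null_comparison)
    show "eventually (\<lambda>x. norm (op_inv (T x) - S) \<le> 2 * norm S * (norm (T x - T0) * norm S)) F"
      using ev inv' by eventually_elim (rule bound)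
    show "((\<lambda>x. 2 * norm S * (norm (T x - T0) * norm S)) \<longlongrightarrow> 0) F"
      using tendsto_mult_left[OF lim0, of "2 * norm S"] by simp
  qed
  then show "((\<lambda>x. op_inv (T x)) \<longlongrightarrow> op_inv T0) F"
    by (simp add: LIM_zero_iff S_def)
qed

text \<open>For \<open>z\<close> other than 0 this says that \<open>1 / z\<close> lies outside the
  spectrum; the origin always belongs to it.\<close>

definition regular_set :: "'x::complex_hilbert \<Rightarrow>\<^sub>B 'x \<Rightarrow> complex set"
  where "regular_set A = {z. op_invertible (id_cblinfun - z *\<^sub>C A)}"

definition resolvent :: "'x::complex_hilbert \<Rightarrow>\<^sub>B 'x \<Rightarrow> complex \<Rightarrow> 'x \<Rightarrow>\<^sub>B 'x"
  where "resolvent A z = op_inv (id_cblinfun - z *\<^sub>C A)"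

lemma resolvent_inverse:
  "z \<in> regular_set A \<Longrightarrow> is_inverse (id_cblinfun - z *\<^sub>C A) (resolvent A z)"
  by (simp add: regular_set_def resolvent_def is_inverse_op_inv)

lemma resolvent_eq:
  assumes "z \<in> regular_set A"
  shows "resolvent A z = id_cblinfun + z *\<^sub>C (A o\<^sub>B resolvent A z)"
    and "resolvent A z = id_cblinfun + z *\<^sub>C (resolvent A z o\<^sub>B A)"
  using resolvent_inverse[OF assms] by (simp_all add: is_inverse_def compose_simps algebra_simps)

lemma resolvent_tendsto:
  fixes A :: "'x::complex_hilbert \<Rightarrow>\<^sub>B 'x"
  assumes "z \<in> regular_set A"
  shows "(resolvent A \<longlongrightarrow> resolvent A z) (at z)"
    and "eventually (\<lambda>w. w \<in> regular_set A) (nhds z)"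
proof -
  have inv: "op_invertible (id_cblinfun - z *\<^sub>C A)"
    using assms by (simp add: regular_set_def)
  have lim: "((\<lambda>w. id_cblinfun - w *\<^sub>C A) \<longlongrightarrow> id_cblinfun - z *\<^sub>C A) (nhds z)"
    by (intro tendsto_intros scaleC.tendsto filterlim_ident)
  show "eventually (\<lambda>w. w \<in> regular_set A) (nhds z)"
    using op_inv_tendsto(1)[OF lim inv] by (simp add: regular_set_def)
  have "(resolvent A \<longlongrightarrow> resolvent A z) (nhds z)"
    using op_inv_tendsto(2)[OF lim inv] by (simp add: resolvent_def[abs_def])
  then show "(resolvent A \<longlongrightarrow> resolvent A z) (at z)"
    by (rule filterlim_mono) (simp_all add: at_within_le_nhds)
qed

lemma open_regular_set: "open (regular_set (A :: 'x::complex_hilbert \<Rightarrow>\<^sub>B 'x))"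
proof (rule Topological_Spaces.openI)
  fix z assume "z \<in> regular_set A"
  then obtain S where "open S" "z \<in> S" "\<forall>w\<in>S. w \<in> regular_set A"
    using resolvent_tendsto(2)[of z A] by (auto simp: eventually_nhds)
  then show "\<exists>T. open T \<and> z \<in> T \<and> T \<subseteq> regular_set A"
    by auto
qed

lemma continuous_on_resolvent: "continuous_on (regular_set A) (resolvent A)"
  by (simp add: continuous_on_eq_continuous_at open_regular_set isCont_def resolvent_tendsto(1))

lemma resolvent_identity:
  assumes "z \<in> regular_set A" "w \<in> regular_set A"
  shows "resolvent A w - resolvent A z = (w - z) *\<^sub>C (resolvent A w o\<^sub>B A o\<^sub>B resolvent A z)"
proof -
  let ?R = "resolvent A"
  have "?R w - ?R z = ?R w o\<^sub>B ((id_cblinfun - z *\<^sub>C A) o\<^sub>B ?R z) - (?R w o\<^sub>B (id_cblinfun - w *\<^sub>C A)) o\<^sub>B ?R z"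
    using resolvent_inverse[OF assms(1)] resolvent_inverse[OF assms(2)]
    by (simp add: is_inverse_def compose_simps)
  also have "\<dots> = (w - z) *\<^sub>C (?R w o\<^sub>B A o\<^sub>B ?R z)"
    by (simp only: compose_simps) (simp add: scaleC.diff_left)
  finally show ?thesis .
qed

lemma has_derivative_resolvent:
  assumes z: "z \<in> regular_set A"
  shows "(resolvent A has_derivative (\<lambda>h. h *\<^sub>C (resolvent A z o\<^sub>B A o\<^sub>B resolvent A z))) (at z)"
proof -
  let ?R = "resolvent A"
  have "((\<lambda>w. ?R w o\<^sub>B A o\<^sub>B ?R z) \<longlongrightarrow> ?R z o\<^sub>B A o\<^sub>B ?R z) (at z)"
    by (intro compose.tendsto tendsto_const resolvent_tendsto z)
  moreover have "eventually (\<lambda>w. ?R w o\<^sub>B A o\<^sub>B ?R z = (1 / (w - z)) *\<^sub>C (?R w - ?R z)) (at z)"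
    using resolvent_tendsto(2)[OF z] unfolding eventually_at_filter
  proof eventually_elim
    case (elim w)
    show ?case
      unfolding resolvent_identity[OF z elim] scaleC_scaleC by (simp add: scaleC_one)
  qed
  ultimately have "has_complex_derivative ?R (?R z o\<^sub>B A o\<^sub>B ?R z) z"
    unfolding has_complex_derivative_def by (rule Lim_transform_eventually)
  then show ?thesis
    by (simp add: has_complex_derivative_iff)
qed

section \<open>Laurent coefficients of the resolvent\<close>

lemma complex_derivative_along:
  fixes h :: "complex \<Rightarrow> 'a::complex_normed_vector"
  assumes "(h has_derivative (\<lambda>k. k *\<^sub>C h')) (at (g t))"
    and "(g has_vector_derivative g') (at t within S)"
  shows "((\<lambda>t. h (g t)) has_vector_derivative (g' *\<^sub>C h')) (at t within S)"
proof -
  have "((\<lambda>t. h (g t)) has_derivative (\<lambda>x. (x *\<^sub>R g') *\<^sub>C h')) (at t within S)"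
    using has_derivative_compose[OF assms(2)[unfolded has_vector_derivative_def] assms(1)] by simp
  then show ?thesis
    by (simp add: has_vector_derivative_def scaleC.scaleR_left)
qed

text \<open>Cauchy's theorem for an annulus in the logarithmic coordinate \<open>w\<close>.
  Differentiating the integral in the real part produces the integral of \<open>h'\<close> over a
  period, which vanishes by periodicity.\<close>

lemma periodic_integral_constant:
  fixes h h' :: "complex \<Rightarrow> 'a::{complex_normed_vector, banach}"
  assumes deriv: "\<And>w. \<bar>Re w\<bar> < e \<Longrightarrow> (h has_derivative (\<lambda>k. k *\<^sub>C h' w)) (at w)"
    and cont: "continuous_on {w. \<bar>Re w\<bar> < e} h'"
    and periodic: "\<And>w. \<bar>Re w\<bar> < e \<Longrightarrow> h (w + 2 * pi * \<i>) = h w"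
    and s: "\<bar>s\<bar> < e"
  shows "integral {0..2*pi} (\<lambda>t. h (Complex s t)) = integral {0..2*pi} (\<lambda>t. h (Complex 0 t))"
proof -
  define U where "U = {-e<..<e}"
  have U: "x \<in> U \<longleftrightarrow> \<bar>x\<bar> < e" for x
    by (auto simp: U_def)
  have strip: "Complex x t \<in> {w. \<bar>Re w\<bar> < e}" if "x \<in> U" for x t
    using that U by simp
  have vert: "(Complex x has_vector_derivative \<i>) (at t within S)" for x t S
    unfolding Complex_eq has_vector_derivative_def
    by (auto intro!: derivative_eq_intros simp: scaleR_conv_of_real)
  have horiz: "((\<lambda>x. Complex x t) has_vector_derivative 1) (at x within S)" for x t S
    unfolding Complex_eq has_vector_derivative_def
    by (auto intro!: derivative_eq_intros simp: scaleR_conv_of_real)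
  have cont_h: "continuous_on {0..2*pi} (\<lambda>t. h (Complex x t))" if "x \<in> U" for x
    using complex_derivative_along[OF deriv vert] that
    by (auto simp: U intro!: continuous_on_vector_derivative)
  have contC: "continuous_on S (\<lambda>(x, t). Complex x t)" for S
    unfolding Complex_eq case_prod_unfold by (intro continuous_intros)
  have cont_h': "continuous_on (U \<times> cbox 0 (2*pi)) (\<lambda>(x, t). h' (Complex x t))"
  proof -
    have "(\<lambda>(x, t). Complex x t) ` (U \<times> cbox 0 (2*pi)) \<subseteq> {w. \<bar>Re w\<bar> < e}"
      using strip by auto
    from continuous_on_compose2[OF cont contC this] show ?thesis
      by (simp add: case_prod_unfold)
  qed
  \<comment> \<open>Along a vertical line the derivative of \<open>h\<close> is
    \<open>\<i> *\<^sub>C h'\<close>, so the integral is a difference of endpoint values one period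
    apart.\<close>
  have zero: "integral {0..2*pi} (\<lambda>t. h' (Complex x t)) = 0" if x: "x \<in> U" for x
  proof -
    have "((\<lambda>t. \<i> *\<^sub>C h' (Complex x t)) has_integral h (Complex x (2*pi)) - h (Complex x 0)) {0..2*pi}"
      by (intro fundamental_theorem_of_calculus complex_derivative_along[OF deriv vert]) (use x U in auto)
    moreover have "h (Complex x (2*pi)) = h (Complex x 0)"
      using periodic[of "Complex x 0"] x U by (simp add: Complex_eq mult.commute)
    ultimately have "((\<lambda>t. \<i> *\<^sub>C h' (Complex x t)) has_integral 0) {0..2*pi}"
      by simp
    from has_integral_linear[OF this scaleC.bounded_linear_right[of "- \<i>"]]
    have "((\<lambda>t. h' (Complex x t)) has_integral 0) {0..2*pi}"
      by (simp add: o_def scaleC_scaleC scaleC_one scaleC.zero_right)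
    then show ?thesis
      by (rule integral_unique)
  qed
  have "((\<lambda>x. integral (cbox 0 (2*pi)) (\<lambda>t. h (Complex x t))) has_vector_derivative
      integral (cbox 0 (2*pi)) (\<lambda>t. h' (Complex x t))) (at x within U)" if x: "x \<in> U" for x
  proof (rule leibniz_rule_vector_derivative[OF _ _ cont_h' x])
    show "((\<lambda>x. h (Complex x t)) has_vector_derivative h' (Complex x t)) (at x within U)"
      if "x \<in> U" for x t
      using complex_derivative_along[OF deriv horiz] strip[OF that] by (simp add: scaleC_one)
    show "(\<lambda>t. h (Complex x t)) integrable_on cbox 0 (2*pi)" if "x \<in> U" for x
      using cont_h[OF that] by (simp add: integrable_continuous_interval)
  qed (simp add: U_def)
  then have "((\<lambda>x. integral {0..2*pi} (\<lambda>t. h (Complex x t))) has_vector_derivative 0) (at x within U)"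
    if "x \<in> U" for x
    using zero[OF that] that by (metis cbox_interval)
  then obtain k where "\<And>x. x \<in> U \<Longrightarrow> integral {0..2*pi} (\<lambda>t. h (Complex x t)) = k"
    using has_vector_derivative_zero_constant[of U "\<lambda>x. integral {0..2*pi} (\<lambda>t. h (Complex x t))"]
    by (auto simp: U_def)
  then show ?thesis
    using s by (simp add: U)
qed

lemma summable_on_int_geometric:
  fixes r :: real
  assumes "0 \<le> r" "r < 1"
  shows "(\<lambda>n::int. r ^ nat \<bar>n\<bar>) summable_on UNIV"
proof -
  have *: "(\<lambda>n::nat. r ^ n) summable_on UNIV"
    using assms by (intro summable_nonneg_imp_summable_on summable_geometric) auto
  have "(\<lambda>n::int. r ^ nat \<bar>n\<bar>) summable_on range int"
    using * by (subst summable_on_reindex) (auto simp: o_def)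
  moreover have "(\<lambda>n::int. r ^ nat \<bar>n\<bar>) summable_on range (\<lambda>n. - int n)"
    using * by (subst summable_on_reindex) (auto simp: o_def inj_def)
  ultimately have "(\<lambda>n::int. r ^ nat \<bar>n\<bar>) summable_on (range int \<union> range (\<lambda>n. - int n))"
    by (rule summable_on_union)
  moreover have "range int \<union> range (\<lambda>n. - int n) = UNIV"
    by (metis (no_types, lifting) UNIV_eq_I Un_iff int_cases2 rangeI)
  ultimately show ?thesis by simp
qed

lemma has_sum_minus:
  fixes f :: "'a \<Rightarrow> 'b::topological_ab_group_add"
  shows "(f has_sum a) A \<Longrightarrow> ((\<lambda>x. - f x) has_sum - a) A"
  by (simp add: has_sum_uminus)

text \<open>The coefficients are means of the resolvent over circles. Moving to a larger or a
  smaller circle gives their decay, and a recurrence obtained from the resolvent equation identifies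
  the sum.\<close>

lemma resolvent_laurent:
  fixes A :: "'x::complex_hilbert \<Rightarrow>\<^sub>B 'x"
  assumes circle: "\<T> \<subseteq> regular_set A"
  obtains c :: "int \<Rightarrow> 'x \<Rightarrow>\<^sub>B 'x" and r M :: real
  where "0 < r" "r < 1" "\<And>n. norm (c n) \<le> M * r ^ nat \<bar>n\<bar>"
    "\<And>z. z \<in> \<T> \<Longrightarrow> ((\<lambda>n. z powi n *\<^sub>C c n) has_sum resolvent A z) UNIV"
proof -
  let ?R = "resolvent A"
  obtain d where d: "d > 0" "(\<Union>x\<in>\<T>. ball x d) \<subseteq> regular_set A"
    using compact_subset_open_imp_ball_epsilon_subset[OF compact_sphere open_regular_set circle] by blast
  \<comment> \<open>Chosen so that \<open>exp\<close> maps the strip of half-width \<open>e\<close>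
    to points at distance less than \<open>d\<close> from the circle.\<close>
  define e where "e = ln (1 + d)"
  have e: "e > 0" using d by (simp add: e_def)
  have reg: "exp w \<in> regular_set A" if w: "\<bar>Re w\<bar> < e" for w
  proof -
    have "exp w = exp (\<i> * Im w) * of_real (exp (Re w))"
      by (simp add: exp_eq_polar[of w] cis_conv_exp)
    then have "dist (exp (\<i> * Im w)) (exp w) = \<bar>1 - exp (Re w)\<bar>"
      by (metis abs_norm_cancel dist_norm mult.commute mult_1 norm_exp_i_times norm_mult norm_of_real
          of_real_1 of_real_diff right_diff_distrib')
    also have "\<dots> \<le> exp \<bar>Re w\<bar> - 1"
    proof (cases "Re w \<ge> 0")
      case False
      have "2 \<le> exp (Re w) + exp (- Re w)"
        using cosh_real_ge_1[of "Re w"] by (simp add: cosh_def)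
      then show ?thesis using False by simp
    qed simp
    also have "\<dots> < d"
      using w d by (metis add_pos_pos diff_less_eq e_def exp_less_mono exp_ln zero_less_one add.commute)
    finally have "exp w \<in> ball (exp (\<i> * Im w)) d" by simp
    moreover have "exp (\<i> * Im w) \<in> \<T>" by simp
    ultimately show ?thesis using d by blast
  qed
  \<comment> \<open>Strictly inside the admissible strip, so that its image under \<open>exp\<close>
    is a compact annulus with a uniform resolvent bound.\<close>
  define s where "s = e / 2"
  have s: "0 < s" "s < e" using e by (auto simp: s_def)
  \<comment> \<open>With \<open>z = exp w\<close> this is \<open>z powi (- n)\<close> times the
    resolvent at \<open>z\<close>; its mean over a vertical period is the Laurent
    coefficient.\<close>
  define h where "h n w = exp (- of_int n * w) *\<^sub>C ?R (exp w)" for n :: int and w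
  define h' where "h' n w = exp (- of_int n * w) *\<^sub>C (exp w *\<^sub>C (?R (exp w) o\<^sub>B A o\<^sub>B ?R (exp w)))
    + (- of_int n * exp (- of_int n * w)) *\<^sub>C ?R (exp w)" for n :: int and w
  define J where "J n x = integral {0..2*pi} (\<lambda>t. h n (Complex x t))" for n x
  define c where "c n = (1 / (2*pi)) *\<^sub>R J n 0" for n
  have cont_R: "continuous_on {w. \<bar>Re w\<bar> < e} (\<lambda>w. ?R (exp w))"
    by (rule continuous_on_compose2[OF continuous_on_resolvent]) (auto intro!: continuous_intros reg)
  have cont_h: "continuous_on {w. \<bar>Re w\<bar> < e} (h n)" for n
    unfolding h_def[abs_def] by (intro continuous_intros scaleC.continuous_on cont_R)
  have cont_line: "continuous_on {0..2*pi} (\<lambda>t. f (Complex x t))"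
    if "continuous_on {w. \<bar>Re w\<bar> < e} f" "\<bar>x\<bar> < e" for x and f :: "complex \<Rightarrow> 'x \<Rightarrow>\<^sub>B 'x"
    by (rule continuous_on_compose2[OF that(1)]) (use that(2) in \<open>auto simp: Complex_eq intro!: continuous_intros\<close>)
  have J_const: "J n x = J n 0" if "\<bar>x\<bar> < e" for n x
    unfolding J_def
  proof (rule periodic_integral_constant[where h' = "h' n", OF _ _ _ that])
    fix w :: complex assume w: "\<bar>Re w\<bar> < e"
    show "(h n has_derivative (\<lambda>k. k *\<^sub>C h' n w)) (at w)"
    proof -
      have 1: "((\<lambda>w. exp (- of_int n * w)) has_derivative (\<lambda>k. k * (- of_int n * exp (- of_int n * w)))) (at w)"
        using DERIV_chain2[OF DERIV_exp DERIV_cmult_Id, of "- of_int n" w UNIV]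
        by (auto simp: has_field_derivative_def mult_ac elim!: has_derivative_eq_rhs)
      have "(exp has_derivative (\<lambda>k. k * exp w)) (at w)"
        by (auto intro!: derivative_eq_intros)
      from has_derivative_compose[OF this has_derivative_resolvent[OF reg[OF w]]]
      have 2: "((\<lambda>w. ?R (exp w)) has_derivative
          (\<lambda>k. (k * exp w) *\<^sub>C (?R (exp w) o\<^sub>B A o\<^sub>B ?R (exp w)))) (at w)" .
      show ?thesis
        using scaleC.FDERIV[OF 1 2] unfolding h_def[abs_def] h'_def
        by (simp add: scaleC_add_right scaleC_scaleC mult_ac)
    qed
    have "exp (- of_int n * (w + 2 * pi * \<i>)) = exp (- of_int n * w)"
      unfolding exp_eq by (rule exI[where x = "- n"]) (simp add: algebra_simps)
    moreover have "exp (w + 2 * pi * \<i>) = exp w"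
      unfolding exp_eq by (rule exI[where x = 1]) simp
    ultimately show "h n (w + 2 * pi * \<i>) = h n w"
      by (simp add: h_def)
  next
    show "continuous_on {w. \<bar>Re w\<bar> < e} (h' n)"
      unfolding h'_def[abs_def] 
      by (intro continuous_intros scaleC.continuous_on compose.continuous_on cont_R)
  qed
  define K where "K = exp ` (cbox (Complex (-s) 0) (Complex s (2*pi)))"
  have "compact (?R ` K)"
    unfolding K_def image_image
    by (intro compact_continuous_image continuous_on_subset[OF cont_R])
      (use s in \<open>auto simp: in_cbox_complex_iff\<close>)
  then obtain M where M: "\<And>z. z \<in> K \<Longrightarrow> norm (?R z) \<le> M"
    using compact_imp_bounded[of "?R ` K"] by (auto simp: bounded_iff)
  have J_bound: "norm (J n x) \<le> exp (- of_int n * x) * M * (2*pi)" if x: "\<bar>x\<bar> \<le> s" for n x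
  proof -
    have "norm (J n x) \<le> exp (- of_int n * x) * M * (2*pi - 0)"
      unfolding J_def
    proof (rule integral_bound)
      show "continuous_on {0..2*pi} (\<lambda>t. h n (Complex x t))"
        using x s by (intro cont_line cont_h) auto
      fix t :: real assume "t \<in> {0..2*pi}"
      then have "exp (Complex x t) \<in> K"
        using x unfolding K_def by (intro imageI) (auto simp: in_cbox_complex_iff)
      then show "norm (h n (Complex x t)) \<le> exp (- of_int n * x) * M"
        by (simp add: h_def norm_scaleC M)
    qed simp
    then show ?thesis by simp
  qed
  have c_bound: "norm (c n) \<le> M * exp (- s) ^ nat \<bar>n\<bar>" for n
  proof -
    \<comment> \<open>The outer circle for nonnegative \<open>n\<close> and the inner one for
      negative \<open>n\<close>: in both cases the exponent becomes
      \<open>- s * \<bar>n\<bar>\<close>.\<close>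
    define x where "x = (if n \<ge> 0 then s else - s)"
    have x: "\<bar>x\<bar> \<le> s" "\<bar>x\<bar> < e" using s by (auto simp: x_def)
    have "norm (c n) = norm (J n x) / (2*pi)"
      by (simp add: c_def J_const[OF x(2)])
    also have "\<dots> \<le> exp (- of_int n * x) * M"
      using J_bound[OF x(1), of n] by (simp add: field_simps)
    also have "exp (- of_int n * x) = exp (- s) ^ nat \<bar>n\<bar>"
      by (simp add: x_def flip: exp_of_nat_mult)
    finally show ?thesis by (simp add: mult.commute)
  qed
  have int_h: "(\<lambda>t. h n (Complex 0 t)) integrable_on {0..2*pi}" for n
    using e by (intro integrable_continuous_interval cont_line cont_h) auto
  have delta: "((\<lambda>t. exp (- of_int n * Complex 0 t) *\<^sub>C id_cblinfun) has_integral
      (if n = 0 then (2 * pi) *\<^sub>R (id_cblinfun :: 'x \<Rightarrow>\<^sub>B 'x) else 0)) {0..2*pi}" for n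
  proof (cases "n = 0")
    case True
    then show ?thesis
      using has_integral_const_real[of "id_cblinfun :: 'x \<Rightarrow>\<^sub>B 'x" 0 "2*pi"] by (simp add: scaleC_one)
  next
    case False
    let ?f = "\<lambda>w. exp (- of_int n * w) / (- of_int n * \<i>)"
    have "((\<lambda>t. exp (- of_int n * Complex 0 t)) has_integral ?f (Complex 0 (2*pi)) - ?f (Complex 0 0)) {0..2*pi}"
    proof (rule fundamental_theorem_of_calculus)
      fix t :: real
      have "((\<lambda>x. ?f (\<i> * x)) has_field_derivative exp (- of_int n * (\<i> * t))) (at (of_real t))"
        using False by (auto intro!: derivative_eq_intros)
      from has_vector_derivative_real_field[OF this]
      show "((\<lambda>t. ?f (Complex 0 t)) has_vector_derivative exp (- of_int n * Complex 0 t)) (at t within {0..2*pi})"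
        by (simp add: Complex_eq)
    qed simp
    moreover have "exp (- of_int n * Complex 0 (2*pi)) = exp (- of_int n * Complex 0 0)"
      unfolding exp_eq by (rule exI[where x = "- n"]) (simp add: Complex_eq algebra_simps)
    ultimately have "((\<lambda>t. exp (- of_int n * Complex 0 t)) has_integral 0) {0..2*pi}"
      by simp
    from has_integral_linear[OF this scaleC.bounded_linear_left[of "id_cblinfun :: 'x \<Rightarrow>\<^sub>B 'x"]]
    show ?thesis
      using False by (simp add: o_def scaleC.zero_left)
  qed
  have shift: "exp (- of_int n * w) *\<^sub>C exp w *\<^sub>C T = exp (- of_int (n - 1) * w) *\<^sub>C T"
    for n w and T :: "'x \<Rightarrow>\<^sub>B 'x"
    by (simp add: scaleC_scaleC algebra_simps flip: exp_add)
  \<comment> \<open>The resolvent equations \<open>R = I + z A R\<close> and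
    \<open>R = I + z R A\<close>, integrated against \<open>z powi (- n)\<close>; the factor
    \<open>z\<close> lowers the index by one.\<close>
  have rec: "c n - A o\<^sub>B c (n - 1) = (if n = 0 then id_cblinfun else 0)"
    and rec': "c n - c (n - 1) o\<^sub>B A = (if n = 0 then id_cblinfun else 0)" for n
  proof -
    have int_J: "((\<lambda>t. h n (Complex 0 t)) has_integral J n 0) {0..2*pi}" for n
      using int_h by (simp add: J_def integrable_integral)
    have e0: "exp (Complex 0 t) \<in> regular_set A" for t
      using e by (intro reg) simp
    have "h n w - A o\<^sub>B h (n - 1) w = exp (- of_int n * w) *\<^sub>C id_cblinfun"
      "h n w - h (n - 1) w o\<^sub>B A = exp (- of_int n * w) *\<^sub>C id_cblinfun"
      if "exp w \<in> regular_set A" for w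
      unfolding h_def compose_scaleC_left compose_scaleC_right shift[symmetric]
      by (subst resolvent_eq[OF that], simp add: scaleC_add_right)+
    note eqs = this[OF e0]
    have "((\<lambda>t. exp (- of_int n * Complex 0 t) *\<^sub>C id_cblinfun) has_integral J n 0 - A o\<^sub>B J (n - 1) 0) {0..2*pi}"
      using has_integral_diff[OF int_J has_integral_linear[OF int_J compose.bounded_linear_right], of n A "n - 1"]
      by (simp add: o_def eqs)
    then have "J n 0 - A o\<^sub>B J (n - 1) 0 = (if n = 0 then (2 * pi) *\<^sub>R id_cblinfun else 0)"
      by (rule has_integral_unique[OF _ delta])
    then show "c n - A o\<^sub>B c (n - 1) = (if n = 0 then id_cblinfun else 0)"
      unfolding c_def compose.scaleR_right scaleR_diff_right[symmetric] by simp
    have "((\<lambda>t. exp (- of_int n * Complex 0 t) *\<^sub>C id_cblinfun) has_integral J n 0 - J (n - 1) 0 o\<^sub>B A) {0..2*pi}"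
      using has_integral_diff[OF int_J has_integral_linear[OF int_J compose.bounded_linear_left], of n A "n - 1"]
      by (simp add: o_def eqs)
    then have "J n 0 - J (n - 1) 0 o\<^sub>B A = (if n = 0 then (2 * pi) *\<^sub>R id_cblinfun else 0)"
      by (rule has_integral_unique[OF _ delta])
    then show "c n - c (n - 1) o\<^sub>B A = (if n = 0 then id_cblinfun else 0)"
      unfolding c_def compose.scaleR_left scaleR_diff_right[symmetric] by simp
  qed
  show ?thesis
  proof
    show "0 < exp (- s)" "exp (- s) < 1" using s by auto
    show "norm (c n) \<le> M * exp (- s) ^ nat \<bar>n\<bar>" for n by (rule c_bound)
    fix z :: complex assume z: "z \<in> \<T>"
    then have z1: "cmod z = 1" by simp
    have "(\<lambda>n. norm (z powi n *\<^sub>C c n)) summable_on UNIV"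
    proof (rule Infinite_Sum.abs_summable_on_comparison_test')
      show "(\<lambda>n::int. M * exp (- s) ^ nat \<bar>n\<bar>) summable_on UNIV"
        using s by (intro summable_on_cmult_right summable_on_int_geometric) auto
    qed (simp add: norm_scaleC norm_power_int z1 c_bound)
    then have "(\<lambda>n. z powi n *\<^sub>C c n) summable_on UNIV"
      by (rule abs_summable_summable)
    then obtain S where S: "((\<lambda>n. z powi n *\<^sub>C c n) has_sum S) UNIV"
      unfolding summable_on_def ..
    have z0: "z \<noteq> 0" using z1 by auto
    have pow: "z powi n = z * z powi (n - 1)" for n
      using z0 by (simp add: power_int_diff)
    have delta_sum: "((\<lambda>n::int. if n = 0 then id_cblinfun else 0) has_sum (id_cblinfun :: 'x \<Rightarrow>\<^sub>B 'x)) UNIV"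
      by (rule has_sum_finite_neutralI[where B = "{0::int}"]) auto
    have shifted: "((\<lambda>n. z powi n *\<^sub>C L (c (n - 1))) has_sum z *\<^sub>C L S) UNIV"
      if L: "bounded_linear L" "\<And>a T. L (a *\<^sub>C T) = a *\<^sub>C L T" for L :: "('x \<Rightarrow>\<^sub>B 'x) \<Rightarrow> 'x \<Rightarrow>\<^sub>B 'x"
    proof -
      have "((\<lambda>n. z *\<^sub>C L (z powi n *\<^sub>C c n)) has_sum z *\<^sub>C L S) UNIV"
        by (intro has_sum_bounded_linear[OF scaleC.bounded_linear_right] has_sum_bounded_linear[OF L(1)] S)
      also have "?this \<longleftrightarrow> ?thesis"
        by (rule has_sum_reindex_bij_witness[where i = "\<lambda>n. n - 1" and j = "\<lambda>n. n + 1"])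
          (auto simp: L(2) scaleC_scaleC pow[of "_ + 1"])
      finally show ?thesis .
    qed
    \<comment> \<open>No Fourier inversion is needed: by the recurrences the sum of the series
      inverts \<open>I - z A\<close> from both sides, and inverses are unique.\<close>
    have "S + - (z *\<^sub>C (A o\<^sub>B S)) = id_cblinfun"
    proof (rule has_sum_unique[OF _ delta_sum])
      have "((\<lambda>n. z powi n *\<^sub>C c n + - (z powi n *\<^sub>C (A o\<^sub>B c (n - 1)))) has_sum S + - (z *\<^sub>C (A o\<^sub>B S))) UNIV"
        by (intro has_sum_add S has_sum_minus
            shifted[of "\<lambda>T. A o\<^sub>B T", OF compose.bounded_linear_right compose_scaleC_right])
      moreover have "z powi n *\<^sub>C c n + - (z powi n *\<^sub>C (A o\<^sub>B c (n - 1))) = (if n = 0 then id_cblinfun else 0)" for n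
        using rec[of n] by (auto simp: scaleC_one scaleC.zero_right simp flip: scaleC.diff_right)
      ultimately show "((\<lambda>n::int. if n = 0 then id_cblinfun else 0) has_sum S + - (z *\<^sub>C (A o\<^sub>B S))) UNIV"
        by simp
    qed
    moreover have "S + - (z *\<^sub>C (S o\<^sub>B A)) = id_cblinfun"
    proof (rule has_sum_unique[OF _ delta_sum])
      have "((\<lambda>n. z powi n *\<^sub>C c n + - (z powi n *\<^sub>C (c (n - 1) o\<^sub>B A))) has_sum S + - (z *\<^sub>C (S o\<^sub>B A))) UNIV"
        by (intro has_sum_add S has_sum_minus
            shifted[of "\<lambda>T. T o\<^sub>B A", OF compose.bounded_linear_left compose_scaleC_left])
      moreover have "z powi n *\<^sub>C c n + - (z powi n *\<^sub>C (c (n - 1) o\<^sub>B A)) = (if n = 0 then id_cblinfun else 0)" for n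
        using rec'[of n] by (auto simp: scaleC_one scaleC.zero_right simp flip: scaleC.diff_right)
      ultimately show "((\<lambda>n::int. if n = 0 then id_cblinfun else 0) has_sum S + - (z *\<^sub>C (S o\<^sub>B A))) UNIV"
        by simp
    qed
    ultimately have "is_inverse (id_cblinfun - z *\<^sub>C A) S"
      by (simp add: is_inverse_def compose_simps)
    then show "((\<lambda>n. z powi n *\<^sub>C c n) has_sum ?R z) UNIV"
      using S by (simp add: resolvent_def op_inv_eq)
  qed
qed

section \<open>Matrices of operators with exponential off-diagonal decay\<close>

definition geometric :: "(int \<Rightarrow> 'a::real_normed_vector) \<Rightarrow> bool"
  where "geometric f \<longleftrightarrow> (\<exists>r M. 0 < r \<and> r < 1 \<and> (\<forall>n. norm (f n) \<le> M * r ^ nat \<bar>n\<bar>))"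

definition decaying :: "(int \<Rightarrow> int \<Rightarrow> 'a::real_normed_vector) \<Rightarrow> bool"
  where "decaying a \<longleftrightarrow> (\<exists>r M. 0 < r \<and> r < 1 \<and> (\<forall>i j. norm (a i j) \<le> M * r ^ nat \<bar>i - j\<bar>))"

lemma geometricI:
  "0 < r \<Longrightarrow> r < 1 \<Longrightarrow> (\<And>n. norm (f n) \<le> M * r ^ nat \<bar>n\<bar>) \<Longrightarrow> geometric f"
  unfolding geometric_def by blast

lemma decayingI:
  "0 < r \<Longrightarrow> r < 1 \<Longrightarrow> (\<And>i j. norm (a i j) \<le> M * r ^ nat \<bar>i - j\<bar>) \<Longrightarrow> decaying a"
  unfolding decaying_def by blast

lemma infsum_single:
  "(\<Sum>\<^sub>\<infinity>l. if l = i then g l else 0) = g i" for g :: "int \<Rightarrow> 'b::{comm_monoid_add, t2_space}"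
  by (rule infsumI, rule has_sum_finite_neutralI[where B = "{i}"]) auto

lemma geometric_abs_summable:
  assumes "geometric f"
  shows "(\<lambda>n. norm (f n)) summable_on UNIV"
proof -
  obtain r M where *: "0 < r" "r < 1" "\<And>n. norm (f n) \<le> M * r ^ nat \<bar>n\<bar>"
    using assms unfolding geometric_def by blast
  then show ?thesis
    by (intro Infinite_Sum.abs_summable_on_comparison_test'[OF _ *(3)] summable_on_cmult_right
        summable_on_int_geometric) auto
qed

lemma decayingE2:
  assumes "decaying a" "decaying b"
  obtains r M N where "0 < r" "r < 1" "0 \<le> M" "0 \<le> N"
    "\<And>i j. norm (a i j) \<le> M * r ^ nat \<bar>i - j\<bar>" "\<And>i j. norm (b i j) \<le> N * r ^ nat \<bar>i - j\<bar>"
proof -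
  from assms obtain r M s N where *: "0 < r" "r < 1" "0 < s" "s < 1"
    "\<And>i j. norm (a i j) \<le> M * r ^ nat \<bar>i - j\<bar>" "\<And>i j. norm (b i j) \<le> N * s ^ nat \<bar>i - j\<bar>"
    unfolding decaying_def by blast
  have "0 \<le> M" "0 \<le> N"
    using order_trans[OF norm_ge_zero *(5)[of 0 0]] order_trans[OF norm_ge_zero *(6)[of 0 0]] by simp_all
  then show thesis
    using * by (intro that[of "max r s" M N])
      (auto intro: order_trans[OF *(5)] order_trans[OF *(6)] intro!: mult_left_mono power_mono)
qed

lemma int_geometric_shift:
  fixes r :: real
  shows "((\<lambda>l::int. r ^ nat \<bar>i - l\<bar>) has_sum s) UNIV \<longleftrightarrow> ((\<lambda>l::int. r ^ nat \<bar>l\<bar>) has_sum s) UNIV"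
  by (rule has_sum_reindex_bij_witness[where i = "\<lambda>l. i - l" and j = "\<lambda>l. i - l"]) auto

lemma summable_on_int_geometric_shift:
  "0 \<le> r \<Longrightarrow> r < 1 \<Longrightarrow> (\<lambda>l::int. (r::real) ^ nat \<bar>i - l\<bar>) summable_on UNIV"
  using summable_on_int_geometric[of r] by (simp add: summable_on_def int_geometric_shift)

lemma summable_on_int_geometric_shift':
  "0 \<le> r \<Longrightarrow> r < 1 \<Longrightarrow> (\<lambda>l::int. (r::real) ^ nat \<bar>l - i\<bar>) summable_on UNIV"
  using summable_on_int_geometric_shift[of r i] by (simp add: abs_minus_commute)

text \<open>The path from \<open>i\<close> over \<open>l\<close> to \<open>j\<close> is at least as
  long as both \<open>\<bar>i - j\<bar>\<close> and \<open>\<bar>i - l\<bar>\<close>. Passing to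
  \<open>sqrt r\<close> doubles the exponent, so one half pays for the decay off the diagonal and
  the other for summing over \<open>l\<close>.\<close>

lemma decaying_compose_bound:
  fixes a b :: "int \<Rightarrow> int \<Rightarrow> 'u::complex_hilbert \<Rightarrow>\<^sub>B 'u"
  assumes r: "0 < r" "r < 1" and MN: "0 \<le> M" "0 \<le> N"
    and a: "\<And>i j. norm (a i j) \<le> M * r ^ nat \<bar>i - j\<bar>"
    and b: "\<And>i j. norm (b i j) \<le> N * r ^ nat \<bar>i - j\<bar>"
  shows "norm (a i l o\<^sub>B b l j) \<le> M * N * sqrt r ^ nat \<bar>i - j\<bar> * sqrt r ^ nat \<bar>i - l\<bar>"
proof -
  have "norm (a i l o\<^sub>B b l j) \<le> (M * r ^ nat \<bar>i - l\<bar>) * (N * r ^ nat \<bar>l - j\<bar>)"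
    by (rule order_trans[OF norm_cblinfun_compose mult_mono[OF a b]]) (use r MN in auto)
  also have "\<dots> = M * N * r ^ (nat \<bar>i - l\<bar> + nat \<bar>l - j\<bar>)"
    by (simp add: power_add)
  also have "r ^ (nat \<bar>i - l\<bar> + nat \<bar>l - j\<bar>) = sqrt r ^ (2 * (nat \<bar>i - l\<bar> + nat \<bar>l - j\<bar>))"
    unfolding power_mult using r by simp
  also have "\<dots> \<le> sqrt r ^ (nat \<bar>i - j\<bar> + nat \<bar>i - l\<bar>)"
    using r by (intro power_decreasing) auto
  finally show ?thesis
    using MN by (simp add: power_add mult_left_mono mult.assoc)
qed

lemma decaying_compose_summable:
  fixes a b :: "int \<Rightarrow> int \<Rightarrow> 'u::complex_hilbert \<Rightarrow>\<^sub>B 'u"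
  assumes "decaying a" "decaying b"
  shows "(\<lambda>l. norm (a i l o\<^sub>B b l j)) summable_on UNIV"
    and "(\<lambda>l. a i l o\<^sub>B b l j) summable_on UNIV"
proof -
  obtain r M N where *: "0 < r" "r < 1" "0 \<le> M" "0 \<le> N"
    "\<And>i j. norm (a i j) \<le> M * r ^ nat \<bar>i - j\<bar>" "\<And>i j. norm (b i j) \<le> N * r ^ nat \<bar>i - j\<bar>"
    by (rule decayingE2[OF assms]) blast
  show "(\<lambda>l. norm (a i l o\<^sub>B b l j)) summable_on UNIV"
    by (rule Infinite_Sum.abs_summable_on_comparison_test'[OF _ decaying_compose_bound[OF *]])
      (use * in \<open>auto intro!: summable_on_cmult_right summable_on_int_geometric_shift\<close>)
  then show "(\<lambda>l. a i l o\<^sub>B b l j) summable_on UNIV"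
    by (rule abs_summable_summable)
qed

lemma decaying_mult_bound:
  fixes a b :: "int \<Rightarrow> int \<Rightarrow> 'u::complex_hilbert \<Rightarrow>\<^sub>B 'u"
  assumes *: "0 < r" "r < 1" "0 \<le> M" "0 \<le> N"
    "\<And>i j. norm (a i j) \<le> M * r ^ nat \<bar>i - j\<bar>" "\<And>i j. norm (b i j) \<le> N * r ^ nat \<bar>i - j\<bar>"
  shows "norm (\<Sum>\<^sub>\<infinity>l. a i l o\<^sub>B b l j) \<le>
    M * N * sqrt r ^ nat \<bar>i - j\<bar> * (\<Sum>\<^sub>\<infinity>l::int. sqrt r ^ nat \<bar>l\<bar>)"
proof -
  have dec: "decaying a" "decaying b"
    by (rule decayingI[OF *(1,2,5)], rule decayingI[OF *(1,2,6)])
  have "((\<lambda>l::int. sqrt r ^ nat \<bar>i - l\<bar>) has_sum (\<Sum>\<^sub>\<infinity>l::int. sqrt r ^ nat \<bar>l\<bar>)) UNIV"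
    unfolding int_geometric_shift using * by (simp add: summable_on_int_geometric)
  then have "((\<lambda>l::int. M * N * sqrt r ^ nat \<bar>i - j\<bar> * sqrt r ^ nat \<bar>i - l\<bar>) has_sum
      M * N * sqrt r ^ nat \<bar>i - j\<bar> * (\<Sum>\<^sub>\<infinity>l::int. sqrt r ^ nat \<bar>l\<bar>)) UNIV"
    by (rule has_sum_cmult_right)
  then show ?thesis
    by (rule norm_infsum_le[OF has_sum_infsum[OF decaying_compose_summable(2)[OF dec]] _ decaying_compose_bound[OF *]])
qed

text \<open>A type of its own turns decaying matrices into a ring, so that the block computations
  with compressions and inverses become ring identities.\<close>

typedef (overloaded) 'u opmat = "{a :: int \<Rightarrow> int \<Rightarrow> 'u::complex_hilbert \<Rightarrow>\<^sub>B 'u. decaying a}"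
  morphisms entry Opmat
  by (rule exI[where x = "\<lambda>i j. 0"]) (auto intro!: decayingI[where r = "1/2" and M = 0])

setup_lifting type_definition_opmat

lemma opmat_eqI: "(\<And>i j. entry a i j = entry b i j) \<Longrightarrow> a = b"
  by (metis entry_inject ext)

lemma decaying_entry: "decaying (entry a)"
  using entry[of a] by simp

lemma decaying_mult:
  fixes a b :: "int \<Rightarrow> int \<Rightarrow> 'u::complex_hilbert \<Rightarrow>\<^sub>B 'u"
  assumes "decaying a" "decaying b"
  shows "decaying (\<lambda>i j. \<Sum>\<^sub>\<infinity>l. a i l o\<^sub>B b l j)"
proof -
  obtain r M N where *: "0 < r" "r < 1" "0 \<le> M" "0 \<le> N"
    "\<And>i j. norm (a i j) \<le> M * r ^ nat \<bar>i - j\<bar>" "\<And>i j. norm (b i j) \<le> N * r ^ nat \<bar>i - j\<bar>"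
    by (rule decayingE2[OF assms]) blast
  show ?thesis
    using * by (intro decayingI[of "sqrt r" _ "M * N * (\<Sum>\<^sub>\<infinity>l::int. sqrt r ^ nat \<bar>l\<bar>)"])
      (use decaying_mult_bound[OF *] in \<open>auto simp: mult_ac\<close>)
qed

text \<open>Fubini for the double sum over \<open>k\<close> and \<open>l\<close>. The outer matrices
  supply decay in \<open>i - k\<close> and in \<open>l - j\<close>; of the middle one only
  boundedness is used.\<close>

lemma decaying_mult_assoc:
  fixes a b c :: "int \<Rightarrow> int \<Rightarrow> 'u::complex_hilbert \<Rightarrow>\<^sub>B 'u"
  assumes "decaying a" "decaying b" "decaying c"
  shows "(\<Sum>\<^sub>\<infinity>l. (\<Sum>\<^sub>\<infinity>k. a i k o\<^sub>B b k l) o\<^sub>B c l j) = (\<Sum>\<^sub>\<infinity>k. a i k o\<^sub>B (\<Sum>\<^sub>\<infinity>l. b k l o\<^sub>B c l j))"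
proof -
  obtain r M where a: "0 < r" "r < 1" "\<And>i j. norm (a i j) \<le> M * r ^ nat \<bar>i - j\<bar>"
    using assms(1) unfolding decaying_def by blast
  obtain s N K where bc: "0 < s" "s < 1" "0 \<le> N" "0 \<le> K"
    "\<And>i j. norm (b i j) \<le> N * s ^ nat \<bar>i - j\<bar>" "\<And>i j. norm (c i j) \<le> K * s ^ nat \<bar>i - j\<bar>"
    by (rule decayingE2[OF assms(2,3)]) blast
  have M: "0 \<le> M"
    using order_trans[OF norm_ge_zero a(3)[of 0 0]] by simp
  let ?g = "\<lambda>(l, k). (K * s ^ nat \<bar>l - j\<bar>) * (M * N * r ^ nat \<bar>i - k\<bar>)"
  have g: "?g summable_on UNIV \<times> UNIV"
  proof (rule summable_on_SigmaI)
    show "((\<lambda>k. ?g (l, k)) has_sum (K * s ^ nat \<bar>l - j\<bar>) * (\<Sum>\<^sub>\<infinity>k. M * N * r ^ nat \<bar>i - k\<bar>)) UNIV" for l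
      unfolding case_prod_conv using a
      by (intro has_sum_cmult_right has_sum_infsum summable_on_cmult_right summable_on_int_geometric_shift) auto
    show "(\<lambda>l. (K * s ^ nat \<bar>l - j\<bar>) * (\<Sum>\<^sub>\<infinity>k. M * N * r ^ nat \<bar>i - k\<bar>)) summable_on UNIV"
      using bc by (intro summable_on_cmult_left summable_on_cmult_right summable_on_int_geometric_shift') auto
  qed (use a bc M in auto)
  have bound: "norm (a i k o\<^sub>B b k l o\<^sub>B c l j) \<le> (K * s ^ nat \<bar>l - j\<bar>) * (M * N * r ^ nat \<bar>i - k\<bar>)" for k l
  proof -
    have "norm (b k l) \<le> N * s ^ nat \<bar>k - l\<bar>" by (rule bc)
    also have "\<dots> \<le> N * 1" using bc by (intro mult_left_mono power_le_one) auto
    finally have b: "norm (b k l) \<le> N" by simp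
    have "norm (a i k o\<^sub>B b k l) \<le> (M * r ^ nat \<bar>i - k\<bar>) * N"
      by (rule order_trans[OF norm_cblinfun_compose mult_mono[OF a(3) b]]) (use a M in auto)
    then have "norm (a i k o\<^sub>B b k l o\<^sub>B c l j) \<le> (M * r ^ nat \<bar>i - k\<bar> * N) * (K * s ^ nat \<bar>l - j\<bar>)"
      by (rule order_trans[OF norm_cblinfun_compose mult_mono[OF _ bc(6)]]) (use a bc M in auto)
    then show ?thesis by (simp add: mult_ac)
  qed
  have "(\<lambda>p. norm (case p of (l, k) \<Rightarrow> a i k o\<^sub>B b k l o\<^sub>B c l j)) summable_on UNIV \<times> UNIV"
    by (rule Infinite_Sum.abs_summable_on_comparison_test'[OF g]) (use bound in auto)
  then have sm: "(\<lambda>(l, k). a i k o\<^sub>B b k l o\<^sub>B c l j) summable_on UNIV \<times> UNIV"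
    by (rule abs_summable_summable)
  have "(\<Sum>\<^sub>\<infinity>l. (\<Sum>\<^sub>\<infinity>k. a i k o\<^sub>B b k l) o\<^sub>B c l j) = (\<Sum>\<^sub>\<infinity>l. \<Sum>\<^sub>\<infinity>k. a i k o\<^sub>B b k l o\<^sub>B c l j)"
    by (intro infsum_cong infsumI[symmetric] has_sum_bounded_linear[OF compose.bounded_linear_left]
        has_sum_infsum decaying_compose_summable assms)
  also have "\<dots> = (\<Sum>\<^sub>\<infinity>k. \<Sum>\<^sub>\<infinity>l. a i k o\<^sub>B b k l o\<^sub>B c l j)"
    by (rule infsum_swap_banach[OF sm])
  also have "\<dots> = (\<Sum>\<^sub>\<infinity>k. a i k o\<^sub>B (\<Sum>\<^sub>\<infinity>l. b k l o\<^sub>B c l j))"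
    unfolding cblinfun_compose_assoc
    by (intro infsum_cong infsumI has_sum_bounded_linear[OF compose.bounded_linear_right]
        has_sum_infsum decaying_compose_summable assms)
  finally show ?thesis .
qed

lift_definition proj :: "int set \<Rightarrow> 'u::complex_hilbert opmat"
  is "\<lambda>J i j. if i = j \<and> i \<in> J then id_cblinfun else 0"
  by (rule decayingI[of "1/2" _ "norm (id_cblinfun :: 'u \<Rightarrow>\<^sub>B 'u)"]) auto

instantiation opmat :: (complex_hilbert) "{ring, monoid_mult}"
begin

lift_definition zero_opmat :: "'a opmat" is "\<lambda>i j. 0"
  by (rule decayingI[of "1/2" _ 0]) auto

lift_definition plus_opmat :: "'a opmat \<Rightarrow> 'a opmat \<Rightarrow> 'a opmat" is "\<lambda>a b i j. a i j + b i j"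
proof -
  fix a b :: "int \<Rightarrow> int \<Rightarrow> 'a \<Rightarrow>\<^sub>B 'a" assume "decaying a" "decaying b"
  then obtain r M N where *: "0 < r" "r < 1" "0 \<le> M" "0 \<le> N"
    "\<And>i j. norm (a i j) \<le> M * r ^ nat \<bar>i - j\<bar>" "\<And>i j. norm (b i j) \<le> N * r ^ nat \<bar>i - j\<bar>"
    by (rule decayingE2) blast
  show "decaying (\<lambda>i j. a i j + b i j)"
    using * by (intro decayingI[of r _ "M + N"])
      (auto simp: distrib_right intro!: norm_triangle_le add_mono)
qed

lift_definition uminus_opmat :: "'a opmat \<Rightarrow> 'a opmat" is "\<lambda>a i j. - a i j"
  by (simp add: decaying_def)

definition minus_opmat :: "'a opmat \<Rightarrow> 'a opmat \<Rightarrow> 'a opmat" where "minus_opmat a b = a + - b"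

lift_definition times_opmat :: "'a opmat \<Rightarrow> 'a opmat \<Rightarrow> 'a opmat"
  is "\<lambda>a b i j. \<Sum>\<^sub>\<infinity>l. a i l o\<^sub>B b l j"
  by (rule decaying_mult)

definition one_opmat :: "'a opmat" where "one_opmat = proj UNIV"

lemma entry_proj_mult: "entry (proj J * a) i j = (if i \<in> J then entry a i j else 0)"
proof -
  have "entry (proj J * a) i j = (\<Sum>\<^sub>\<infinity>l. if l = i then (if l \<in> J then entry a l j else 0) else 0)"
    unfolding times_opmat.rep_eq proj.rep_eq
    by (intro infsum_cong) (auto simp: compose_simps)
  then show ?thesis by (simp only: infsum_single)
qed

lemma entry_mult_proj: "entry (a * proj J) i j = (if j \<in> J then entry a i j else 0)"
proof -
  have "entry (a * proj J) i j = (\<Sum>\<^sub>\<infinity>l. if l = j then (if l \<in> J then entry a i l else 0) else 0)"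
    unfolding times_opmat.rep_eq proj.rep_eq
    by (intro infsum_cong) (auto simp: compose_simps)
  then show ?thesis by (simp only: infsum_single)
qed

instance
proof
  fix a b c :: "'a opmat"
  show "a + b + c = a + (b + c)" by transfer (simp add: add.assoc)
  show "a + b = b + a" by transfer (simp add: add.commute)
  show "0 + a = a" by transfer simp
  show "- a + a = 0" by transfer simp
  show "a - b = a + - b" by (rule minus_opmat_def)
  show "a * b * c = a * (b * c)" by transfer (simp add: decaying_mult_assoc)
  show "(a + b) * c = a * c + b * c"
    by transfer (simp add: compose.add_left infsum_add decaying_compose_summable)
  show "a * (b + c) = a * b + a * c"
    by transfer (simp add: compose.add_right infsum_add decaying_compose_summable)
  show "1 * a = a" by (rule opmat_eqI) (simp add: one_opmat_def entry_proj_mult)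
  show "a * 1 = a" by (rule opmat_eqI) (simp add: one_opmat_def entry_mult_proj)
qed

end

lemma entry_simps:
  "entry 0 i j = 0" "entry (a + b) i j = entry a i j + entry b i j"
  "entry (- a) i j = - entry a i j" "entry (a - b) i j = entry a i j - entry b i j"
  "entry 1 i j = (if i = j then id_cblinfun else 0)"
  unfolding minus_opmat_def one_opmat_def zero_opmat.rep_eq plus_opmat.rep_eq
    uminus_opmat.rep_eq proj.rep_eq
  by simp_all

lemma entry_mult_has_sum: "((\<lambda>l. entry a i l o\<^sub>B entry b l j) has_sum entry (a * b) i j) UNIV"
  unfolding times_opmat.rep_eq
  by (rule has_sum_infsum[OF decaying_compose_summable(2)[OF decaying_entry decaying_entry]])

lemma proj_mult: "proj J * proj K = proj (J \<inter> K)"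
  by (rule opmat_eqI) (auto simp: entry_proj_mult proj.rep_eq)

text \<open>Meaningful for \<open>geometric\<close> coefficients; otherwise the matrix does not
  decay and \<open>Opmat\<close> is unspecified there.\<close>

definition toeplitz :: "(int \<Rightarrow> 'u::complex_hilbert \<Rightarrow>\<^sub>B 'u) \<Rightarrow> 'u opmat"
  where "toeplitz f = Opmat (\<lambda>i j. f (i - j))"

lemma entry_toeplitz:
  assumes "geometric f"
  shows "entry (toeplitz f) i j = f (i - j)"
proof -
  have "decaying (\<lambda>i j. f (i - j))"
    using assms unfolding geometric_def decaying_def by blast
  then show ?thesis
    by (simp add: toeplitz_def Opmat_inverse)
qed

text \<open>Conjugation with the bilateral shift. It is multiplicative and fixes Toeplitz matrices,
  so it carries inverses on one half line to inverses on the next.\<close>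

lift_definition shift :: "'u::complex_hilbert opmat \<Rightarrow> 'u opmat" is "\<lambda>a i j. a (i - 1) (j - 1)"
proof -
  fix a :: "int \<Rightarrow> int \<Rightarrow> 'u \<Rightarrow>\<^sub>B 'u" assume "decaying a"
  then obtain r M where *: "0 < r" "r < 1" "\<And>i j. norm (a i j) \<le> M * r ^ nat \<bar>i - j\<bar>"
    unfolding decaying_def by blast
  show "decaying (\<lambda>i j. a (i - 1) (j - 1))"
    using *(1,2) by (rule decayingI) (use *(3)[of "_ - 1" "_ - 1"] in simp)
qed

lemma shift_mult: "shift (a * b) = shift a * shift b"
proof (rule opmat_eqI)
  fix i j
  have "((\<lambda>l. entry (shift a) i l o\<^sub>B entry (shift b) l j) has_sum entry (a * b) (i - 1) (j - 1)) UNIV \<longleftrightarrow>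
      ((\<lambda>l. entry a (i - 1) l o\<^sub>B entry b l (j - 1)) has_sum entry (a * b) (i - 1) (j - 1)) UNIV"
    by (rule has_sum_reindex_bij_witness[where i = "\<lambda>l. l + 1" and j = "\<lambda>l. l - 1"])
      (auto simp: shift.rep_eq)
  then show "entry (shift (a * b)) i j = entry (shift a * shift b) i j"
    using entry_mult_has_sum[of a "i - 1" b "j - 1"]
      has_sum_unique[OF entry_mult_has_sum[of "shift a" i "shift b" j]]
    by (simp add: shift.rep_eq)
qed

lemma shift_toeplitz: "geometric f \<Longrightarrow> shift (toeplitz f) = toeplitz f"
  by (rule opmat_eqI) (simp add: shift.rep_eq entry_toeplitz)

section \<open>Toeplitz operators with contractive symbol\<close>

lemma cinner_add_right: "cinner x (y + z) = cinner x y + cinner x (z :: 'a::complex_hilbert)"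
  by (metis cinner_add_left cinner_commute complex_cnj_add)

lemma cinner_scaleC_right: "cinner x (a *\<^sub>C y) = cnj a * cinner x (y :: 'a::complex_hilbert)"
  by (metis cinner_commute cinner_scaleC_left complex_cnj_mult)

lemma cinner_zero: "cinner 0 y = 0" "cinner y (0 :: 'a::complex_hilbert) = 0"
  using cinner_add_left[of 0 0 y] cinner_add_right[of y 0 0] by simp_all

lemma cinner_sum_left: "cinner (sum f S) y = (\<Sum>i\<in>S. cinner (f i) (y :: 'a::complex_hilbert))"
  by (induction S rule: infinite_finite_induct) (simp_all add: cinner_zero cinner_add_left)

lemma cinner_sum_right: "cinner y (sum f S) = (\<Sum>i\<in>S. cinner (y :: 'a::complex_hilbert) (f i))"
  by (induction S rule: infinite_finite_induct) (simp_all add: cinner_zero cinner_add_right)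

lemma sum_roots_of_unity:
  fixes m :: int
  assumes "\<bar>m\<bar> < int N"
  shows "(\<Sum>k<N. cis (2 * pi * real k / real N) powi m) = (if m = 0 then of_nat N else 0)"
proof (cases "m = 0")
  case False
  let ?w = "cis (2 * pi * m / N)"
  have N: "N > 0" using assms by auto
  have "?w \<noteq> 1"
  proof
    assume "?w = 1"
    then have "cos (2 * pi * m / N) = 1"
      by (metis cis.simps(1) one_complex.simps(1))
    then obtain n :: int where "2 * pi * m / N = n * 2 * pi"
      by (auto simp: cos_one_2pi_int)
    then have "real_of_int m = n * real N"
      using N by (simp add: field_simps)
    then have "m = n * int N"
      by (metis of_int_eq_iff of_int_mult of_int_of_nat_eq)
    then have "\<bar>n\<bar> * int N < 1 * int N" "n \<noteq> 0"
      using assms False by (auto simp: abs_mult)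
    then show False
      using N by (simp add: mult_less_cancel_right)
  qed
  moreover have "?w ^ N = 1"
  proof -
    have "?w ^ N = cis (real N * (2 * pi * m / N))"
      by (rule Complex.DeMoivre)
    also have "real N * (2 * pi * m / N) = 2 * pi * m"
      using N by simp
    finally have "?w ^ N = cis (2 * pi * m)" .
    also have "\<dots> = 1"
      by (rule cis_multiple_2pi) simp
    finally show ?thesis .
  qed
  ultimately have "(\<Sum>k<N. ?w ^ k) = 0"
    by (simp add: geometric_sum)
  moreover have "cis (2 * pi * real k / real N) powi m = ?w ^ k" for k
    by (simp add: Complex.DeMoivre cis_power_int field_simps)
  ultimately show ?thesis using False by simp
qed simp

text \<open>Averaging over \<open>N\<close>-th roots of unity replaces the integral over the circle.
  Orthogonality then holds only for exponents that are distinct modulo \<open>N\<close>, hence the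
  condition on the differences in \<open>H\<close>.\<close>

lemma parseval_roots_of_unity:
  fixes h :: "int \<Rightarrow> 'u::complex_hilbert"
  assumes H: "finite H" "\<And>m n. m \<in> H \<Longrightarrow> n \<in> H \<Longrightarrow> \<bar>m - n\<bar> < int N"
  shows "(\<Sum>k<N. (norm (\<Sum>n\<in>H. cis (2 * pi * real k / real N) powi n *\<^sub>C h n))\<^sup>2) = N * (\<Sum>n\<in>H. (norm (h n))\<^sup>2)"
proof -
  let ?z = "\<lambda>k. cis (2 * pi * real k / N)"
  have "complex_of_real (\<Sum>k<N. (norm (\<Sum>n\<in>H. ?z k powi n *\<^sub>C h n))\<^sup>2) =
      (\<Sum>k<N. \<Sum>n\<in>H. \<Sum>m\<in>H. ?z k powi (n - m) * cinner (h n) (h m))"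
    unfolding of_real_sum cinner_self[symmetric] cinner_sum_left
    unfolding cinner_sum_right cinner_scaleC_left cinner_scaleC_right mult.assoc[symmetric]
    by (intro sum.cong refl arg_cong2[where f = "(*)"])
      (simp add: cis_power_int cis_cnj cis_mult left_diff_distrib diff_divide_distrib)
  also have "\<dots> = (\<Sum>n\<in>H. \<Sum>m\<in>H. (\<Sum>k<N. ?z k powi (n - m)) * cinner (h n) (h m))"
    unfolding sum_distrib_right by (subst sum.swap, intro sum.cong refl, rule sum.swap)
  also have "\<dots> = (\<Sum>n\<in>H. \<Sum>m\<in>H. if m = n then of_nat N * cinner (h n) (h m) else 0)"
    by (intro sum.cong refl) (simp add: sum_roots_of_unity H)
  also have "\<dots> = complex_of_real (N * (\<Sum>n\<in>H. (norm (h n))\<^sup>2))"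
    using H by (simp add: sum.delta cinner_self sum_distrib_left)
  finally show ?thesis
    by (simp only: of_real_eq_iff)
qed

text \<open>The inner sums are the coefficients of the symbol times the trigonometric polynomial
  with coefficients \<open>y\<close>. The product is bounded pointwise on the circle, Parseval is
  applied on both sides, and keeping only the rows in \<open>I\<close> decreases the left
  side.\<close>

lemma laurent_polynomial_contraction:
  fixes f :: "int \<Rightarrow> 'u::complex_hilbert \<Rightarrow>\<^sub>B 'u"
  assumes fin: "finite K" "finite J" "finite I"
    and q: "\<And>z. z \<in> \<T> \<Longrightarrow> norm (\<Sum>n\<in>K. z powi n *\<^sub>C f n) \<le> q"
  shows "(\<Sum>i\<in>I. (norm (\<Sum>l\<in>J. if i - l \<in> K then cblinfun_apply (f (i - l)) (y l) else 0))\<^sup>2)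
    \<le> q\<^sup>2 * (\<Sum>l\<in>J. (norm (y l))\<^sup>2)"
proof -
  define h where "h i = (\<Sum>l\<in>J. if i - l \<in> K then cblinfun_apply (f (i - l)) (y l) else 0)" for i
  \<comment> \<open>All exponents that occur: the prescribed rows, the support of \<open>y\<close>
    and the support of the product.\<close>
  define H where "H = I \<union> J \<union> (\<Union>l\<in>J. (\<lambda>n. n + l) ` K)"
  have finH: "finite H" using fin by (simp add: H_def)
  obtain b where b: "\<And>n. n \<in> H \<Longrightarrow> \<bar>n\<bar> \<le> b"
    using finH by (metis finite_imageI Max_ge imageI)
  \<comment> \<open>Large enough to separate any two exponents in \<open>H\<close>; the absolute
    value covers empty \<open>H\<close>, for which \<open>b\<close> is arbitrary.\<close>
  define N where "N = nat (2 * \<bar>b\<bar> + 1)"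
  have N: "N > 0" "m \<in> H \<Longrightarrow> n \<in> H \<Longrightarrow> \<bar>m - n\<bar> < int N" for m n
    using b[of m] b[of n] by (auto simp: N_def)
  have conv: "(\<Sum>i\<in>H. z powi i *\<^sub>C h i) = cblinfun_apply (\<Sum>n\<in>K. z powi n *\<^sub>C f n) (\<Sum>l\<in>J. z powi l *\<^sub>C y l)"
    if z: "z \<in> \<T>" for z
  proof -
    have z0: "z \<noteq> 0" using z by auto
    have "(\<Sum>i\<in>H. z powi i *\<^sub>C h i) =
        (\<Sum>l\<in>J. \<Sum>i\<in>H. if i - l \<in> K then z powi i *\<^sub>C cblinfun_apply (f (i - l)) (y l) else 0)"
      unfolding h_def scaleC.sum_right
      by (subst sum.swap) (intro sum.cong refl, simp add: scaleC.zero_right)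
    also have "\<dots> = (\<Sum>l\<in>J. \<Sum>n\<in>K. z powi (n + l) *\<^sub>C cblinfun_apply (f n) (y l))"
    proof (rule sum.cong[OF refl])
      fix l assume l: "l \<in> J"
      show "(\<Sum>i\<in>H. if i - l \<in> K then z powi i *\<^sub>C cblinfun_apply (f (i - l)) (y l) else 0) =
          (\<Sum>n\<in>K. z powi (n + l) *\<^sub>C cblinfun_apply (f n) (y l))"
        unfolding sum.inter_filter[OF finH, symmetric]
        by (rule sum.reindex_bij_witness[where i = "\<lambda>n. n + l" and j = "\<lambda>i. i - l"])
          (use l in \<open>auto simp: H_def\<close>)
    qed
    also have "\<dots> = (\<Sum>l\<in>J. \<Sum>n\<in>K. cblinfun_apply (z powi n *\<^sub>C f n) (z powi l *\<^sub>C y l))"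
      using z0 by (simp add: scaleC_apply cblinfun_apply_scaleC scaleC_scaleC power_int_add mult.commute)
    also have "\<dots> = cblinfun_apply (\<Sum>n\<in>K. z powi n *\<^sub>C f n) (\<Sum>l\<in>J. z powi l *\<^sub>C y l)"
      by (simp only: cbapply.sum_left cbapply.sum_right)
    finally show ?thesis .
  qed
  let ?z = "\<lambda>k. cis (2 * pi * real k / N)"
  have "N * (\<Sum>i\<in>I. (norm (h i))\<^sup>2) \<le> N * (\<Sum>i\<in>H. (norm (h i))\<^sup>2)"
    by (intro mult_left_mono sum_mono2 finH) (auto simp: H_def)
  also have "\<dots> = (\<Sum>k<N. (norm (\<Sum>i\<in>H. ?z k powi i *\<^sub>C h i))\<^sup>2)"
    using parseval_roots_of_unity[OF finH N(2), of h] by simp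
  also have "\<dots> \<le> (\<Sum>k<N. (q * norm (\<Sum>l\<in>J. ?z k powi l *\<^sub>C y l))\<^sup>2)"
  proof (intro sum_mono power_mono norm_ge_zero)
    fix k
    have z: "?z k \<in> \<T>" by simp
    show "norm (\<Sum>i\<in>H. ?z k powi i *\<^sub>C h i) \<le> q * norm (\<Sum>l\<in>J. ?z k powi l *\<^sub>C y l)"
      unfolding conv[OF z]
      by (rule order_trans[OF norm_cblinfun_apply mult_right_mono[OF q[OF z]]]) simp
  qed
  also have "\<dots> = q\<^sup>2 * (\<Sum>k<N. (norm (\<Sum>l\<in>J. ?z k powi l *\<^sub>C y l))\<^sup>2)"
    by (simp add: power_mult_distrib sum_distrib_left)
  also have "(\<Sum>k<N. (norm (\<Sum>l\<in>J. ?z k powi l *\<^sub>C y l))\<^sup>2) = N * (\<Sum>l\<in>J. (norm (y l))\<^sup>2)"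
    by (rule parseval_roots_of_unity[OF fin(2) N(2)]) (auto simp: H_def)
  finally have "real N * (\<Sum>i\<in>I. (norm (h i))\<^sup>2) \<le> real N * (q\<^sup>2 * (\<Sum>l\<in>J. (norm (y l))\<^sup>2))"
    by (simp add: mult_ac)
  then show ?thesis
    using N(1) by (simp add: h_def)
qed

text \<open>Cutting the symbol off to a large finite set changes it by less than \<open>e\<close>
  uniformly on the circle, because the coefficients are absolutely summable; then \<open>e\<close>
  tends to 0.\<close>

lemma finite_contraction:
  fixes f :: "int \<Rightarrow> 'u::complex_hilbert \<Rightarrow>\<^sub>B 'u"
  assumes sm: "(\<lambda>n. norm (f n)) summable_on UNIV"
    and q: "\<And>z. z \<in> \<T> \<Longrightarrow> norm (\<Sum>\<^sub>\<infinity>n. z powi n *\<^sub>C f n) \<le> q"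
    and fin: "finite J" "finite I"
  shows "(\<Sum>i\<in>I. (norm (\<Sum>l\<in>J. cblinfun_apply (f (i - l)) (y l)))\<^sup>2) \<le> q\<^sup>2 * (\<Sum>l\<in>J. (norm (y l))\<^sup>2)"
proof -
  have bound: "(\<Sum>i\<in>I. (norm (\<Sum>l\<in>J. cblinfun_apply (f (i - l)) (y l)))\<^sup>2)
      \<le> (q + e)\<^sup>2 * (\<Sum>l\<in>J. (norm (y l))\<^sup>2)" if e: "e > 0" for e
  proof -
    let ?D = "(\<lambda>(i, l). i - l) ` (I \<times> J)"
    obtain K0 where K0: "finite K0"
      "\<And>K. finite K \<Longrightarrow> K0 \<subseteq> K \<Longrightarrow> dist (\<Sum>n\<in>K. norm (f n)) (\<Sum>\<^sub>\<infinity>n. norm (f n)) < e"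
      using has_sum_infsum[OF sm] e unfolding has_sum_def tendsto_iff eventually_finite_subsets_at_top
      by (metis subset_UNIV)
    \<comment> \<open>Including all differences makes the truncated matrix agree with the full one
      on \<open>I \<times> J\<close>.\<close>
    define K where "K = K0 \<union> ?D"
    have K: "finite K" "?D \<subseteq> K" "dist (\<Sum>n\<in>K. norm (f n)) (\<Sum>\<^sub>\<infinity>n. norm (f n)) < e"
      using K0 fin by (auto simp: K_def)
    have "norm (\<Sum>n\<in>K. z powi n *\<^sub>C f n) \<le> q + e" if z: "z \<in> \<T>" for z
    proof -
      have norm_eq: "norm (z powi n *\<^sub>C f n) = norm (f n)" for n
        using z by (simp add: norm_scaleC norm_power_int)
      have smz: "(\<lambda>n. z powi n *\<^sub>C f n) summable_on UNIV"
        by (rule abs_summable_summable) (simp add: norm_eq sm)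
      have smK: "(\<lambda>n. norm (f n)) summable_on (- K)"
        by (rule summable_on_subset_banach[OF sm]) simp
      have "(\<Sum>\<^sub>\<infinity>n. z powi n *\<^sub>C f n) = (\<Sum>\<^sub>\<infinity>n\<in>K. z powi n *\<^sub>C f n) + (\<Sum>\<^sub>\<infinity>n\<in>-K. z powi n *\<^sub>C f n)"
        using infsum_Un_disjoint[of "\<lambda>n. z powi n *\<^sub>C f n" K "- K"] K summable_on_subset_banach[OF smz, of "- K"]
        by simp
      moreover have "(\<Sum>\<^sub>\<infinity>n. norm (f n)) = (\<Sum>\<^sub>\<infinity>n\<in>K. norm (f n)) + (\<Sum>\<^sub>\<infinity>n\<in>-K. norm (f n))"
        using infsum_Un_disjoint[of "\<lambda>n. norm (f n)" K "- K"] K smK by simp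
      moreover have "norm (\<Sum>\<^sub>\<infinity>n\<in>-K. z powi n *\<^sub>C f n) \<le> (\<Sum>\<^sub>\<infinity>n\<in>-K. norm (f n))"
        using norm_infsum_bound[of "\<lambda>n. z powi n *\<^sub>C f n" "- K"] smK by (simp add: norm_eq)
      ultimately show ?thesis
        using K(1,3) q[OF z] norm_triangle_ineq4[of "\<Sum>\<^sub>\<infinity>n. z powi n *\<^sub>C f n" "\<Sum>\<^sub>\<infinity>n\<in>-K. z powi n *\<^sub>C f n"]
        by (simp add: dist_real_def)
    qed
    from laurent_polynomial_contraction[OF K(1) fin this, of y]
    have "(\<Sum>i\<in>I. (norm (\<Sum>l\<in>J. if i - l \<in> K then cblinfun_apply (f (i - l)) (y l) else 0))\<^sup>2)
      \<le> (q + e)\<^sup>2 * (\<Sum>l\<in>J. (norm (y l))\<^sup>2)" .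
    moreover have "(\<Sum>l\<in>J. if i - l \<in> K then cblinfun_apply (f (i - l)) (y l) else 0) =
      (\<Sum>l\<in>J. cblinfun_apply (f (i - l)) (y l))" if "i \<in> I" for i
      using K(2) that by (intro sum.cong) auto
    ultimately show ?thesis by simp
  qed
  have "((\<lambda>e. (q + e)\<^sup>2 * (\<Sum>l\<in>J. (norm (y l))\<^sup>2)) \<longlongrightarrow> (q + 0)\<^sup>2 * (\<Sum>l\<in>J. (norm (y l))\<^sup>2)) (at_right 0)"
    by (intro tendsto_intros)
  moreover have "eventually (\<lambda>e. (\<Sum>i\<in>I. (norm (\<Sum>l\<in>J. cblinfun_apply (f (i - l)) (y l)))\<^sup>2)
      \<le> (q + e)\<^sup>2 * (\<Sum>l\<in>J. (norm (y l))\<^sup>2)) (at_right 0)"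
    using bound by (auto simp: eventually_at_right_field intro: exI[of _ 1])
  ultimately show ?thesis
    using tendsto_lowerbound[of "\<lambda>e. (q + e)\<^sup>2 * (\<Sum>l\<in>J. (norm (y l))\<^sup>2)"] by fastforce
qed

text \<open>The operator norm bound on square summable sequences, expressed by finite partial sums
  on both sides; the number \<open>c\<close> stands for the squared norm of
  \<open>y\<close>.\<close>

lemma toeplitz_contraction:
  fixes f :: "int \<Rightarrow> 'u::complex_hilbert \<Rightarrow>\<^sub>B 'u"
  assumes sm: "(\<lambda>n. norm (f n)) summable_on UNIV"
    and q: "\<And>z. z \<in> \<T> \<Longrightarrow> norm (\<Sum>\<^sub>\<infinity>n. z powi n *\<^sub>C f n) \<le> q"
    and y: "\<And>J. finite J \<Longrightarrow> (\<Sum>l\<in>J. (norm (y l))\<^sup>2) \<le> c"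
    and I: "finite I" and h: "\<And>i. i \<in> I \<Longrightarrow> ((\<lambda>l. cblinfun_apply (f (i - l)) (y l)) has_sum h i) UNIV"
  shows "(\<Sum>i\<in>I. (norm (h i))\<^sup>2) \<le> q\<^sup>2 * c"
proof (rule tendsto_upperbound)
  show "((\<lambda>J. \<Sum>i\<in>I. (norm (\<Sum>l\<in>J. cblinfun_apply (f (i - l)) (y l)))\<^sup>2) \<longlongrightarrow> (\<Sum>i\<in>I. (norm (h i))\<^sup>2))
      (finite_subsets_at_top UNIV)"
    using h unfolding has_sum_def by (intro tendsto_intros)
  show "\<forall>\<^sub>F J in finite_subsets_at_top UNIV.
      (\<Sum>i\<in>I. (norm (\<Sum>l\<in>J. cblinfun_apply (f (i - l)) (y l)))\<^sup>2) \<le> q\<^sup>2 * c"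
    by (rule eventually_finite_subsets_at_top_weakI)
      (auto intro!: order_trans[OF finite_contraction[OF sm q _ I] mult_left_mono[OF y]])
qed simp

section \<open>Weighted powers of the half-line matrix and its inverse\<close>

definition half_line :: "'u::complex_hilbert opmat" where "half_line = proj {0..}"

text \<open>The weights \<open>\<rho>\<^bsup>i-j\<^esup>\<close> turn the Toeplitz matrix with symbol \<open>f z\<close> into the one with symbol
  \<open>f (\<rho> z)\<close>.\<close>

lemma toeplitz_power_bound:
  fixes f :: "int \<Rightarrow> 'u::complex_hilbert \<Rightarrow>\<^sub>B 'u"
  assumes f: "geometric f" and \<rho>: "\<rho> > 0" and "q \<ge> 0"
    and sm: "(\<lambda>n. norm (\<rho> powi n *\<^sub>R f n)) summable_on UNIV"
    and q: "\<And>z. z \<in> \<T> \<Longrightarrow> norm (\<Sum>\<^sub>\<infinity>n. z powi n *\<^sub>C (\<rho> powi n *\<^sub>R f n)) \<le> q"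
  shows "\<rho> powi (i - j) * norm (entry ((half_line * toeplitz f * half_line) ^ k) i j) \<le> q ^ k"
proof -
  define T where "T = half_line * toeplitz f * half_line"
  have T: "entry T i l = (if i \<ge> 0 \<and> l \<ge> 0 then f (i - l) else 0)" for i l
    by (simp add: T_def half_line_def entry_mult_proj entry_proj_mult entry_toeplitz[OF f])
  \<comment> \<open>The induction needs the square-sum bound for a whole column; a bound for single
    entries would not propagate through the matrix product.\<close>
  have sum_bound: "(\<Sum>i\<in>I. (norm (\<rho> powi (i - j) *\<^sub>R cblinfun_apply (entry (T ^ k) i j) u))\<^sup>2)
      \<le> (q ^ k * norm u)\<^sup>2" if I: "finite I" for I u
    using I
  proof (induction k arbitrary: I)
    case 0
    have "(\<Sum>i\<in>I. (norm (\<rho> powi (i - j) *\<^sub>R cblinfun_apply (entry (T ^ 0) i j) u))\<^sup>2)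
        = (\<Sum>i\<in>I. if i = j then (norm u)\<^sup>2 else 0)"
      by (intro sum.cong) (auto simp: entry_simps id_cblinfun.rep_eq cbapply.zero_left)
    then show ?case by (simp add: 0)
  next
    case (Suc k)
    \<comment> \<open>Set to 0 at negative \<open>l\<close>, so that the full Toeplitz matrix acts
      on \<open>y\<close> in the same way as its compression.\<close>
    define y where "y l = (if l \<ge> 0 then \<rho> powi (l - j) *\<^sub>R cblinfun_apply (entry (T ^ k) l j) u else 0)" for l
    define h where "h i = \<rho> powi (i - j) *\<^sub>R cblinfun_apply (entry (T ^ Suc k) i j) u" for i
    have y: "(\<Sum>l\<in>J. (norm (y l))\<^sup>2) \<le> (q ^ k * norm u)\<^sup>2" if "finite J" for J
      by (rule order_trans[OF sum_mono Suc.IH[OF that]]) (simp add: y_def)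
    have row: "((\<lambda>l. \<rho> powi (i - j) *\<^sub>R cblinfun_apply (entry T i l o\<^sub>B entry (T ^ k) l j) u) has_sum h i) UNIV" for i
      unfolding h_def power_Suc
      by (intro has_sum_bounded_linear[OF bounded_linear_scaleR_right]
          has_sum_bounded_linear[OF cbapply.bounded_linear_left] entry_mult_has_sum)
    have zero: "h i = 0" if "i < 0" for i
      using row[of i] that by (simp add: T compose.zero_left cbapply.zero_left)
        (metis has_sum_0 has_sum_unique)
    \<comment> \<open>The weights are multiplicative along \<open>i\<close>, \<open>l\<close>,
      \<open>j\<close>, so one part goes to the symbol and the other to the column.\<close>
    have weights: "\<rho> powi (i - j) = \<rho> powi (i - l) * \<rho> powi (l - j)" for i l
      using \<rho> by (simp flip: power_int_add)
    have "((\<lambda>l. cblinfun_apply (\<rho> powi (i - l) *\<^sub>R f (i - l)) (y l)) has_sum h i) UNIV" if "i \<ge> 0" for i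
    proof -
      have "\<rho> powi (i - j) *\<^sub>R cblinfun_apply (entry T i l o\<^sub>B entry (T ^ k) l j) u =
          cblinfun_apply (\<rho> powi (i - l) *\<^sub>R f (i - l)) (y l)" for l
        using that by (simp add: T y_def weights[of i l] cblinfun_compose.rep_eq cbapply.scaleR_left
            cbapply.scaleR_right cbapply.zero_left cbapply.zero_right)
      then show ?thesis using row[of i] by simp
    qed
    from toeplitz_contraction[OF sm q y _ this, of "I \<inter> {0..}"]
    have "(\<Sum>i\<in>I \<inter> {0..}. (norm (h i))\<^sup>2) \<le> q\<^sup>2 * (q ^ k * norm u)\<^sup>2"
      using Suc.prems by auto
    moreover have "(\<Sum>i\<in>I \<inter> {0..}. (norm (h i))\<^sup>2) = (\<Sum>i\<in>I. (norm (h i))\<^sup>2)"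
      by (rule sum.mono_neutral_left) (use Suc.prems zero in \<open>auto simp: not_le\<close>)
    ultimately show ?case
      by (simp add: h_def power_mult_distrib)
  qed
  have "norm (\<rho> powi (i - j) *\<^sub>R entry (T ^ k) i j) \<le> q ^ k"
  proof (rule norm_cblinfun_bound)
    fix u
    have "(norm (\<rho> powi (i - j) *\<^sub>R cblinfun_apply (entry (T ^ k) i j) u))\<^sup>2 \<le> (q ^ k * norm u)\<^sup>2"
      using sum_bound[of "{i}" u] by simp
    then show "norm (cblinfun_apply (\<rho> powi (i - j) *\<^sub>R entry (T ^ k) i j) u) \<le> q ^ k * norm u"
      unfolding cbapply.scaleR_left by (rule power2_le_imp_le) (use \<open>q \<ge> 0\<close> in simp)
  qed (use \<open>q \<ge> 0\<close> in simp)
  then show ?thesis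
    using \<rho> by (simp add: T_def)
qed

text \<open>The quotient of \<open>s ^ n - 1\<close> by \<open>s - 1\<close> is a sum of powers and
  therefore grows with \<open>s\<close>.\<close>

lemma power_minus_one_chord:
  fixes s t :: real
  assumes "1 \<le> s" "s \<le> t" "1 < t"
  shows "s ^ n - 1 \<le> (s - 1) / (t - 1) * (t ^ n - 1)"
proof -
  have "s ^ n - 1 = (s - 1) * (\<Sum>i<n. s ^ i)"
    by (rule power_diff_1_eq)
  also have "\<dots> \<le> (s - 1) * (\<Sum>i<n. t ^ i)"
    using assms by (intro mult_left_mono sum_mono power_mono) auto
  also have "\<dots> = (s - 1) / (t - 1) * (t ^ n - 1)"
    using assms by (subst power_diff_1_eq) simp
  finally show ?thesis .
qed

text \<open>As \<rho> tends to 1, the weighted symbol tends to the original one uniformly on the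
  circle. A deviation of at most \<open>(1 - q) / 2\<close> leaves the bound
  \<open>p = (1 + q) / 2\<close>, which is below 1.\<close>

lemma weighted_symbol_bound:
  fixes f :: "int \<Rightarrow> 'a::{complex_normed_vector, banach}"
  assumes f: "geometric f" and q: "q < 1"
    and symbol: "\<And>z. z \<in> \<T> \<Longrightarrow> norm (\<Sum>\<^sub>\<infinity>n. z powi n *\<^sub>C f n) \<le> q"
  obtains t p where "1 < t" "p < 1"
    "\<forall>\<rho>\<in>{t, 1 / t}. (\<lambda>n. norm (\<rho> powi n *\<^sub>R f n)) summable_on UNIV"
    "\<forall>\<rho>\<in>{t, 1 / t}. \<forall>z\<in>\<T>. norm (\<Sum>\<^sub>\<infinity>n. z powi n *\<^sub>C (\<rho> powi n *\<^sub>R f n)) \<le> p"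
proof -
  obtain r M where r: "0 < r" "r < 1" and M: "\<And>n. norm (f n) \<le> M * r ^ nat \<bar>n\<bar>"
    using f unfolding geometric_def by blast
  \<comment> \<open>Half of the exponential margin: weights with base \<open>t1\<close> turn the
    rate \<open>r\<close> into \<open>sqrt r\<close>, which is still summable.\<close>
  define t1 where "t1 = 1 / sqrt r"
  have t1: "1 < t1" "r * t1 = sqrt r" using r by (auto simp: t1_def real_div_sqrt)
  have sm1: "(\<lambda>n. norm (f n) * t1 ^ nat \<bar>n\<bar>) summable_on UNIV"
  proof -
    have "(\<lambda>n. norm (norm (f n) * t1 ^ nat \<bar>n\<bar>)) summable_on UNIV"
    proof (rule Infinite_Sum.abs_summable_on_comparison_test')
      show "(\<lambda>n::int. M * sqrt r ^ nat \<bar>n\<bar>) summable_on UNIV"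
        using r by (intro summable_on_cmult_right summable_on_int_geometric) auto
      show "norm (norm (f n) * t1 ^ nat \<bar>n\<bar>) \<le> M * sqrt r ^ nat \<bar>n\<bar>" for n
        using mult_right_mono[OF M[of n], of "t1 ^ nat \<bar>n\<bar>"] t1
        by (simp add: mult.assoc flip: power_mult_distrib)
    qed
    then show ?thesis using t1 by simp
  qed
  define g where "g = (\<Sum>\<^sub>\<infinity>n. norm (f n) * t1 ^ nat \<bar>n\<bar>)"
  have g: "g \<ge> 0" unfolding g_def using t1 by (intro infsum_nonneg) auto
  \<comment> \<open>The fraction of the way from 1 to \<open>t1\<close> at which the total deviation
    is at most \<open>(1 - q) / 2\<close>. Adding 1 to \<open>g\<close> avoids a zero denominator,
    and the minimum keeps \<open>t \<le> t1\<close>.\<close>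
  define d where "d = min 1 ((1 - q) / 2 / (g + 1))"
  have d: "0 < d" "d \<le> 1" "d * g \<le> (1 - q) / 2"
  proof -
    show "0 < d" "d \<le> 1" using q g by (auto simp: d_def)
    have "d * g \<le> (1 - q) / 2 / (g + 1) * (g + 1)"
      using q g by (intro mult_mono) (auto simp: d_def)
    also have "\<dots> = (1 - q) / 2" using g by (intro nonzero_eq_divide_eq[THEN iffD1, OF _ refl]) simp
    finally show "d * g \<le> (1 - q) / 2" .
  qed
  define t where "t = 1 + d * (t1 - 1)"
  have t: "1 < t" "t \<le> t1" "(t - 1) / (t1 - 1) = d"
  proof -
    have "d * (t1 - 1) \<le> t1 - 1"
      using d t1 by (intro mult_left_le_one_le) auto
    then show "t \<le> t1"
      by (simp only: t_def le_diff_eq add.commute)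
    show "1 < t" "(t - 1) / (t1 - 1) = d"
      using d t1 by (auto simp: t_def)
  qed
  \<comment> \<open>Of a power of \<open>t\<close> and its reciprocal the power lies farther from 1;
    the chord estimate makes its deviation proportional to \<open>d\<close>.\<close>
  have dev: "\<bar>\<rho> powi n - 1\<bar> \<le> d * t1 ^ nat \<bar>n\<bar>" if "\<rho> = t \<or> \<rho> = 1 / t" for \<rho> and n :: int
  proof -
    have "\<bar>\<rho> powi n - 1\<bar> \<le> t ^ nat \<bar>n\<bar> - 1"
    proof -
      have "\<rho> powi n = t ^ nat \<bar>n\<bar> \<or> \<rho> powi n = 1 / t ^ nat \<bar>n\<bar>"
        using that by (auto simp: power_int_def power_divide inverse_eq_divide)
      moreover have "1 - 1 / x \<le> x - 1" if "x \<ge> 1" for x :: real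
        using that sum_squares_ge_zero[of "x - 1" 0] by (simp add: field_simps power2_eq_square)
      moreover have "t ^ nat \<bar>n\<bar> \<ge> 1" using t by simp
      ultimately show ?thesis by (auto simp: abs_if)
    qed
    also have "\<dots> \<le> d * (t1 ^ nat \<bar>n\<bar> - 1)"
      using power_minus_one_chord[of t t1 "nat \<bar>n\<bar>"] t t1 by simp
    also have "\<dots> \<le> d * t1 ^ nat \<bar>n\<bar>"
      using d by simp
    finally show ?thesis .
  qed
  have dev_f: "norm (\<rho> powi n *\<^sub>R f n - f n) \<le> d * (norm (f n) * t1 ^ nat \<bar>n\<bar>)"
    if "\<rho> = t \<or> \<rho> = 1 / t" for \<rho> and n :: int
  proof -
    have "norm (\<rho> powi n *\<^sub>R f n - f n) = \<bar>\<rho> powi n - 1\<bar> * norm (f n)"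
      by (metis norm_scaleR scaleR_left_diff_distrib scaleR_one)
    then show ?thesis
      using mult_right_mono[OF dev[OF that, of n], of "norm (f n)"] by (simp add: mult_ac)
  qed
  have smf: "(\<lambda>n. norm (f n)) summable_on UNIV"
    by (rule geometric_abs_summable[OF f])
  have smd: "(\<lambda>n. norm (\<rho> powi n *\<^sub>R f n - f n)) summable_on UNIV" if "\<rho> = t \<or> \<rho> = 1 / t" for \<rho>
    by (rule Infinite_Sum.abs_summable_on_comparison_test'[OF summable_on_cmult_right[OF sm1] dev_f[OF that]])
  have sm\<rho>: "(\<lambda>n. norm (\<rho> powi n *\<^sub>R f n)) summable_on UNIV" if "\<rho> = t \<or> \<rho> = 1 / t" for \<rho>
    by (rule Infinite_Sum.abs_summable_on_comparison_test'[OF summable_on_add[OF smf smd[OF that]]])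
      (rule norm_triangle_sub)
  have "norm (\<Sum>\<^sub>\<infinity>n. z powi n *\<^sub>C (\<rho> powi n *\<^sub>R f n)) \<le> (1 + q) / 2"
    if \<rho>: "\<rho> = t \<or> \<rho> = 1 / t" and z: "z \<in> \<T>" for \<rho> :: real and z :: complex
  proof -
    have nz: "norm (z powi n *\<^sub>C x) = norm x" for n and x :: 'a
      using z by (simp add: norm_scaleC norm_power_int)
    have s1: "(\<lambda>n. z powi n *\<^sub>C f n) summable_on UNIV"
      by (rule abs_summable_summable) (simp add: nz smf)
    have s2: "(\<lambda>n. z powi n *\<^sub>C (\<rho> powi n *\<^sub>R f n - f n)) summable_on UNIV"
      by (rule abs_summable_summable) (simp add: nz smd[OF \<rho>])
    have "(\<Sum>\<^sub>\<infinity>n. z powi n *\<^sub>C (\<rho> powi n *\<^sub>R f n)) =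
        (\<Sum>\<^sub>\<infinity>n. z powi n *\<^sub>C f n) + (\<Sum>\<^sub>\<infinity>n. z powi n *\<^sub>C (\<rho> powi n *\<^sub>R f n - f n))"
      by (subst infsum_add[OF s1 s2, symmetric]) (simp add: scaleC.diff_right)
    moreover have "norm (\<Sum>\<^sub>\<infinity>n. z powi n *\<^sub>C (\<rho> powi n *\<^sub>R f n - f n)) \<le> d * g"
    proof (rule norm_infsum_le[OF has_sum_infsum[OF s2]])
      show "((\<lambda>n. d * (norm (f n) * t1 ^ nat \<bar>n\<bar>)) has_sum d * g) UNIV"
        unfolding g_def by (intro has_sum_cmult_right has_sum_infsum sm1)
    qed (simp add: nz dev_f[OF \<rho>])
    ultimately show ?thesis
      using symbol[OF z] d(3)
        norm_triangle_ineq[of "\<Sum>\<^sub>\<infinity>n. z powi n *\<^sub>C f n" "\<Sum>\<^sub>\<infinity>n. z powi n *\<^sub>C (\<rho> powi n *\<^sub>R f n - f n)"]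
      by (simp only: add_divide_distrib diff_divide_distrib)
  qed
  note symbol_\<rho> = this
  show thesis
  proof (rule that[of t "(1 + q) / 2"])
    show "1 < t" "(1 + q) / 2 < 1" using t q by auto
    show "\<forall>\<rho>\<in>{t, 1 / t}. (\<lambda>n. norm (\<rho> powi n *\<^sub>R f n)) summable_on UNIV"
      by (intro ballI sm\<rho>) simp
    show "\<forall>\<rho>\<in>{t, 1 / t}. \<forall>z\<in>\<T>. norm (\<Sum>\<^sub>\<infinity>n. z powi n *\<^sub>C (\<rho> powi n *\<^sub>R f n)) \<le> (1 + q) / 2"
      by (intro ballI symbol_\<rho>) simp_all
  qed
qed

text \<open>Multiplication by a fixed decaying matrix is bounded for the supremum of the entry
  norms, since its rows and columns have uniformly bounded sums. Error terms can thus be multiplied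
  by \<open>1 - X\<close> in the Neumann argument.\<close>

lemma opmat_mult_bounds:
  fixes a :: "'u::complex_hilbert opmat"
  obtains C where "\<And>b c i j. (\<And>i j. norm (entry b i j) \<le> c) \<Longrightarrow> norm (entry (a * b) i j) \<le> C * c"
    "\<And>b c i j. (\<And>i j. norm (entry b i j) \<le> c) \<Longrightarrow> norm (entry (b * a) i j) \<le> C * c"
proof -
  obtain r M where r: "0 < r" "r < 1" and M: "\<And>i j. norm (entry a i j) \<le> M * r ^ nat \<bar>i - j\<bar>"
    using decaying_entry[of a] unfolding decaying_def by blast
  define C where "C = M * (\<Sum>\<^sub>\<infinity>l::int. r ^ nat \<bar>l\<bar>)"
  have s: "((\<lambda>l. r ^ nat \<bar>i - l\<bar>) has_sum (\<Sum>\<^sub>\<infinity>l::int. r ^ nat \<bar>l\<bar>)) UNIV" for i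
    unfolding int_geometric_shift using r by (simp add: summable_on_int_geometric)
  have cs: "((\<lambda>l. M * r ^ nat \<bar>i - l\<bar> * c) has_sum C * c) UNIV" for i c
    unfolding C_def by (intro has_sum_cmult_left has_sum_cmult_right s)
  have "norm (entry (a * b) i j) \<le> C * c" "norm (entry (b * a) i j) \<le> C * c"
    if b: "\<And>i j. norm (entry b i j) \<le> c" for b c i j
  proof -
    have c: "0 \<le> c" using order_trans[OF norm_ge_zero b] .
    show "norm (entry (a * b) i j) \<le> C * c"
    proof (rule norm_infsum_le[OF entry_mult_has_sum cs])
      show "norm (entry a i l o\<^sub>B entry b l j) \<le> M * r ^ nat \<bar>i - l\<bar> * c" for l
        by (rule order_trans[OF norm_cblinfun_compose mult_mono[OF M b]])
          (use order_trans[OF norm_ge_zero M] in auto)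
    qed
    show "norm (entry (b * a) i j) \<le> C * c"
    proof (rule norm_infsum_le[OF entry_mult_has_sum cs])
      show "norm (entry b i l o\<^sub>B entry a l j) \<le> M * r ^ nat \<bar>j - l\<bar> * c" for l
        using order_trans[OF norm_cblinfun_compose mult_mono[OF b[of i l] M[of l j]]] c
        by (simp add: mult.commute abs_minus_commute)
    qed
  qed
  then show thesis by (rule that)
qed

text \<open>The series is summed entry by entry. One rate \<open>s\<close> for all powers keeps the
  sum decaying, and the tails are small uniformly in \<open>i\<close> and \<open>j\<close>, so the
  finite geometric identities pass to the limit.\<close>

lemma opmat_neumann:
  fixes X :: "'u::complex_hilbert opmat"
  assumes q: "0 \<le> q" "q < 1" and s: "0 < s" "s < 1"
    and X: "\<And>k i j. norm (entry (X ^ k) i j) \<le> q ^ k * s ^ nat \<bar>i - j\<bar>"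
  obtains N where "(1 - X) * N = 1" "N * (1 - X) = 1"
proof -
  have sm: "summable (\<lambda>k. norm (entry (X ^ k) i j))" for i j
    by (rule summable_comparison_test'[where g = "\<lambda>k. q ^ k * s ^ nat \<bar>i - j\<bar>"])
      (use X q in \<open>auto intro!: summable_mult2 summable_geometric\<close>)
  define n where "n i j = (\<Sum>k. entry (X ^ k) i j)" for i j
  have n_bound: "norm (\<Sum>k. entry (X ^ (k + m)) i j) \<le> q ^ m / (1 - q) * s ^ nat \<bar>i - j\<bar>" for i j m
  proof -
    have sums: "(\<lambda>k. q ^ m * s ^ nat \<bar>i - j\<bar> * q ^ k) sums (q ^ m * s ^ nat \<bar>i - j\<bar> * (1 / (1 - q)))"
      using q by (intro sums_mult geometric_sums) auto
    have "norm (\<Sum>k. entry (X ^ (k + m)) i j) \<le> (\<Sum>k. q ^ m * s ^ nat \<bar>i - j\<bar> * q ^ k)"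
      by (rule norm_suminf_le[OF _ sums_summable[OF sums]])
        (use X[of "_ + m"] in \<open>simp add: power_add mult_ac\<close>)
    then show ?thesis using sums_unique[OF sums] by simp
  qed
  have dec: "decaying n"
    by (rule decayingI[OF s, of _ "1 / (1 - q)"]) (use n_bound[of 0] in \<open>simp add: n_def\<close>)
  define N where "N = Opmat n"
  have entry_N: "entry N = n"
    by (simp add: N_def Opmat_inverse dec)
  define S where "S m = (\<Sum>k<m. X ^ k)" for m
  have entry_S: "entry (S m) i j = (\<Sum>k<m. entry (X ^ k) i j)" for m i j
    by (induction m) (simp_all add: S_def entry_simps)
  have tail: "norm (entry (N - S m) i j) \<le> q ^ m / (1 - q)" for m i j
  proof -
    have "entry (N - S m) i j = (\<Sum>k. entry (X ^ (k + m)) i j)"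
      using suminf_split_initial_segment[OF summable_norm_cancel[OF sm], of i j m]
      by (simp add: entry_simps entry_N entry_S n_def)
    moreover have "q ^ m / (1 - q) * s ^ nat \<bar>i - j\<bar> \<le> q ^ m / (1 - q) * 1"
      using q s by (intro mult_left_mono power_le_one) auto
    ultimately show ?thesis using n_bound[of m i j] by simp
  qed
  have S: "(1 - X) * S m = 1 - X ^ m" "S m * (1 - X) = 1 - X ^ m" for m
  proof (induction m)
    case (Suc m)
    have "S (Suc m) = S m + X ^ m" by (simp add: S_def)
    then have "(1 - X) * S (Suc m) = (1 - X) * S m + (1 - X) * X ^ m"
      "S (Suc m) * (1 - X) = S m * (1 - X) + X ^ m * (1 - X)"
      by (simp_all only: distrib_left distrib_right)
    then show "(1 - X) * S (Suc m) = 1 - X ^ Suc m" "S (Suc m) * (1 - X) = 1 - X ^ Suc m"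
      unfolding Suc by (simp_all add: left_diff_distrib right_diff_distrib power_commutes)
  qed (simp_all add: S_def)
  obtain C where C: "\<And>b c i j. (\<And>i j. norm (entry b i j) \<le> c) \<Longrightarrow> norm (entry ((1 - X) * b) i j) \<le> C * c"
    "\<And>b c i j. (\<And>i j. norm (entry b i j) \<le> c) \<Longrightarrow> norm (entry (b * (1 - X)) i j) \<le> C * c"
    by (rule opmat_mult_bounds[of "1 - X"]) blast
  have Xm: "norm (entry (X ^ m) i j) \<le> q ^ m" for m i j
    using X[of m i j] mult_left_mono[of "s ^ nat \<bar>i - j\<bar>" 1 "q ^ m"] q s
    by (simp add: power_le_one)
  have lim: "(\<lambda>m. C * (q ^ m / (1 - q)) + q ^ m) \<longlonglongrightarrow> C * (0 / (1 - q)) + 0"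
    using q by (intro tendsto_intros LIMSEQ_realpow_zero) auto
  have zero: "a = 0" if "\<And>m. a = b m - X ^ m" "\<And>m i j. norm (entry (b m) i j) \<le> C * (q ^ m / (1 - q))"
    for a and b :: "nat \<Rightarrow> 'u opmat"
  proof (rule opmat_eqI)
    fix i j
    have "norm (entry a i j) \<le> C * (q ^ m / (1 - q)) + q ^ m" for m
      unfolding that(1)[of m] entry_simps
      by (rule order_trans[OF norm_triangle_ineq4 add_mono[OF that(2) Xm]])
    then have "norm (entry a i j) \<le> C * (0 / (1 - q)) + 0"
      by (intro LIMSEQ_le_const[OF lim]) auto
    then show "entry a i j = entry 0 i j" by (simp add: entry_simps)
  qed
  have "(1 - X) * N - 1 = 0"
  proof (rule zero)
    show "(1 - X) * N - 1 = (1 - X) * (N - S m) - X ^ m" for m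
      unfolding right_diff_distrib[of "1 - X"] S by simp
  qed (intro C tail)
  moreover have "N * (1 - X) - 1 = 0"
  proof (rule zero)
    show "N * (1 - X) - 1 = (N - S m) * (1 - X) - X ^ m" for m
      unfolding left_diff_distrib[of N] S by simp
  qed (intro C tail)
  ultimately show thesis
    using that[of N] by simp
qed

text \<open>Off the half line \<open>1 - X\<close> is the identity, so inverting it in the full ring
  also inverts the half-line Toeplitz matrix.\<close>

lemma toeplitz_half_line_inverse:
  fixes f :: "int \<Rightarrow> 'u::complex_hilbert \<Rightarrow>\<^sub>B 'u"
  assumes f: "geometric f" and q: "q < 1"
    and symbol: "\<And>z. z \<in> \<T> \<Longrightarrow> norm (\<Sum>\<^sub>\<infinity>n. z powi n *\<^sub>C f n) \<le> q"
  obtains R where "half_line * R = R" "R * half_line = R"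
    "half_line * (1 - toeplitz f) * R = half_line" "R * (1 - toeplitz f) * half_line = half_line"
proof -
  obtain t p where t: "1 < t" and p: "p < 1"
    and sm: "\<forall>\<rho>\<in>{t, 1 / t}. (\<lambda>n. norm (\<rho> powi n *\<^sub>R f n)) summable_on UNIV"
    and bd: "\<forall>\<rho>\<in>{t, 1 / t}. \<forall>z\<in>\<T>. norm (\<Sum>\<^sub>\<infinity>n. z powi n *\<^sub>C (\<rho> powi n *\<^sub>R f n)) \<le> p"
    by (rule weighted_symbol_bound[OF f q symbol])
  have p0: "0 \<le> p"
    using order_trans[OF norm_ge_zero bd[rule_format, of t 1]] by simp
  define P :: "'u opmat" where "P = half_line"
  have PP: "P * P = P" by (simp add: P_def half_line_def proj_mult)
  define X where "X = P * toeplitz f * P"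
  have PX: "P * X = X" "X * P = X"
    by (simp_all add: X_def PP mult.assoc) (simp add: PP flip: mult.assoc)
  have X_bound: "norm (entry (X ^ k) i j) \<le> p ^ k * (1 / t) ^ nat \<bar>i - j\<bar>" for k i j
  proof -
    \<comment> \<open>The weight is chosen by the side of the diagonal, so that it always equals
      \<open>t ^ nat \<bar>i - j\<bar>\<close>.\<close>
    define \<rho> where "\<rho> = (if i \<ge> j then t else 1 / t)"
    have \<rho>: "\<rho> \<in> {t, 1 / t}" "\<rho> > 0" using t by (auto simp: \<rho>_def)
    have "\<rho> powi (i - j) = t ^ nat \<bar>i - j\<bar>"
      using t by (auto simp: \<rho>_def power_int_def field_simps power_inverse)
    then have "t ^ nat \<bar>i - j\<bar> * norm (entry (X ^ k) i j) \<le> p ^ k"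
      using toeplitz_power_bound[OF f \<rho>(2) p0 sm[rule_format, OF \<rho>(1)] bd[rule_format, OF \<rho>(1)], of i j k]
      by (simp add: X_def P_def)
    then show ?thesis
      using t by (simp add: field_simps)
  qed
  obtain N where N: "(1 - X) * N = 1" "N * (1 - X) = 1"
    by (rule opmat_neumann[OF p0 p _ _ X_bound]) (use t in auto)
  \<comment> \<open>Since \<open>X\<close> commutes with \<open>P\<close>, so does the inverse
    \<open>N\<close>; hence \<open>P * N\<close> is the half-line block of \<open>N\<close>.\<close>
  have PN: "P * N = N * P"
  proof -
    have "P * N = N * ((1 - X) * P) * N"
      using N by (simp flip: mult.assoc)
    also have "(1 - X) * P = P * (1 - X)"
      by (simp add: PX algebra_simps)
    also have "N * (P * (1 - X)) * N = N * P"
      using N by (simp add: mult.assoc)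
    finally show ?thesis .
  qed
  show thesis
  proof (rule that[of "P * N"])
    have "P * (1 - toeplitz f) * P = P * (1 - X)"
      by (simp add: X_def algebra_simps PP) (simp add: PP flip: mult.assoc)
    then have "P * (1 - toeplitz f) * (P * N) = P"
      using N by (simp add: mult.assoc[symmetric]) (simp add: N mult.assoc)
    then show "half_line * (1 - toeplitz f) * (P * N) = half_line"
      by (simp add: P_def)
    have "P * (1 - toeplitz f) * P = (1 - X) * P"
      by (simp add: X_def algebra_simps PP)
    then have "N * (P * (1 - toeplitz f) * P) = N * ((1 - X) * P)"
      by simp
    also have "\<dots> = P"
      using N(2) by (simp flip: mult.assoc)
    finally have "N * P * (1 - toeplitz f) * P = P"
      by (simp add: mult.assoc)
    then show "P * N * (1 - toeplitz f) * half_line = half_line"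
      by (simp add: P_def PN[unfolded P_def])
    show "half_line * (P * N) = P * N"
      by (simp add: PP flip: P_def mult.assoc)
    show "P * N * half_line = P * N"
      by (simp add: PN PP mult.assoc flip: P_def)
  qed
qed

section \<open>Convolution and evaluation\<close>

text \<open>At \<open>z = 0\<close> only the term \<open>f 0\<close> survives, as
  \<open>0 powi n = 0\<close> for all other \<open>n\<close>; for causal \<open>f\<close> this is
  the value of the power series.\<close>

definition symbol :: "(int \<Rightarrow> 'a::{complex_normed_vector, banach}) \<Rightarrow> complex \<Rightarrow> 'a"
  where "symbol f z = (\<Sum>\<^sub>\<infinity>n. z powi n *\<^sub>C f n)"

lemma geometric_column: "geometric (\<lambda>n. entry a n j)"
proof -
  obtain r M where *: "0 < r" "r < 1" "\<And>i j. norm (entry a i j) \<le> M * r ^ nat \<bar>i - j\<bar>"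
    using decaying_entry[of a] unfolding decaying_def by blast
  have M: "0 \<le> M" using order_trans[OF norm_ge_zero *(3)[of 0 0]] by simp
  show ?thesis
  proof (rule geometricI[OF *(1,2), of _ "M / r ^ nat \<bar>j\<bar>"])
    fix n
    have "r ^ (nat \<bar>n - j\<bar> + nat \<bar>j\<bar>) \<le> r ^ nat \<bar>n\<bar>"
      using * by (intro power_decreasing) auto
    then have "M * r ^ nat \<bar>n - j\<bar> \<le> M / r ^ nat \<bar>j\<bar> * r ^ nat \<bar>n\<bar>"
      using * M by (simp add: field_simps power_add mult_left_mono)
    then show "norm (entry a n j) \<le> M / r ^ nat \<bar>j\<bar> * r ^ nat \<bar>n\<bar>"
      by (rule order_trans[OF *(3)])
  qed
qed

text \<open>The index is reversed because entry \<open>(0, j)\<close> of a Toeplitz matrix is its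
  coefficient with index \<open>- j\<close>.\<close>

lemma geometric_row: "geometric (\<lambda>n. entry a 0 (- n))"
proof -
  obtain r M where *: "0 < r" "r < 1" "\<And>i j. norm (entry a i j) \<le> M * r ^ nat \<bar>i - j\<bar>"
    using decaying_entry[of a] unfolding decaying_def by blast
  show ?thesis
    using *(1,2) by (rule geometricI) (use *(3)[of 0 "- _"] in simp)
qed

lemma geometric_reverse: "geometric f \<Longrightarrow> geometric (\<lambda>n. f (- n))"
  unfolding geometric_def by (metis abs_minus_cancel)

lemma geometric_compose: "geometric f \<Longrightarrow> geometric (\<lambda>n. S o\<^sub>B f n)"
proof -
  assume "geometric f"
  then obtain r M where *: "0 < r" "r < 1" "\<And>n. norm (f n) \<le> M * r ^ nat \<bar>n\<bar>"
    unfolding geometric_def by blast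
  show ?thesis
  proof (rule geometricI[OF *(1,2), of _ "norm S * M"])
    show "norm (S o\<^sub>B f n) \<le> norm S * M * r ^ nat \<bar>n\<bar>" for n
      using order_trans[OF norm_cblinfun_compose mult_left_mono[OF *(3) norm_ge_zero[of S]]]
      by (simp add: mult.assoc)
  qed
qed

lemma toeplitz_mult_has_sum:
  assumes "geometric a" "geometric b"
  shows "((\<lambda>l. a (n - l) o\<^sub>B b l) has_sum entry (toeplitz a * toeplitz b) n 0) UNIV"
  using entry_mult_has_sum[of "toeplitz a" n "toeplitz b" 0] by (simp add: entry_toeplitz assms)

text \<open>Translating the summation index shows that the product depends on \<open>i - j\<close>
  alone, so column 0 determines it and also provides the decay of \<open>c\<close>.\<close>

lemma toeplitz_mult:
  assumes "geometric a" "geometric b" "\<And>n. c n = entry (toeplitz a * toeplitz b) n 0"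
  shows "toeplitz a * toeplitz b = toeplitz c" and "geometric c"
proof -
  have c: "c = (\<lambda>n. entry (toeplitz a * toeplitz b) n 0)"
    using assms(3) by auto
  show gc: "geometric c"
    unfolding c by (rule geometric_column)
  show "toeplitz a * toeplitz b = toeplitz c"
  proof (rule opmat_eqI)
    fix i j
    have "((\<lambda>l. a (i - l) o\<^sub>B b (l - j)) has_sum c (i - j)) UNIV \<longleftrightarrow>
        ((\<lambda>l. a (i - j - l) o\<^sub>B b l) has_sum c (i - j)) UNIV"
      by (rule has_sum_reindex_bij_witness[where i = "\<lambda>l. l + j" and j = "\<lambda>l. l - j"])
        (auto simp: algebra_simps)
    then have "((\<lambda>l. a (i - l) o\<^sub>B b (l - j)) has_sum c (i - j)) UNIV"
      using toeplitz_mult_has_sum[OF assms(1,2)] assms(3) by simp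
    moreover have "((\<lambda>l. a (i - l) o\<^sub>B b (l - j)) has_sum entry (toeplitz a * toeplitz b) i j) UNIV"
      using entry_mult_has_sum[of "toeplitz a" i "toeplitz b" j] by (simp add: entry_toeplitz assms)
    ultimately show "entry (toeplitz a * toeplitz b) i j = entry (toeplitz c) i j"
      by (simp add: entry_toeplitz gc) (metis has_sum_unique)
  qed
qed

text \<open>The Cauchy product. The power law is demanded only where the coefficients do not vanish:
  at \<open>z = 0\<close> it fails for exponents of opposite sign, and causal sequences never meet
  that case.\<close>

lemma symbol_convolution:
  fixes a b c :: "int \<Rightarrow> 'u::complex_hilbert \<Rightarrow>\<^sub>B 'u"
  assumes c: "\<And>n. ((\<lambda>l. a (n - l) o\<^sub>B b l) has_sum c n) UNIV"
    and a: "(\<lambda>n. norm (z powi n *\<^sub>C a n)) summable_on UNIV"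
    and b: "(\<lambda>n. norm (z powi n *\<^sub>C b n)) summable_on UNIV"
    and z: "\<And>m n. a m \<noteq> 0 \<Longrightarrow> b n \<noteq> 0 \<Longrightarrow> z powi (m + n) = z powi m * z powi n"
  shows "symbol c z = symbol a z o\<^sub>B symbol b z"
proof -
  let ?a = "\<lambda>n. z powi n *\<^sub>C a n" and ?b = "\<lambda>n. z powi n *\<^sub>C b n"
  have a': "(?a has_sum symbol a z) UNIV" and b': "(?b has_sum symbol b z) UNIV"
    using a b by (auto simp: symbol_def intro!: has_sum_infsum abs_summable_summable)
  have split: "z powi n *\<^sub>C (a (n - l) o\<^sub>B b l) = ?a (n - l) o\<^sub>B ?b l" for n l
  proof (cases "a (n - l) = 0 \<or> b l = 0")
    case True
    then show ?thesis
      by (auto simp: compose.zero_left compose.zero_right scaleC.zero_right)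
  next
    case False
    then have "z powi n = z powi (n - l) * z powi l"
      using z[of "n - l" l] by simp
    then show ?thesis
      by (simp add: compose_simps scaleC_scaleC mult.commute)
  qed
  have shift_sum: "((\<lambda>n. g (n - l)) has_sum s) UNIV \<longleftrightarrow> (g has_sum s) UNIV"
    for g :: "int \<Rightarrow> 'b::{comm_monoid_add, topological_space}" and s l
    by (rule has_sum_reindex_bij_witness[where i = "\<lambda>n. n + l" and j = "\<lambda>n. n - l"]) auto
  have "(\<lambda>p. norm (case p of (l, n) \<Rightarrow> ?a (n - l) o\<^sub>B ?b l)) summable_on UNIV \<times> UNIV"
  proof (rule Infinite_Sum.abs_summable_on_comparison_test')
    show "(\<lambda>(l, n). norm (?a (n - l)) * norm (?b l)) summable_on UNIV \<times> UNIV"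
    proof (rule summable_on_SigmaI)
      show "((\<lambda>n. case (l, n) of (l, n) \<Rightarrow> norm (?a (n - l)) * norm (?b l)) has_sum
          (\<Sum>\<^sub>\<infinity>n. norm (?a n)) * norm (?b l)) UNIV" for l
        unfolding case_prod_conv
        by (intro has_sum_cmult_left shift_sum[THEN iffD2] has_sum_infsum a)
      show "(\<lambda>l. (\<Sum>\<^sub>\<infinity>n. norm (?a n)) * norm (?b l)) summable_on UNIV"
        by (intro summable_on_cmult_right b)
    qed auto
  qed (auto simp: norm_cblinfun_compose)
  then have sm: "(\<lambda>(l, n). ?a (n - l) o\<^sub>B ?b l) summable_on UNIV \<times> UNIV"
    by (rule abs_summable_summable)
  have "symbol c z = (\<Sum>\<^sub>\<infinity>n. \<Sum>\<^sub>\<infinity>l. ?a (n - l) o\<^sub>B ?b l)"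
    unfolding symbol_def split[symmetric]
    by (intro infsum_cong infsumI[symmetric] has_sum_bounded_linear[OF scaleC.bounded_linear_right] c)
  also have "\<dots> = (\<Sum>\<^sub>\<infinity>l. \<Sum>\<^sub>\<infinity>n. ?a (n - l) o\<^sub>B ?b l)"
    by (rule infsum_swap_banach[OF sm, symmetric])
  also have "\<dots> = (\<Sum>\<^sub>\<infinity>l. symbol a z o\<^sub>B ?b l)"
    by (intro infsum_cong infsumI has_sum_bounded_linear[OF compose.bounded_linear_left]
        shift_sum[THEN iffD2] a')
  also have "\<dots> = symbol a z o\<^sub>B symbol b z"
    by (intro infsumI has_sum_bounded_linear[OF compose.bounded_linear_right] b')
  finally show ?thesis .
qed

lemma geometric_summable_circle:
  fixes a :: "int \<Rightarrow> 'a::complex_normed_vector"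
  assumes "geometric a" "z \<in> \<T>"
  shows "(\<lambda>n. norm (z powi n *\<^sub>C a n)) summable_on UNIV"
proof -
  have "norm (z powi n *\<^sub>C a n) = norm (a n)" for n
    using assms(2) by (simp add: norm_scaleC norm_power_int)
  then show ?thesis
    using geometric_abs_summable[OF assms(1)] by simp
qed

lemma symbol_mult_circle:
  fixes a b c :: "int \<Rightarrow> 'u::complex_hilbert \<Rightarrow>\<^sub>B 'u"
  assumes "geometric a" "geometric b" "toeplitz a * toeplitz b = toeplitz c" "geometric c" "z \<in> \<T>"
  shows "symbol c z = symbol a z o\<^sub>B symbol b z"
proof (rule symbol_convolution)
  show "((\<lambda>l. a (n - l) o\<^sub>B b l) has_sum c n) UNIV" for n
    using toeplitz_mult_has_sum[OF assms(1,2), of n] by (simp add: assms entry_toeplitz)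
  have "z \<noteq> 0" using assms(5) by auto
  then show "z powi (m + n) = z powi m * z powi n" for m n
    by (simp add: power_int_add)
qed (use assms in \<open>auto intro!: geometric_summable_circle\<close>)

definition causal :: "(int \<Rightarrow> 'a::zero) \<Rightarrow> bool" where "causal a \<longleftrightarrow> (\<forall>n<0. a n = 0)"

lemma causal_summable:
  fixes a :: "int \<Rightarrow> 'a::complex_normed_vector"
  assumes "causal a" "0 < r" "\<And>n. norm (a n) \<le> M * r ^ nat \<bar>n\<bar>" "cmod z * r < 1"
  shows "(\<lambda>n. norm (z powi n *\<^sub>C a n)) summable_on UNIV"
proof (rule Infinite_Sum.abs_summable_on_comparison_test')
  show "(\<lambda>n::int. M * (cmod z * r) ^ nat \<bar>n\<bar>) summable_on UNIV"
    using assms by (intro summable_on_cmult_right summable_on_int_geometric) auto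
  have M: "0 \<le> M" using order_trans[OF norm_ge_zero assms(3)[of 0]] by simp
  show "norm (z powi n *\<^sub>C a n) \<le> M * (cmod z * r) ^ nat \<bar>n\<bar>" for n
  proof (cases "n < 0")
    case True
    then show ?thesis
      using assms(1,2) M by (simp add: causal_def scaleC.zero_right)
  next
    case False
    then have "norm (z powi n *\<^sub>C a n) \<le> cmod z ^ nat \<bar>n\<bar> * (M * r ^ nat \<bar>n\<bar>)"
      using assms(3)[of n] by (simp add: norm_scaleC norm_power power_int_def mult_left_mono)
    then show ?thesis
      by (simp add: power_mult_distrib mult_ac)
  qed
qed

lemma symbol_mult_causal:
  fixes a b c :: "int \<Rightarrow> 'u::complex_hilbert \<Rightarrow>\<^sub>B 'u"
  assumes c: "\<And>n. ((\<lambda>l. a (n - l) o\<^sub>B b l) has_sum c n) UNIV"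
    and "causal a" "causal b" "0 < r" "cmod z * r < 1"
    and "\<And>n. norm (a n) \<le> M * r ^ nat \<bar>n\<bar>" "\<And>n. norm (b n) \<le> N * r ^ nat \<bar>n\<bar>"
  shows "symbol c z = symbol a z o\<^sub>B symbol b z"
proof (rule symbol_convolution[OF c])
  fix m n assume "a m \<noteq> 0" "b n \<noteq> 0"
  then have "0 \<le> m" "0 \<le> n"
    using assms(2,3) by (auto simp: causal_def not_less[symmetric])
  then show "z powi (m + n) = z powi m * z powi n"
    by (simp add: power_int_def nat_add_distrib power_add)
qed (use causal_summable assms in blast)+

lemma symbol_delta: "symbol (\<lambda>n. if n = 0 then x else 0) z = x"
proof -
  have "symbol (\<lambda>n. if n = 0 then x else 0) z = (\<Sum>\<^sub>\<infinity>n::int. if n = 0 then x else 0)"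
    unfolding symbol_def by (intro infsum_cong) (auto simp: scaleC_one scaleC.zero_right)
  then show ?thesis by (simp add: infsum_single)
qed

lemma symbol_reverse: "symbol (\<lambda>n. f (- n)) z = symbol f (1 / z)"
  unfolding symbol_def
  by (rule infsum_reindex_bij_witness[where i = uminus and j = uminus])
    (auto simp: power_int_minus power_int_divide_distrib inverse_eq_divide)

section \<open>Factorization of the coefficient sequence\<close>

text \<open>The inverse of the corner entry is the Schur complement formed with the inverse of the matrix
  obtained by deleting row and column 0; by shift invariance that inverse is a shifted copy of \<open>R\<close>.\<close>

lemma corner_invertible:
  fixes L R :: "'u::complex_hilbert opmat"
  assumes L: "shift L = L"
    and R: "half_line * R = R" "R * half_line = R"
    and RL: "half_line * L * R = half_line" "R * L * half_line = half_line"
  obtains S where "is_inverse (entry R 0 0) S"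
proof -
  define p :: "'u opmat" where "p = half_line"
  define p' :: "'u opmat" where "p' = proj {1..}"
  define e :: "'u opmat" where "e = proj {0}"
  define R' where "R' = shift R"
  have "shift p = p'"
    by (rule opmat_eqI) (auto simp: shift.rep_eq p_def p'_def half_line_def proj.rep_eq)
  then have R'1: "p' * R' = R'" "R' * p' = R'" "p' * L * R' = p'" "R' * L * p' = p'"
    using arg_cong[OF R(1), of shift] arg_cong[OF R(2), of shift]
      arg_cong[OF RL(1), of shift] arg_cong[OF RL(2), of shift]
    by (simp_all add: shift_mult L R'_def p_def)
  have pe: "p = e + p'"
    by (rule opmat_eqI) (auto simp: p_def p'_def e_def half_line_def proj.rep_eq entry_simps)
  have idem: "e * e = e" "p' * e = 0" "e * p' = 0" "p' * p = p'" "p * p' = p'" "e * p = e" "p * e = e"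
    by (auto simp: e_def p_def p'_def half_line_def proj_mult)
      (auto simp: opmat_eqI proj.rep_eq entry_simps)
  \<comment> \<open>The Schur complement \<open>L00 - L01 R' L10\<close> for the splitting
    \<open>p = e + p'\<close>, with \<open>R'\<close> as the inverse of the block
    \<open>L11\<close>.\<close>
  define S where "S = e * L * e - e * L * R' * L * e"
  have R1: "p * R = R" "R * p = R" "p * L * R = p" "R * L * p = p"
    using R RL by (simp_all add: p_def)
  \<comment> \<open>Below the corner, column 0 of \<open>L R\<close> vanishes; multiplying by
    \<open>R'\<close> solves this for the lower block of \<open>R\<close>.\<close>
  have A: "p' * R * e = - (R' * L * e * R * e)"
  proof -
    have "p' * L * R = p' * (p * L * R)" by (simp add: idem flip: mult.assoc)
    then have 0: "p' * L * R * e = 0" by (simp only: R1 idem)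
    have "0 = R' * (p' * L * R * e)" by (simp only: 0 mult_zero_right)
    also have "\<dots> = (R' * p') * L * (p * R) * e" by (simp only: R1 mult.assoc)
    also have "\<dots> = R' * L * e * R * e + (R' * L * p') * R * e"
      by (simp only: R'1 pe distrib_left distrib_right mult.assoc)
    finally show ?thesis by (simp add: R'1 eq_neg_iff_add_eq_0 add.commute)
  qed
  have B: "e * L * e * R * e + e * L * (p' * R * e) = e"
  proof -
    have "e * L * e * R * e + e * L * (p' * R * e) = e * L * (p * R) * e"
      by (simp only: pe distrib_left distrib_right mult.assoc)
    also have "\<dots> = (e * p) * L * R * e"
      by (simp only: R1 idem)
    also have "\<dots> = e * (p * L * R) * e"
      by (simp only: mult.assoc)
    finally show ?thesis by (simp only: R1 idem)
  qed
  have "S * (e * R * e) = e * L * (e * e) * R * e - e * L * (R' * L * (e * e) * R * e)"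
    by (simp only: S_def left_diff_distrib mult.assoc)
  also have "\<dots> = e * L * e * R * e + e * L * (p' * R * e)"
    by (simp only: A idem mult_minus_right diff_conv_add_uminus)
  finally have SR: "S * (e * R * e) = e"
    by (simp only: B)
  \<comment> \<open>The mirror image, from row 0 of \<open>R L\<close>; it leads to the other side
    of the inverse.\<close>
  have C: "e * R * p' = - (e * R * e * L * R')"
  proof -
    have "e * R * L * p' = e * R * L * (p * p')" by (simp only: idem)
    also have "\<dots> = e * ((R * L * p) * p')" by (simp only: mult.assoc)
    finally have 0: "e * R * L * p' = 0" by (simp only: R1 idem)
    have "0 = e * R * L * p' * R'" by (simp only: 0 mult_zero_left)
    also have "\<dots> = e * (R * p) * L * R'" by (simp only: R1 R'1 mult.assoc)
    also have "\<dots> = e * R * e * L * R' + e * R * (p' * L * R')"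
      by (simp only: pe distrib_left distrib_right mult.assoc)
    finally show ?thesis by (simp add: R'1 eq_neg_iff_add_eq_0 add.commute)
  qed
  have D: "e * R * e * L * e + (e * R * p') * L * e = e"
  proof -
    have "e * R * e * L * e + (e * R * p') * L * e = e * (R * p) * L * e"
      by (simp only: pe distrib_left distrib_right mult.assoc)
    also have "\<dots> = e * R * L * (p * e)"
      by (simp only: R1 idem)
    also have "\<dots> = e * (R * L * p) * e"
      by (simp only: mult.assoc)
    finally show ?thesis by (simp only: R1 idem)
  qed
  have "(e * R * e) * S = e * R * (e * e) * L * e - (e * R * (e * e) * L * R') * L * e"
    by (simp only: S_def right_diff_distrib mult.assoc)
  also have "\<dots> = e * R * e * L * e + (e * R * p') * L * e"
    by (simp only: C idem mult_minus_left diff_conv_add_uminus)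
  finally have RS: "(e * R * e) * S = e"
    by (simp only: D)
  \<comment> \<open>A product passing through \<open>e\<close> involves only the index 0, so a
    matrix identity becomes a composition of operators.\<close>
  have corner: "entry (a * (e * b)) 0 0 = entry a 0 0 o\<^sub>B entry b 0 0" for a b :: "'u opmat"
  proof -
    have "entry (a * (e * b)) 0 0 = (\<Sum>\<^sub>\<infinity>l. if l = 0 then entry a 0 l o\<^sub>B entry b l 0 else 0)"
      by (rule infsumI[OF entry_mult_has_sum, symmetric, THEN trans])
        (auto simp: e_def entry_proj_mult compose.zero_right intro!: infsum_cong)
    then show ?thesis by (simp only: infsum_single)
  qed
  have "entry (e * R * e) 0 0 = entry R 0 0"
    by (simp add: e_def entry_mult_proj entry_proj_mult)
  moreover have "S * (e * (e * R * e)) = e" "(e * R * e) * (e * S) = e"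
    using SR RS by (simp_all add: idem flip: mult.assoc) (simp_all add: idem mult.assoc)
  moreover have "entry e 0 0 = (id_cblinfun :: 'u \<Rightarrow>\<^sub>B 'u)"
    by (simp add: e_def proj.rep_eq)
  ultimately have "is_inverse (entry R 0 0) (entry S 0 0)"
    unfolding is_inverse_def using corner by metis
  then show thesis by (rule that)
qed

text \<open>With \<open>P\<close> for \<open>half_line\<close>, the relation
  \<open>P L R = P\<close> says that column 0 of \<open>L R\<close> is the unit column at
  nonnegative indices, which yields the support of \<open>V\<close> and \<open>V 0 = I\<close>;
  \<open>R L P = P\<close> does the same for \<open>Q\<close>. The link between the two products is
  \<open>(Y L) X = Y (L X)\<close> for bi-infinite matrices.\<close>

lemma factor_coefficients:
  fixes f :: "int \<Rightarrow> 'u::complex_hilbert \<Rightarrow>\<^sub>B 'u"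
  assumes f: "geometric f" and q: "q < 1" and bound: "\<And>z. z \<in> \<T> \<Longrightarrow> norm (symbol f z) \<le> q"
  obtains X V Y Q and T S :: "'u \<Rightarrow>\<^sub>B 'u"
  where "geometric X" "geometric V" "geometric Y" "geometric Q"
    "causal X" "causal Q" "causal (\<lambda>n. V (- n))" "causal (\<lambda>n. Y (- n))"
    "is_inverse T S" "X 0 = T" "Y 0 = T" "V 0 = id_cblinfun" "Q 0 = id_cblinfun"
    "(1 - toeplitz f) * toeplitz X = toeplitz V"
    "\<And>n. ((\<lambda>l. Q (n - l) o\<^sub>B X l) has_sum (if n = 0 then T else 0)) UNIV"
    "\<And>n. ((\<lambda>l. Y (n - l) o\<^sub>B V l) has_sum (if n = 0 then T else 0)) UNIV"
proof -
  obtain R where R: "half_line * R = R" "R * half_line = R"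
    "half_line * (1 - toeplitz f) * R = half_line" "R * (1 - toeplitz f) * half_line = half_line"
    using toeplitz_half_line_inverse[OF f q] bound unfolding symbol_def by blast
  define g where "g n = (if n = 0 then id_cblinfun else 0) - f n" for n
  define L where "L = 1 - toeplitz f"
  have Lg: "entry L i j = g (i - j)" for i j
    by (simp add: L_def g_def entry_simps entry_toeplitz[OF f])
  have gg: "geometric g"
    using geometric_column[of L 0] by (simp add: Lg)
  have L: "L = toeplitz g"
    by (rule opmat_eqI) (simp add: Lg entry_toeplitz[OF gg])
  define X where "X n = entry R n 0" for n
  define Y where "Y n = entry R 0 (- n)" for n
  define V where "V n = entry (L * R) n 0" for n
  define Q where "Q n = entry (R * L) 0 (- n)" for n
  define T where "T = entry R 0 0"
  have geo: "geometric X" "geometric Y" "geometric V" "geometric Q"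
    unfolding X_def Y_def V_def Q_def by (rule geometric_column geometric_row)+
  have R_neg: "i < 0 \<or> j < 0 \<Longrightarrow> entry R i j = 0" for i j
    using arg_cong[OF R(1), of "\<lambda>a. entry a i j"] arg_cong[OF R(2), of "\<lambda>a. entry a i j"]
    by (auto simp: half_line_def entry_proj_mult entry_mult_proj split: if_splits)
  have V: "V n = (if n = 0 then id_cblinfun else 0)" if "n \<ge> 0" for n
    using arg_cong[OF R(3), of "\<lambda>a. entry a n 0"] that
    by (simp add: half_line_def V_def L_def mult.assoc entry_proj_mult proj.rep_eq)
  have Q: "Q n = (if n = 0 then id_cblinfun else 0)" if "n \<le> 0" for n
    using arg_cong[OF R(4), of "\<lambda>a. entry a 0 (- n)"] that
    by (simp add: half_line_def Q_def L_def entry_mult_proj proj.rep_eq)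
  have LX: "L * toeplitz X = toeplitz V"
    unfolding L
  proof (rule toeplitz_mult[OF gg geo(1)])
    show "V n = entry (toeplitz g * toeplitz X) n 0" for n
      unfolding V_def L times_opmat.rep_eq by (simp add: entry_toeplitz geo X_def)
  qed
  have YL: "toeplitz Y * L = toeplitz Q"
  proof -
    \<comment> \<open>\<open>Q\<close> is read off row 0, whereas \<open>toeplitz_mult\<close> reads
      column 0; both give the coefficients of the same Toeplitz matrix.\<close>
    define Q' where "Q' n = entry (toeplitz Y * toeplitz g) n 0" for n
    have *: "toeplitz Y * toeplitz g = toeplitz Q'" "geometric Q'"
      by (rule toeplitz_mult[OF geo(2) gg], simp add: Q'_def)+
    have "Q n = entry (toeplitz Y * toeplitz g) 0 (- n)" for n
      unfolding Q_def L times_opmat.rep_eq by (simp add: entry_toeplitz geo Y_def)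
    then have "Q = Q'"
      by (auto simp: * entry_toeplitz)
    then show ?thesis using * by (simp add: L)
  qed
  have single: "(h has_sum s) UNIV \<Longrightarrow> (\<And>l. l \<noteq> k \<Longrightarrow> h l = 0) \<Longrightarrow> s = h k"
    for h :: "int \<Rightarrow> 'u \<Rightarrow>\<^sub>B 'u" and s k
    using has_sum_unique[OF _ has_sum_finite_neutralI[of "{k}" UNIV h "h k"]] by auto
  define W where "W n = entry (toeplitz Q * toeplitz X) n 0" for n
  have W1: "((\<lambda>l. Q (n - l) o\<^sub>B X l) has_sum W n) UNIV" for n
    unfolding W_def by (rule toeplitz_mult_has_sum[OF geo(4,1)])
  have "toeplitz Q * toeplitz X = toeplitz Y * toeplitz V"
    unfolding LX[symmetric] YL[symmetric] by (rule mult.assoc)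
  then have W2: "((\<lambda>l. Y (n - l) o\<^sub>B V l) has_sum W n) UNIV" for n
    unfolding W_def using toeplitz_mult_has_sum[OF geo(2,3)] by simp
  \<comment> \<open>For \<open>n \<le> 0\<close> causality of \<open>Q\<close> and \<open>X\<close>
    leaves only the term \<open>l = 0\<close>; for \<open>n > 0\<close> the opposite supports of
    \<open>Y\<close> and \<open>V\<close> do so in the other product, where moreover
    \<open>Y n = 0\<close>.\<close>
  have W: "W n = (if n = 0 then T else 0)" for n
  proof (cases "n \<le> 0")
    case True
    have "W n = Q n o\<^sub>B X 0"
      by (rule single[OF W1[of n], of 0, simplified])
        (use True in \<open>auto simp: X_def R_neg Q compose_simps linorder_neq_iff\<close>)
    then show ?thesis using Q[OF True] by (simp add: compose_simps X_def T_def)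
  next
    case False
    have "W n = Y n o\<^sub>B V 0"
      by (rule single[OF W2[of n], of 0, simplified])
        (use False in \<open>auto simp: Y_def R_neg V compose_simps linorder_neq_iff\<close>)
    then show ?thesis using False by (simp add: compose_simps Y_def R_neg)
  qed
  obtain S where "is_inverse T S"
    using corner_invertible[of L R] R shift_toeplitz[OF gg] by (auto simp: L_def[symmetric] L T_def)
  moreover have "causal X" "causal Q" "causal (\<lambda>n. V (- n))" "causal (\<lambda>n. Y (- n))"
    by (auto simp: causal_def X_def Y_def R_neg Q V)
  ultimately show thesis
    using that[of X V Y Q T S] geo LX W1 W2 Q[of 0] V[of 0]
    by (simp add: W L_def) (simp add: X_def Y_def T_def)
qed

section \<open>Analyticity of the factors\<close>

lemma causal_symbol_sums:
  fixes a :: "int \<Rightarrow> 'a::{complex_normed_vector, banach}"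
  assumes "causal a" "0 < r" "\<And>n. norm (a n) \<le> M * r ^ nat \<bar>n\<bar>" "cmod z * r < 1"
  shows "(\<lambda>k. z ^ k *\<^sub>C a (int k)) sums symbol a z"
proof -
  have "((\<lambda>n. z powi n *\<^sub>C a n) has_sum symbol a z) UNIV"
    unfolding symbol_def by (rule has_sum_infsum[OF abs_summable_summable[OF causal_summable[OF assms]]])
  also have "?this \<longleftrightarrow> ((\<lambda>n. z powi n *\<^sub>C a n) has_sum symbol a z) (range int)"
  proof (rule has_sum_cong_neutral)
    fix n :: int assume "n \<in> UNIV - range int"
    then have "n < 0" by (metis DiffD2 not_less rangeI zero_le_imp_eq_int)
    then show "z powi n *\<^sub>C a n = 0"
      using assms(1) by (simp add: causal_def scaleC.zero_right)
  qed auto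
  also have "\<dots> \<longleftrightarrow> ((\<lambda>k. z ^ k *\<^sub>C a (int k)) has_sum symbol a z) UNIV"
    by (subst has_sum_reindex) (auto simp: o_def)
  finally show ?thesis
    by (rule has_sum_imp_sums)
qed

text \<open>Termwise differentiation of a vector-valued power series inside its disc of convergence;
  the differentiated geometric series is the Weierstrass majorant.\<close>

lemma causal_symbol_differentiable:
  fixes a :: "int \<Rightarrow> 'a::{complex_normed_vector, banach}"
  assumes a: "causal a" "0 < r" "\<And>n. norm (a n) \<le> M * r ^ nat \<bar>n\<bar>" and z: "cmod z * r < 1"
  shows "\<exists>f'. has_complex_derivative (symbol a) f' z"
proof -
  have M: "0 \<le> M" using order_trans[OF norm_ge_zero a(3)[of 0]] by simp
  \<comment> \<open>A radius strictly between \<open>cmod z\<close> and \<open>1 / r\<close>: the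
    ball contains \<open>z\<close>, and the majorant converges uniformly on it.\<close>
  obtain \<rho> where \<rho>: "cmod z < \<rho>" "\<rho> < 1 / r"
    using dense[of "cmod z" "1 / r"] z a(2) by (auto simp: field_simps)
  then have \<rho>r: "\<rho> * r < 1" "0 \<le> \<rho>"
    using a(2) by (auto simp: field_simps intro: order_trans[OF norm_ge_zero less_imp_le])
  define S where "S = ball (0::complex) \<rho>"
  have S: "cmod x < \<rho>" "cmod x * r < 1" if "x \<in> S" for x
  proof -
    show x: "cmod x < \<rho>" using that by (simp add: S_def)
    have "cmod x * r \<le> \<rho> * r"
      using x a(2) by (intro mult_right_mono) auto
    then show "cmod x * r < 1" using \<rho>r(1) by linarith
  qed
  define b where "b k = a (int k)" for k
  have b: "norm (b k) \<le> M * r ^ k" for k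
    using a(3)[of "int k"] by (simp add: b_def)
  define d where "d k x = (of_nat k * x ^ (k - 1)) *\<^sub>C b k" for k x
  define D where "D x = (\<Sum>k. d k x)" for x
  define m where "m k = real k * \<rho> ^ (k - 1) * (M * r ^ k)" for k
  have "summable (\<lambda>k. m (Suc k))"
  proof -
    have "(\<lambda>k. M * r * (of_nat (Suc k) * (\<rho> * r) ^ k)) sums (M * r * (1 / (1 - \<rho> * r)\<^sup>2))"
      using \<rho>r a(2) by (intro sums_mult geometric_deriv_sums) auto
    then show ?thesis
      by (auto simp: m_def power_mult_distrib mult_ac sums_iff)
  qed
  then have sm: "summable m"
    by (simp add: summable_Suc_iff)
  have d_bound: "norm (d k x) \<le> m k" if "x \<in> S" for k x
    unfolding d_def m_def norm_scaleC norm_mult norm_power norm_of_nat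
    using S(1)[OF that] M a(2) \<rho>r(2) by (intro mult_mono power_mono b) auto
  have unif: "uniform_limit S (\<lambda>n x. \<Sum>k<n. d k x) D sequentially"
    unfolding D_def by (rule Weierstrass_m_test[OF d_bound sm])
  have "\<exists>g. \<forall>x\<in>S. (\<lambda>k. x ^ k *\<^sub>C b k) sums (g x) \<and>
      (g has_derivative (\<lambda>h. h *\<^sub>C D x)) (at x within S)"
  proof (rule has_derivative_series[where f' = "\<lambda>k x h. h *\<^sub>C d k x" and x = 0 and l = "symbol a 0"])
    show "convex S" by (simp add: S_def)
    fix k x assume "x \<in> S"
    have "((\<lambda>x. x ^ k) has_derivative (\<lambda>h. h * (of_nat k * x ^ (k - 1)))) (at x within S)"
      by (auto intro!: derivative_eq_intros simp: mult_ac)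
    from bounded_linear.has_derivative[OF scaleC.bounded_linear_left this, of "b k"]
    show "((\<lambda>x. x ^ k *\<^sub>C b k) has_derivative (\<lambda>h. h *\<^sub>C d k x)) (at x within S)"
      by (simp add: d_def scaleC_scaleC)
  next
    fix e :: real assume "e > 0"
    then have "\<forall>\<^sub>F n in sequentially. \<forall>x\<in>S. dist (\<Sum>k<n. d k x) (D x) < e"
      using unif by (simp add: uniform_limit_iff)
    then show "\<forall>\<^sub>F n in sequentially. \<forall>x\<in>S. \<forall>h::complex. norm ((\<Sum>k<n. h *\<^sub>C d k x) - h *\<^sub>C D x) \<le> e * norm h"
    proof eventually_elim
      case (elim n)
      show ?case
      proof (intro ballI allI)
        fix x h :: complex assume "x \<in> S"
        with elim have "norm h * norm ((\<Sum>k<n. d k x) - D x) \<le> norm h * e"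
          by (intro mult_left_mono) (auto simp: dist_norm)
        moreover have "(\<Sum>k<n. h *\<^sub>C d k x) - h *\<^sub>C D x = h *\<^sub>C ((\<Sum>k<n. d k x) - D x)"
          by (simp add: scaleC.sum_right scaleC.diff_right)
        ultimately show "norm ((\<Sum>k<n. h *\<^sub>C d k x) - h *\<^sub>C D x) \<le> e * norm h"
          by (simp add: norm_scaleC mult.commute)
      qed
    qed
  next
    have "cmod z \<ge> 0" by simp
    then show "0 \<in> S" using \<rho>(1) by (simp add: S_def del: norm_ge_zero)
    show "(\<lambda>k. 0 ^ k *\<^sub>C b k) sums symbol a 0"
      unfolding b_def by (rule causal_symbol_sums[OF a]) simp
  qed
  then obtain g where "\<forall>x\<in>S. (\<lambda>k. x ^ k *\<^sub>C b k) sums (g x) \<and>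
      (g has_derivative (\<lambda>h. h *\<^sub>C D x)) (at x within S)" ..
  then have g: "(\<lambda>k. x ^ k *\<^sub>C b k) sums (g x)"
    "(g has_derivative (\<lambda>h. h *\<^sub>C D x)) (at x within S)" if "x \<in> S" for x
    using that by simp_all
  have zS: "z \<in> S" "open S" using \<rho> by (auto simp: S_def)
  have eq: "g x = symbol a x" if "x \<in> S" for x
    using sums_unique2[OF g(1)[OF that] causal_symbol_sums[OF a S(2)[OF that], folded b_def]] .
  have "(g has_derivative (\<lambda>h. h *\<^sub>C D z)) (at z)"
    using g(2)[OF zS(1)] by (simp add: at_within_open[OF zS])
  then have "(symbol a has_derivative (\<lambda>h. h *\<^sub>C D z)) (at z)"
    by (rule has_derivative_transform_within_open[OF _ zS(2,1) eq])
  then show ?thesis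
    by (auto simp: has_complex_derivative_iff)
qed

lemma idempotent_norm:
  assumes "E o\<^sub>B E = E" "norm E < 1"
  shows "E = 0"
proof (rule ccontr)
  assume "E \<noteq> 0"
  then have "norm E * norm E < 1 * norm E"
    using assms(2) by (intro mult_strict_right_mono) auto
  then show False
    using norm_cblinfun_compose[of E E] assms(1) by simp
qed

text \<open>The defect \<open>I - f z o g z\<close> is a continuous family of idempotents, and a nonzero idempotent has
  norm at least \<open>1\<close>.\<close>

lemma left_inverse_two_sided:
  fixes f g :: "complex \<Rightarrow> 'u::complex_hilbert \<Rightarrow>\<^sub>B 'u"
  assumes "connected S" "continuous_on S f" "continuous_on S g"
    and left: "\<And>z. z \<in> S \<Longrightarrow> g z o\<^sub>B f z = id_cblinfun"
    and w: "w \<in> S" "f w o\<^sub>B g w = id_cblinfun" and z: "z \<in> S"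
  shows "is_inverse (f z) (g z)"
proof -
  define E where "E z = id_cblinfun - f z o\<^sub>B g z" for z
  have idem: "E x o\<^sub>B E x = E x" if "x \<in> S" for x
  proof -
    have "f x o\<^sub>B (g x o\<^sub>B (f x o\<^sub>B g x)) = f x o\<^sub>B g x"
      using left[OF that] by (metis cblinfun_compose_assoc cblinfun_compose_id_left)
    then show ?thesis
      by (simp add: E_def compose_simps)
  qed
  have "connected ((\<lambda>x. norm (E x)) ` S)"
    unfolding E_def using assms(1-3)
    by (intro connected_continuous_image continuous_intros compose.continuous_on)
  moreover have "0 \<in> (\<lambda>x. norm (E x)) ` S"
    using w by (force simp: E_def)
  moreover have "E x = 0 \<or> 1 \<le> norm (E x)" if "x \<in> S" for x
    using idempotent_norm[OF idem[OF that]] by force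
  \<comment> \<open>The norms form an interval that contains 0 and avoids 1/2, so they stay below
    1/2 on all of \<open>S\<close>.\<close>
  then have "1/2 \<notin> (\<lambda>x. norm (E x)) ` S"
    by force
  ultimately have "\<not> 1/2 < norm (E z)"
    using z unfolding connected_iff_interval
    by (metis image_eqI less_eq_real_def half_gt_zero_iff zero_less_one)
  then have "E z = 0"
    using idempotent_norm[OF idem[OF z]] by simp
  then show ?thesis
    using left[OF z] by (simp add: is_inverse_def E_def)
qed

text \<open>The convolution hypothesis makes \<open>symbol b\<close> a left inverse of
  \<open>symbol a\<close> on a disc of radius larger than 1. At the origin both symbols reduce to
  their coefficients of index 0, where \<open>ab0\<close> gives the other side, and connectedness of
  the disc spreads it.\<close>

lemma plus_factor_symbol:
  fixes a b :: "int \<Rightarrow> 'u::complex_hilbert \<Rightarrow>\<^sub>B 'u"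
  assumes "geometric a" "geometric b" "causal a" "causal b"
    and ba: "\<And>n. ((\<lambda>l. b (n - l) o\<^sub>B a l) has_sum (if n = 0 then id_cblinfun else 0)) UNIV"
    and ab0: "a 0 o\<^sub>B b 0 = id_cblinfun"
  shows "plus_factor (symbol a)" "plus_factor (symbol b)"
    and "z \<in> cball 0 1 \<Longrightarrow> is_inverse (symbol a z) (symbol b z)"
proof -
  obtain r M s N where *: "0 < r" "r < 1" "\<And>n. norm (a n) \<le> M * r ^ nat \<bar>n\<bar>"
    "0 < s" "s < 1" "\<And>n. norm (b n) \<le> N * s ^ nat \<bar>n\<bar>"
    using assms(1,2) unfolding geometric_def by blast
  define t where "t = max r s"
  have t: "0 < t" "t < 1" using * by (auto simp: t_def)
  have M: "0 \<le> M" "0 \<le> N"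
    using order_trans[OF norm_ge_zero *(3)[of 0]] order_trans[OF norm_ge_zero *(6)[of 0]] by simp_all
  have bd: "norm (a n) \<le> M * t ^ nat \<bar>n\<bar>" "norm (b n) \<le> N * t ^ nat \<bar>n\<bar>" for n
    by (rule order_trans[OF *(3)] order_trans[OF *(6)],
        use M * in \<open>auto simp: t_def intro!: mult_left_mono power_mono\<close>)+
  define S where "S = ball (0::complex) (1 / t)"
  have S: "cmod z * t < 1" if "z \<in> S" for z
    using that t by (simp add: S_def field_simps)
  have S1: "open S" "cball 0 1 \<subseteq> S" "connected S" "0 \<in> S"
  proof -
    have "1 < 1 / t" using t by simp
    then show "cball 0 1 \<subseteq> S"
      unfolding S_def by (auto intro: le_less_trans)
  qed (use t in \<open>auto simp: S_def\<close>)
  have diff: "\<exists>f'. has_complex_derivative (symbol a) f' z" "\<exists>f'. has_complex_derivative (symbol b) f' z"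
    if "z \<in> S" for z
    by (rule causal_symbol_differentiable[OF _ t(1) bd(1) S[OF that]]
        causal_symbol_differentiable[OF _ t(1) bd(2) S[OF that]], fact)+
  have cont: "continuous_on S (symbol a)" "continuous_on S (symbol b)"
    using diff S1(1) unfolding has_complex_derivative_iff
    by (auto simp: continuous_on_eq_continuous_at intro: has_derivative_continuous)
  have left: "symbol b z o\<^sub>B symbol a z = id_cblinfun" if "z \<in> S" for z
    using symbol_mult_causal[OF ba assms(4,3) t(1) S[OF that] bd(2,1)] by (simp add: symbol_delta)
  have at0: "symbol c 0 = c 0" for c :: "int \<Rightarrow> 'u \<Rightarrow>\<^sub>B 'u"
  proof -
    have "symbol c 0 = (\<Sum>\<^sub>\<infinity>n::int. if n = 0 then c n else 0)"
      unfolding symbol_def by (intro infsum_cong) (auto simp: scaleC_one scaleC.zero_left)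
    then show ?thesis by (simp only: infsum_single)
  qed
  have inv: "is_inverse (symbol a z) (symbol b z)" if "z \<in> S" for z
    using S1 cont left ab0 that by (intro left_inverse_two_sided[of S _ _ 0]) (simp_all add: at0)
  then have inv': "is_inverse (symbol b z) (symbol a z)" if "z \<in> S" for z
    using that by (simp add: is_inverse_def)
  show "z \<in> cball 0 1 \<Longrightarrow> is_inverse (symbol a z) (symbol b z)"
    using inv S1 by blast
  have plus: "plus_factor f"
    if "\<And>z. z \<in> S \<Longrightarrow> \<exists>f'. has_complex_derivative f f' z"
      "\<And>z. z \<in> S \<Longrightarrow> \<exists>f'. has_complex_derivative g f' z"
      "\<And>z. z \<in> S \<Longrightarrow> is_inverse (f z) (g z)" for f g :: "complex \<Rightarrow> 'u \<Rightarrow>\<^sub>B 'u"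
  proof -
    \<comment> \<open>\<open>op_inv (f z)\<close> is known to agree with \<open>g z\<close> only on
      the open set \<open>S\<close>, so differentiability is carried over locally.\<close>
    have "has_complex_derivative (\<lambda>z. op_inv (f z)) f' z"
      if "has_complex_derivative g f' z" "z \<in> S" for f' z
      using that(1) unfolding has_complex_derivative_iff
      by (rule has_derivative_transform_within_open[OF _ S1(1) that(2)])
        (simp add: op_inv_eq[OF \<open>\<And>z. z \<in> S \<Longrightarrow> is_inverse (f z) (g z)\<close>])
    then show ?thesis
      unfolding plus_factor_def invertible_on_nhd_def analytic_on_nhd_def op_invertible_def
      using that S1(1,2) by metis
  qed
  show "plus_factor (symbol a)"
    by (rule plus[OF diff inv])
  show "plus_factor (symbol b)"
    by (rule plus[OF diff(2,1) inv'])
qed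

section \<open>Reflection between the disc and its exterior\<close>

lemma exterior_neighbourhood:
  assumes "open S" "cball 0 1 \<subseteq> S"
  obtains T :: "complex set"
  where "open T" "closure \<E> \<subseteq> T" "\<And>z. z \<in> T \<Longrightarrow> z \<noteq> 0 \<and> 1 / z \<in> S"
proof (rule that[of "- {0} \<inter> (\<lambda>z. 1 / z) -` S"])
  show "open (- {0} \<inter> (\<lambda>z. 1 / z) -` S)"
    by (intro continuous_open_preimage assms(1)) (auto intro!: continuous_intros)
  have "1 / z \<in> S" if "cmod z \<ge> 1" for z
    using that assms(2) by (auto simp: norm_divide divide_le_eq_1 intro!: subsetD[OF assms(2)])
  then show "closure \<E> \<subseteq> - {0} \<inter> (\<lambda>z. 1 / z) -` S"
    by (auto simp: closure_complement)
qed auto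

lemma analytic_reflect:
  assumes "analytic_on_nhd f (cball 0 1)"
  shows "analytic_on_nhd (\<lambda>z. f (1 / z)) (closure \<E>)" "analytic_at_infinity (\<lambda>z. f (1 / z))"
proof -
  obtain S where S: "open S" "cball 0 1 \<subseteq> S" "\<And>z. z \<in> S \<Longrightarrow> \<exists>f'. has_complex_derivative f f' z"
    using assms unfolding analytic_on_nhd_def by blast
  obtain T where T: "open T" "closure \<E> \<subseteq> T" "\<And>z. z \<in> T \<Longrightarrow> z \<noteq> 0 \<and> 1 / z \<in> S"
    using exterior_neighbourhood[OF S(1,2)] by blast
  have "\<exists>f'. has_complex_derivative (\<lambda>z. f (1 / z)) f' z" if "z \<in> T" for z
  proof -
    have z: "z \<noteq> 0" "1 / z \<in> S" using T(3)[OF that] by auto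
    obtain f' where f': "(f has_derivative (\<lambda>h. h *\<^sub>C f')) (at (1 / z))"
      using S(3)[OF z(2)] by (auto simp: has_complex_derivative_iff)
    have "((\<lambda>z. 1 / z) has_derivative (\<lambda>h. h * (- 1 / z\<^sup>2))) (at z)"
      using z by (auto intro!: derivative_eq_intros simp: power2_eq_square)
    from has_derivative_compose[OF this f']
    have "((\<lambda>z. f (1 / z)) has_derivative (\<lambda>h. h *\<^sub>C ((- 1 / z\<^sup>2) *\<^sub>C f'))) (at z)"
      by (simp only: scaleC_scaleC)
    then show ?thesis
      by (auto simp: has_complex_derivative_iff)
  qed
  then show "analytic_on_nhd (\<lambda>z. f (1 / z)) (closure \<E>)"
    unfolding analytic_on_nhd_def using T(1,2) by blast
  \<comment> \<open>The value at infinity is \<open>f 0\<close>; with it the function in the local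
    coordinate at infinity is \<open>f\<close> itself.\<close>
  have "(\<lambda>w. if w = 0 then f 0 else f (1 / (1 / w))) = f"
    by auto
  moreover have "analytic_on_nhd f {0}"
    using S unfolding analytic_on_nhd_def by (intro exI[of _ S]) auto
  ultimately show "analytic_at_infinity (\<lambda>z. f (1 / z))"
    unfolding analytic_at_infinity_def by metis
qed

lemma minus_factor_reflect:
  assumes "plus_factor W"
  shows "minus_factor (\<lambda>z. W (1 / z))"
proof -
  obtain S where S: "open S" "cball 0 1 \<subseteq> S" "\<And>z. z \<in> S \<Longrightarrow> op_invertible (W z)"
    using assms unfolding plus_factor_def invertible_on_nhd_def by blast
  obtain T where T: "open T" "closure \<E> \<subseteq> T" "\<And>z. z \<in> T \<Longrightarrow> z \<noteq> 0 \<and> 1 / z \<in> S"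
    using exterior_neighbourhood[OF S(1,2)] by blast
  have "invertible_on_nhd (\<lambda>z. W (1 / z)) (closure \<E>)"
    unfolding invertible_on_nhd_def using T S(3) by blast
  then show ?thesis
    using assms analytic_reflect[of W] analytic_reflect[of "\<lambda>z. op_inv (W z)"]
    by (simp add: minus_factor_def plus_factor_def)
qed

section \<open>Canonical factorization\<close>

text \<open>Both factors are delivered as plus factors, the first one in the variable
  \<open>1 / z\<close>, so that the same statement serves the reversed sequence.\<close>

lemma canonical_factors:
  fixes f :: "int \<Rightarrow> 'u::complex_hilbert \<Rightarrow>\<^sub>B 'u"
  assumes f: "geometric f" and q: "q < 1" and bound: "\<And>z. z \<in> \<T> \<Longrightarrow> norm (symbol f z) \<le> q"
  obtains V W where "plus_factor V" "plus_factor W"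
    "\<And>z. z \<in> \<T> \<Longrightarrow> id_cblinfun - symbol f z = V (1 / z) o\<^sub>B W z"
proof -
  obtain X V Y Q and T S :: "'u \<Rightarrow>\<^sub>B 'u"
    where geo: "geometric X" "geometric V" "geometric Y" "geometric Q"
    and causal: "causal X" "causal Q" "causal (\<lambda>n. V (- n))" "causal (\<lambda>n. Y (- n))"
    and T: "is_inverse T S" and at0: "X 0 = T" "Y 0 = T" "V 0 = id_cblinfun" "Q 0 = id_cblinfun"
    and LX: "(1 - toeplitz f) * toeplitz X = toeplitz V"
    and QX: "\<And>n. ((\<lambda>l. Q (n - l) o\<^sub>B X l) has_sum (if n = 0 then T else 0)) UNIV"
    and YV: "\<And>n. ((\<lambda>l. Y (n - l) o\<^sub>B V l) has_sum (if n = 0 then T else 0)) UNIV"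
    using factor_coefficients[OF f q bound] by blast
  have ST: "S o\<^sub>B T = id_cblinfun" "T o\<^sub>B S = id_cblinfun"
    using T by (auto simp: is_inverse_def)
  have delta: "S o\<^sub>B (if n = 0 then T else 0) = (if n = 0 then id_cblinfun else 0)" for n :: int
    by (simp add: ST compose.zero_right)
  \<comment> \<open>Composing with \<open>S\<close> normalizes the constant product
    \<open>Q X = T\<close> to the identity.\<close>
  have "((\<lambda>l. (S o\<^sub>B Q (n - l)) o\<^sub>B X l) has_sum (if n = 0 then id_cblinfun else 0)) UNIV" for n
    using has_sum_bounded_linear[OF compose.bounded_linear_right QX[of n], of S]
    by (simp add: delta cblinfun_compose_assoc)
  note plus = plus_factor_symbol[OF geo(1) geometric_compose[OF geo(4)] causal(1) _ this]
  have plus_W: "plus_factor (symbol (\<lambda>n. S o\<^sub>B Q n))"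
    and inv: "z \<in> cball 0 1 \<Longrightarrow> is_inverse (symbol X z) (symbol (\<lambda>n. S o\<^sub>B Q n) z)" for z
    by (rule plus; use causal at0 ST in \<open>simp add: causal_def compose_simps\<close>)+
  \<comment> \<open>The same normalization of \<open>Y V = T\<close> after replacing
    \<open>n\<close> by \<open>- n\<close>, which makes \<open>V\<close> causal in
    \<open>1 / z\<close>; it provides the inverse of the minus factor.\<close>
  have "((\<lambda>l. (S o\<^sub>B Y (- (n - l))) o\<^sub>B V (- l)) has_sum (if n = 0 then id_cblinfun else 0)) UNIV" for n
  proof -
    have "((\<lambda>l. S o\<^sub>B (Y (- n - l) o\<^sub>B V l)) has_sum (if n = 0 then id_cblinfun else 0)) UNIV"
      using has_sum_bounded_linear[OF compose.bounded_linear_right YV[of "- n"], of S]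
      by (simp add: delta)
    also have "?this \<longleftrightarrow> ?thesis"
      by (rule has_sum_reindex_bij_witness[where i = uminus and j = uminus])
        (auto simp: cblinfun_compose_assoc minus_diff_commute)
    finally show ?thesis .
  qed
  note minus = plus_factor_symbol[OF geometric_reverse[OF geo(2)]
      geometric_compose[OF geometric_reverse[OF geo(3)]] causal(3) _ this]
  have plus_V: "plus_factor (symbol (\<lambda>n. V (- n)))"
    by (rule minus; use causal at0 ST in \<open>simp add: causal_def compose_simps\<close>)
  define g where "g n = (if n = 0 then id_cblinfun else 0) - f n" for n
  have gg: "geometric g"
    using geometric_column[of "1 - toeplitz f" 0]
    by (simp add: g_def[abs_def] entry_simps entry_toeplitz[OF f])
  have tg: "1 - toeplitz f = toeplitz g"
    by (rule opmat_eqI) (simp add: entry_toeplitz[OF gg], simp add: g_def entry_simps entry_toeplitz[OF f])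
  show thesis
  proof (rule that[OF plus_V plus_W])
    fix z :: complex assume z: "z \<in> \<T>"
    let ?W = "symbol (\<lambda>n. S o\<^sub>B Q n) z"
    have XW: "symbol X z o\<^sub>B ?W = id_cblinfun"
      using inv[of z] z by (simp add: is_inverse_def)
    have "((\<lambda>n. z powi n *\<^sub>C g n) has_sum id_cblinfun + - symbol f z) UNIV"
    proof -
      have "((\<lambda>n::int. if n = 0 then id_cblinfun else 0) has_sum (id_cblinfun :: 'u \<Rightarrow>\<^sub>B 'u)) UNIV"
        by (rule has_sum_finite_neutralI[where B = "{0::int}"]) auto
      moreover have "((\<lambda>n. z powi n *\<^sub>C f n) has_sum symbol f z) UNIV"
        unfolding symbol_def by (rule has_sum_infsum[OF abs_summable_summable[OF geometric_summable_circle[OF f z]]])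
      ultimately have "((\<lambda>n. (if n = 0 then id_cblinfun else 0) + - (z powi n *\<^sub>C f n)) has_sum
          id_cblinfun + - symbol f z) UNIV"
        by (intro has_sum_add has_sum_minus)
      then show ?thesis
        by (rule has_sum_cong[THEN iffD1, rotated]) (auto simp: g_def scaleC.diff_right scaleC_one scaleC.zero_right)
    qed
    then have "id_cblinfun - symbol f z = symbol g z"
      by (simp add: symbol_def infsumI)
    also have "\<dots> = symbol g z o\<^sub>B symbol X z o\<^sub>B ?W"
      by (simp add: cblinfun_compose_assoc XW cblinfun_compose_id_right)
    also have "symbol g z o\<^sub>B symbol X z = symbol V z"
      using symbol_mult_circle[OF gg geo(1) _ geo(2) z] LX tg by simp
    also have "symbol V z = symbol (\<lambda>n. V (- n)) (1 / z)"
      by (simp add: symbol_reverse)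
    finally show "id_cblinfun - symbol f z = symbol (\<lambda>n. V (- n)) (1 / z) o\<^sub>B ?W" .
  qed
qed

lemma dichotomous_circle:
  assumes "dichotomous A"
  shows "\<T> \<subseteq> regular_set A"
proof
  fix z :: complex assume z: "z \<in> \<T>"
  then have "1 / z \<notin> op_spectrum A" and z0: "z \<noteq> 0"
    using assms by (auto simp: dichotomous_def disjoint_iff norm_divide)
  then obtain S where S: "is_inverse ((1 / z) *\<^sub>C id_cblinfun - A) S"
    by (auto simp: op_spectrum_def op_invertible_def)
  have "id_cblinfun - z *\<^sub>C A = z *\<^sub>C ((1 / z) *\<^sub>C id_cblinfun - A)"
    using z0 by (simp add: scaleC.diff_right scaleC_scaleC scaleC_one)
  then have "is_inverse (id_cblinfun - z *\<^sub>C A) ((1 / z) *\<^sub>C S)"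
    using S z0 by (simp only: is_inverse_def compose_scaleC_left compose_scaleC_right scaleC_scaleC)
      (simp add: scaleC_one)
  then show "z \<in> regular_set A"
    by (auto simp: regular_set_def op_invertible_def)
qed

lemma transfer_function_laurent:
  fixes A :: "'x::complex_hilbert \<Rightarrow>\<^sub>B 'x" and D :: "'u::complex_hilbert \<Rightarrow>\<^sub>B 'u"
  assumes "dichotomous A"
  obtains f where "geometric f" "\<And>z. z \<in> \<T> \<Longrightarrow> symbol f z = transfer_function A B C D z"
proof -
  obtain c r M where r: "0 < r" "r < 1" and c: "\<And>n. norm (c n) \<le> M * r ^ nat \<bar>n\<bar>"
    and sum: "\<And>z. z \<in> \<T> \<Longrightarrow> ((\<lambda>n. z powi n *\<^sub>C c n) has_sum resolvent A z) UNIV"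
    using resolvent_laurent[OF dichotomous_circle[OF assms]] by metis
  have M: "0 \<le> M" using order_trans[OF norm_ge_zero c[of 0]] by simp
  \<comment> \<open>The factor \<open>z\<close> in front of \<open>C\<close> moves the resolvent
    coefficients up by one index.\<close>
  define f where "f n = (if n = 0 then D else 0) + (C o\<^sub>B c (n - 1) o\<^sub>B B)" for n
  show thesis
  proof (rule that[of f])
    show "geometric f"
    proof (rule geometricI[OF r])
      fix n :: int
      have "r ^ (nat \<bar>n - 1\<bar> + 1) \<le> r ^ nat \<bar>n\<bar>"
        using r by (intro power_decreasing) auto
      then have "M * r ^ nat \<bar>n - 1\<bar> \<le> M / r * r ^ nat \<bar>n\<bar>"
        using r M by (simp add: field_simps mult_left_mono)
      then have "norm (c (n - 1)) \<le> M / r * r ^ nat \<bar>n\<bar>"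
        by (rule order_trans[OF c])
      then have "norm (C o\<^sub>B c (n - 1) o\<^sub>B B) \<le> norm C * (M / r * r ^ nat \<bar>n\<bar>) * norm B"
        by (intro order_trans[OF norm_cblinfun_compose] mult_right_mono mult_left_mono norm_ge_zero)
      moreover have "norm (if n = 0 then D else 0) \<le> norm D * r ^ nat \<bar>n\<bar>"
        using r by auto
      ultimately have "norm (f n) \<le> norm D * r ^ nat \<bar>n\<bar> + norm C * (M / r * r ^ nat \<bar>n\<bar>) * norm B"
        unfolding f_def by (intro norm_triangle_le) simp
      also have "\<dots> = (norm D + norm C * (M / r) * norm B) * r ^ nat \<bar>n\<bar>"
        by (simp add: algebra_simps)
      finally show "norm (f n) \<le> (norm D + norm C * (M / r) * norm B) * r ^ nat \<bar>n\<bar>" .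
    qed
    fix z :: complex assume z: "z \<in> \<T>"
    then have z0: "z \<noteq> 0" by auto
    have pow: "z * z powi (n - 1) = z powi n" for n
      using z0 by (simp add: power_int_diff)
    have "((\<lambda>n. z powi (n - 1) *\<^sub>C c (n - 1)) has_sum resolvent A z) UNIV \<longleftrightarrow>
        ((\<lambda>n. z powi n *\<^sub>C c n) has_sum resolvent A z) UNIV"
      by (rule has_sum_reindex_bij_witness[where i = "\<lambda>n. n + 1" and j = "\<lambda>n. n - 1"]) auto
    then have "((\<lambda>n. z powi (n - 1) *\<^sub>C c (n - 1)) has_sum resolvent A z) UNIV"
      using sum[OF z] by simp
    then have "((\<lambda>n. z *\<^sub>C (C o\<^sub>B (z powi (n - 1) *\<^sub>C c (n - 1)) o\<^sub>B B)) has_sum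
        z *\<^sub>C (C o\<^sub>B resolvent A z o\<^sub>B B)) UNIV"
      by (intro has_sum_bounded_linear[OF scaleC.bounded_linear_right]
          has_sum_bounded_linear[OF compose.bounded_linear_left]
          has_sum_bounded_linear[OF compose.bounded_linear_right])
    moreover have "((\<lambda>n::int. if n = 0 then D else 0) has_sum D) UNIV"
      by (rule has_sum_finite_neutralI[where B = "{0::int}"]) auto
    ultimately have "((\<lambda>n. (if n = 0 then D else 0) + z *\<^sub>C (C o\<^sub>B (z powi (n - 1) *\<^sub>C c (n - 1)) o\<^sub>B B)) has_sum
        transfer_function A B C D z) UNIV"
      unfolding transfer_function_def resolvent_def[symmetric] by (intro has_sum_add)
    moreover have "(if n = 0 then D else 0) + z *\<^sub>C (C o\<^sub>B (z powi (n - 1) *\<^sub>C c (n - 1)) o\<^sub>B B) =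
        z powi n *\<^sub>C f n" for n
      by (auto simp: f_def compose_scaleC_left compose_scaleC_right scaleC_scaleC pow
          scaleC_add_right scaleC.zero_right scaleC_one z0)
    ultimately show "symbol f z = transfer_function A B C D z"
      by (simp add: symbol_def infsumI)
  qed
qed

theorem theorem1p1:
  fixes A :: "'x::complex_hilbert \<Rightarrow>\<^sub>B 'x"
    and B :: "'u::complex_hilbert \<Rightarrow>\<^sub>B 'x"
    and C :: "'x \<Rightarrow>\<^sub>B 'u"
    and D :: "'u \<Rightarrow>\<^sub>B 'u"
    and F G :: "complex \<Rightarrow> 'u \<Rightarrow>\<^sub>B 'u"
  assumes "dichotomous A"
    and "op_invertible (id_cblinfun + D)"
    and "F = transfer_function A B C D"
    and "G = (\<lambda>z. id_cblinfun + F z)"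
    and "sup_norm_circle F < 1"
  shows "(\<exists>Vm Vp. right_canonical_factorization G Vm Vp) \<and>
         (\<exists>Wp Wm. left_canonical_factorization G Wp Wm)"
proof -
  obtain f where f: "geometric f" "\<And>z. z \<in> \<T> \<Longrightarrow> symbol f z = F z"
    using transfer_function_laurent[OF assms(1), of B C D] assms(3) by blast
  define h where "h n = - f n" for n
  have h: "geometric h"
    using f(1) by (simp add: geometric_def h_def)
  have symbol_h: "symbol h z = - F z" if "z \<in> \<T>" for z
    using f(2)[OF that] by (simp add: symbol_def h_def scaleC.minus_right infsum_uminus)
  \<comment> \<open>A supremum of reals dominates its members only if they are bounded above; the
    sum of the coefficient norms is such a bound.\<close>
  have "norm (F z) \<le> (\<Sum>\<^sub>\<infinity>n. norm (f n))" if "z \<in> \<T>" for z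
    using norm_infsum_bound[OF geometric_summable_circle[OF f(1) that]] that f(2)[OF that]
    by (simp add: symbol_def norm_scaleC norm_power_int)
  then have bound: "norm (F z) \<le> sup_norm_circle F" if "z \<in> \<T>" for z
    unfolding sup_norm_circle_def using that by (intro cSUP_upper bdd_aboveI2)
  obtain V W where VW: "plus_factor V" "plus_factor W"
    "\<And>z. z \<in> \<T> \<Longrightarrow> id_cblinfun - symbol h z = V (1 / z) o\<^sub>B W z"
    using canonical_factors[OF h assms(5)] bound symbol_h by (metis norm_minus_cancel)
  have inv_circle: "1 / z \<in> \<T>" if "z \<in> \<T>" for z :: complex
    using that by (simp add: norm_divide)
  \<comment> \<open>The reversed sequence has symbol \<open>h\<close> at \<open>1 / z\<close>.
    Factoring there and replacing \<open>z\<close> by \<open>1 / z\<close> interchanges the inner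
    and the outer factor, which is the left factorization.\<close>
  have "norm (symbol (\<lambda>n. h (- n)) z) \<le> sup_norm_circle F" if "z \<in> \<T>" for z
    using bound inv_circle[OF that] symbol_h by (simp add: symbol_reverse)
  then obtain V' W' where VW': "plus_factor V'" "plus_factor W'"
    "\<And>z. z \<in> \<T> \<Longrightarrow> id_cblinfun - symbol (\<lambda>n. h (- n)) z = V' (1 / z) o\<^sub>B W' z"
    using canonical_factors[OF geometric_reverse[OF h] assms(5)] by metis
  have "right_canonical_factorization G (\<lambda>z. V (1 / z)) W"
    unfolding right_canonical_factorization_def
    using VW minus_factor_reflect[OF VW(1)] symbol_h by (simp add: assms(4))
  moreover have "left_canonical_factorization G V' (\<lambda>z. W' (1 / z))"
    unfolding left_canonical_factorization_def
  proof (intro conjI ballI)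
    fix z :: complex assume z: "z \<in> \<T>"
    show "G z = V' z o\<^sub>B W' (1 / z)"
      using VW'(3)[OF inv_circle[OF z]] symbol_h[OF z] by (simp add: symbol_reverse assms(4))
  qed (use VW' minus_factor_reflect in auto)
  ultimately show ?thesis by blast
qed

end
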